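(* Let $0\le\gamma\le1$, $k\ge8$, and let $f,g,h$ be functions on $\mathbb R^3$. Then: (1) $$\langle Q(f,g),h\langle v\rangle^{2k}\rangle\le\frac{C_1}{\sqrt k}\|g\|_{L^1_\gamma}\|f\|_{L^2_{k+\gamma/2}}\|h\|_{L^2_{k+\gamma/2}}+C_2\|f\|_{L^1_\gamma}\|g\|_{L^2_{k+\gamma/2}}\|h\|_{L^2_{k+\gamma/2}}+C_k\|f\|_{L^2_k}\|g\|_{L^2_k}\|h\|_{L^2_k},$$ (2) $$\|Q(f,g)\|_{L^2_k}\le\frac{C_1}{\sqrt k}\|g\|_{L^1_\gamma}\|f\|_{L^2_{k+\gamma}}+C_2\|f\|_{L^1_\gamma}\|g\|_{L^2_{k+\gamma}}+C_k\|f\|_{L^2_k}\|g\|_{L^2_k},$$ where $C_1,C_2$ are absolute constants and $C_k$ depends only on $k$.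
   Context: $\langle v\rangle=\sqrt{1+|v|^2}$, $\|f\|_{L^p_l}=\big(\int_{\mathbb R^3}|f|^p\langle v\rangle^{lp}dv\big)^{1/p}$, $\langle f,g\rangle=\int_{\mathbb R^3}fg\,dv$. The collision operator is $$Q(g,f)(v)=\int_{\mathbb{R}^3}\int_{\mathbb{S}^2}|v-v_*|^\gamma\big[g(v_*')f(v')-g(v_* )f(v)\big]\,d\sigma\,dv_*,$$ $v'=\frac{v+v_*}{2}+\frac{|v-v_*|}{2}\sigma$, $v_*'=\frac{v+v_*}{2}-\frac{|v-v_*|}{2}\sigma$. *)

theory Defs
  imports "HOL-Analysis.Analysis"
begin

definition jb :: "real^3 \<Rightarrow> real" where
  "jb v = sqrt (1 + (norm v)\<^sup>2)"

definition wint :: "real \<Rightarrow> real \<Rightarrow> (real^3 \<Rightarrow> real) \<Rightarrow> ennreal" where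
  "wint p l f = (\<integral>\<^sup>+ v. ennreal (\<bar>f v\<bar> powr p * jb v powr (l * p)) \<partial>lborel)"

definition in_wL :: "real \<Rightarrow> real \<Rightarrow> (real^3 \<Rightarrow> real) \<Rightarrow> bool" where
  "in_wL p l f \<longleftrightarrow> f \<in> borel_measurable lborel \<and> wint p l f < \<infinity>"

definition wnorm :: "real \<Rightarrow> real \<Rightarrow> (real^3 \<Rightarrow> real) \<Rightarrow> real" where
  "wnorm p l f = enn2real (wint p l f) powr (1 / p)"

text \<open>Surface measure on the unit sphere S^2: the push-forward of 3 times Lebesgue
  measure on the unit ball under radial projection (cone measure = surface measure).\<close>
definition sphere_measure :: "(real^3) measure" where
  "sphere_measure = distr (density lborel (\<lambda>v. ennreal (3 * indicator (ball 0 1) v)))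
                          lborel (\<lambda>v. (1 / norm v) *\<^sub>R v)"

definition vprime :: "real^3 \<Rightarrow> real^3 \<Rightarrow> real^3 \<Rightarrow> real^3" where
  "vprime v w \<sigma> = (1/2) *\<^sub>R (v + w) + (norm (v - w) / 2) *\<^sub>R \<sigma>"

definition vsprime :: "real^3 \<Rightarrow> real^3 \<Rightarrow> real^3 \<Rightarrow> real^3" where
  "vsprime v w \<sigma> = (1/2) *\<^sub>R (v + w) - (norm (v - w) / 2) *\<^sub>R \<sigma>"

text \<open>Boltzmann collision operator Q(g,f)(v) with kernel |v - v_*|^gamma
  (integration variable w = v_*).\<close>
definition Qcol :: "real \<Rightarrow> (real^3 \<Rightarrow> real) \<Rightarrow> (real^3 \<Rightarrow> real) \<Rightarrow> real^3 \<Rightarrow> real" where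
  "Qcol \<gamma> g f v = (\<integral> (w, \<sigma>). norm (v - w) powr \<gamma> *
       (g (vsprime v w \<sigma>) * f (vprime v w \<sigma>) - g w * f v) \<partial>(lborel \<Otimes>\<^sub>M sphere_measure))"

end

theory Submission
  imports Defs
begin

text \<open>
  Write \<open>s = |v' - v| / |v - v\<^sub>*| = sin (\<theta>/2)\<close>. After the pre-post-collisional change of variables the gain
  term, tested against \<open>H\<close>, is an integral of \<open>|v - v\<^sub>*|\<^sup>\<gamma> f(v\<^sub>*) g(v) H(v') \<langle>v'\<rangle>\<^sup>k\<close>; since \<open>v'\<close> is
  symmetric in \<open>v\<close> and \<open>v\<^sub>*\<close>, only the region \<open>\<langle>v\<rangle> \<le> \<langle>v\<^sub>*\<rangle>\<close> matters. There
  \<open>\<langle>v'\<rangle> \<le> s\<langle>v\<^sub>*\<rangle> + 2\<langle>v\<rangle>\<close> gives \<open>\<langle>v'\<rangle>\<^sup>k \<le> 2 s\<^sup>k\<langle>v\<^sub>*\<rangle>\<^sup>k + C\<^sub>k \<langle>v\<rangle>\<langle>v\<^sub>*\<rangle>\<^bsup>k-1\<^esup>\<close>, where the second term has lost one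
  power of the large weight and is therefore bounded by the norms of \<open>L\<^sup>2\<^sub>k\<close> alone.
  For the first term the Cauchy-Schwarz inequality with the angular factor \<open>s\<^bsup>k-1\<^esup> = s\<^bsup>k-1-2/3\<^esup> s\<^bsup>2/3\<^esup>\<close> leaves the
  angular integral of \<open>s\<^bsup>2(k-1)-4/3\<^esup>\<close>, of order \<open>1/k\<close>, which is the source of \<open>1/sqrt k\<close>, and
  an integral of \<open>H(v')\<^sup>2 s\<^bsup>4/3\<^esup>\<close>, in which the Jacobian \<open>s\<^sup>2/4\<close> of \<open>v\<^sub>* \<mapsto> v'\<close> is compensated by an integrable
  angular singularity. The second inequality follows by duality from the same estimate with all of the weight \<open>\<langle>\<cdot>\<rangle>\<^sup>\<gamma>\<close> on \<open>f\<close> or \<open>g\<close>.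
\<close>

section \<open>The surface measure of the sphere\<close>

text \<open>The exponent 2/3 balances two singularities. Splitting off s^a in the Cauchy-Schwarz
  inequality leaves, for the lower-order term, (s^2)^(-a) in one factor; this is integrable for a <
  1, because spherical caps have area linear in s^2. The other factor contains s^(2a), which is s^2
  times s^(2a-2). After w -> v' the number s is |n . \<sigma>| with n the unit vector along v' - v,
  and bands have area linear in their width, so 2 - 2a < 1 is required. At a = 2/3 both singular
  exponents are 2/3. Linear area bounds are all that is asked of the sphere, so it is never
  parametrised by angles. A parameter l tells how much of the weight \<gamma> falls on the test
  function: \<gamma>/2 for the first inequality, 0 for the second. The move is paid for with s^l,
  through s |v - w| = |v' - v| <= <v><v'>; this is why s^(k-1) remains and not s^k. No cancellation
  between gain and loss is exploited. The loss term has no small angular factor, which explains the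
  asymmetry between C_1/sqrt k and C_2. All estimates are made on nonnegative integrals, where
  exchanging the order needs no integrability.\<close>

lemma sets_sphere_measure [measurable_cong, simp]: "sets sphere_measure = sets borel"
  by (simp add: sphere_measure_def)

lemma space_sphere_measure [simp]: "space sphere_measure = UNIV"
  by (simp add: sphere_measure_def)

lemma nn_integral_sphere_measure:
  assumes [measurable]: "\<phi> \<in> borel_measurable borel"
  shows "(\<integral>\<^sup>+\<sigma>. \<phi> \<sigma> \<partial>sphere_measure)
    = (\<integral>\<^sup>+x. ennreal (3 * indicator (ball 0 1) x) * \<phi> ((1 / norm x) *\<^sub>R x) \<partial>lborel)"
proof -
  have [measurable]: "ball (0::real^3) 1 \<in> sets borel"
    by simp
  have "(\<integral>\<^sup>+\<sigma>. \<phi> \<sigma> \<partial>sphere_measure) = (\<integral>\<^sup>+x. \<phi> ((1 / norm x) *\<^sub>R x)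
      \<partial>density lborel (\<lambda>v. ennreal (3 * indicator (ball 0 1) v)))"
    unfolding sphere_measure_def by (rule nn_integral_distr) measurable
  also have "\<dots> = (\<integral>\<^sup>+x. ennreal (3 * indicator (ball 0 1) x) * \<phi> ((1 / norm x) *\<^sub>R x) \<partial>lborel)"
    by (rule nn_integral_density) measurable
  finally show ?thesis .
qed

text \<open>Turns areas on the sphere into volumes of cones inside the unit ball, which can be
  enclosed in boxes.\<close>

lemma emeasure_sphere_measure:
  assumes [measurable]: "A \<in> sets borel"
  shows "emeasure sphere_measure A
    = 3 * emeasure lborel {x. norm x < 1 \<and> (1 / norm x) *\<^sub>R x \<in> A}"
proof -
  have "emeasure sphere_measure A = (\<integral>\<^sup>+\<sigma>. indicator A \<sigma> \<partial>sphere_measure)"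
    by simp
  also have "\<dots> = (\<integral>\<^sup>+x. 3 * indicator {x. norm x < 1 \<and> (1 / norm x) *\<^sub>R x \<in> A} x \<partial>lborel)"
    by (subst nn_integral_sphere_measure) (auto intro!: nn_integral_cong simp: indicator_def)
  also have "\<dots> = 3 * emeasure lborel {x. norm x < 1 \<and> (1 / norm x) *\<^sub>R x \<in> A}"
    by (subst nn_integral_cmult_indicator) auto
  finally show ?thesis .
qed

lemma AE_norm_sphere_measure: "AE \<sigma> in sphere_measure. norm \<sigma> = 1"
proof -
  have [measurable]: "ball (0::real^3) 1 \<in> sets borel"
    by simp
  have "AE x in lborel. (x::real^3) \<noteq> 0"
    by (rule AE_lborel_singleton)
  then have "AE x in lborel. 0 < ennreal (3 * indicator (ball 0 1) x) \<longrightarrow> norm ((1 / norm x) *\<^sub>R (x::real^3)) = 1"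
    by eventually_elim auto
  then show ?thesis
    unfolding sphere_measure_def
    by (subst AE_distr_iff, (measurable; fail), (measurable; fail), subst AE_density, measurable)
qed

lemma emeasure_cbox_real3:
  "emeasure lborel (cbox (- vector [a, b, c]) (vector [a, b, c] :: real^3)) = ennreal (8 * a * b * c)"
  if "0 \<le> a" "0 \<le> b" "0 \<le> c"
proof -
  have "0 \<in> cbox (- vector [a, b, c]) (vector [a, b, c] :: real^3)"
    unfolding mem_box_cart forall_3 using that by simp
  then have "measure lborel (cbox (- vector [a, b, c]) (vector [a, b, c] :: real^3))
      = (\<Prod>i\<in>UNIV. vector [a, b, c] $ i - (- vector [a, b, c]) $ (i::3))"
    by (intro content_cbox_cart) auto
  also have "\<dots> = 8 * a * b * c"
    unfolding UNIV_3 by simp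
  finally have "measure lborel (cbox (- vector [a, b, c]) (vector [a, b, c] :: real^3)) = 8 * a * b * c" .
  moreover have "emeasure lborel (cbox (- vector [a, b, c]) (vector [a, b, c] :: real^3)) \<noteq> \<infinity>"
    using emeasure_lborel_cbox_finite[of "- vector [a, b, c]" "vector [a, b, c] :: real^3"] by simp
  ultimately show ?thesis
    by (simp add: emeasure_eq_ennreal_measure)
qed

text \<open>Rotations preserve volume, so a cone with arbitrary axis may be measured after its axis
  has been turned into the first coordinate axis. Boundedness of the image makes \<open>S\<close> a
  set of finite measure, as the invariance of \<open>measure\<close> requires.\<close>

lemma emeasure_lborel_orthogonal_image_le:
  fixes f :: "real^3 \<Rightarrow> real^3"
  assumes f: "orthogonal_transformation f" and S: "f ` S \<subseteq> cbox l u" "S \<in> sets borel"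
  shows "emeasure lborel S \<le> emeasure lborel (cbox l u)"
proof -
  have "bounded (f ` S)"
    using S(1) bounded_cbox bounded_subset by blast
  then have "bounded S"
    using f by (auto simp: bounded_iff orthogonal_transformation)
  then have Sm: "S \<in> lmeasurable"
    using S(2) by (simp add: bounded_set_imp_lmeasurable)
  then have "measure lebesgue S = measure lebesgue (f ` S)"
    by (simp add: measure_orthogonal_image f)
  also have "\<dots> \<le> measure lebesgue (cbox l u)"
    using S(1) Sm f by (intro measure_mono_fmeasurable) (auto simp: fmeasurableD measurable_orthogonal_image)
  finally have *: "measure lebesgue S \<le> measure lebesgue (cbox l u)" .
  have "emeasure lborel S = emeasure lebesgue S"
    using S(2) by simp
  also have "\<dots> = ennreal (measure lebesgue S)"
    using Sm by (simp add: emeasure_eq_measure2)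
  also have "\<dots> \<le> ennreal (measure lebesgue (cbox l u))"
    using * by (rule ennreal_leI)
  also have "\<dots> = emeasure lebesgue (cbox l u)"
    by (simp add: emeasure_eq_measure2)
  finally show ?thesis by simp
qed

text \<open>Once \<omega> is rotated to the first axis, the cone over the band fits into the box
  with half-widths t, 1, 1 and volume 8t; the density 3 makes this 24t.\<close>

lemma sphere_measure_band:
  fixes \<omega> :: "real^3"
  assumes "norm \<omega> = 1" "0 \<le> t"
  shows "emeasure sphere_measure {\<sigma>. \<bar>\<omega> \<bullet> \<sigma>\<bar> \<le> t} \<le> ennreal (24 * t)"
proof -
  obtain f :: "real^3 \<Rightarrow> real^3" where f: "orthogonal_transformation f" "f \<omega> = axis 1 1"
    using orthogonal_transformation_exists_1[of \<omega> "axis 1 1"] assms(1) by auto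
  let ?S = "{x. norm x < 1 \<and> (1 / norm x) *\<^sub>R x \<in> {\<sigma>. \<bar>\<omega> \<bullet> \<sigma>\<bar> \<le> t}}"
  have "f x \<in> cbox (- vector [t, 1, 1]) (vector [t, 1, 1])" if "x \<in> ?S" for x
  proof -
    have n: "norm (f x) < 1"
      using that f by (simp add: orthogonal_transformation)
    have "\<omega> \<bullet> x = f x $ 1"
      using f unfolding orthogonal_transformation_def
      by (metis inner_commute inner_axis inner_real_def mult.right_neutral)
    moreover have "\<bar>\<omega> \<bullet> x\<bar> \<le> t"
    proof -
      have "\<bar>\<omega> \<bullet> x\<bar> \<le> t * norm x"
        using that by (cases "x = 0") (auto simp: abs_mult field_simps)
      also have "\<dots> \<le> t * 1"
        using that assms(2) by (intro mult_left_mono) auto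
      finally show ?thesis by simp
    qed
    ultimately have "\<bar>f x $ 1\<bar> \<le> t" "\<bar>f x $ 2\<bar> \<le> 1" "\<bar>f x $ 3\<bar> \<le> 1"
      using component_le_norm_cart[of "f x" 2] component_le_norm_cart[of "f x" 3] n by linarith+
    then show ?thesis
      by (simp add: mem_box_cart forall_3 abs_le_iff minus_le_iff)
  qed
  then have "emeasure lborel ?S \<le> emeasure lborel (cbox (- vector [t, 1, 1]) (vector [t, 1, 1] :: real^3))"
    by (intro emeasure_lborel_orthogonal_image_le[OF f(1)]) auto
  also have "\<dots> = ennreal (8 * t)"
    using assms by (simp add: emeasure_cbox_real3)
  finally have "3 * emeasure lborel ?S \<le> ennreal 3 * ennreal (8 * t)"
    by (intro mult_mono) auto
  also have "\<dots> = ennreal (24 * t)"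
    using assms(2) by (subst ennreal_mult[symmetric]) auto
  finally show ?thesis
    by (subst emeasure_sphere_measure) auto
qed

lemma emeasure_sphere_measure_UNIV: "emeasure sphere_measure UNIV \<le> 24"
proof -
  have "emeasure sphere_measure UNIV = emeasure sphere_measure {\<sigma>. \<bar>axis 1 1 \<bullet> \<sigma>\<bar> \<le> 1}"
  proof (rule emeasure_eq_AE)
    show "AE \<sigma> in sphere_measure. (\<sigma> \<in> UNIV) = (\<sigma> \<in> {\<sigma>. \<bar>axis 1 1 \<bullet> \<sigma>\<bar> \<le> 1})"
      using AE_norm_sphere_measure
    proof eventually_elim
      case (elim \<sigma>)
      then show ?case
        using Cauchy_Schwarz_ineq2[of "axis 1 1" \<sigma>] by simp
    qed
  qed auto
  also have "\<dots> \<le> ennreal (24 * 1)"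
    by (rule sphere_measure_band) auto
  finally show ?thesis by simp
qed

lemma finite_measure_sphere_measure: "finite_measure sphere_measure"
  using emeasure_sphere_measure_UNIV by (intro finite_measureI) (auto simp: top_unique)

text \<open>From c = \<omega> . \<sigma> >= 1 - 2t follows 1 - c^2 <= 4t - 4t^2 <= 4t, so the
  rotated cone has transversal half-width 2 sqrt t and lies in a box of volume 32t. Two transversal
  directions make the bound linear in t. Squaring needs 1 - 2t >= 0; for t > 1/2 the total area
  bound 24 <= 96t takes over.\<close>

lemma sphere_measure_cap:
  fixes \<omega> :: "real^3"
  assumes "norm \<omega> = 1" "0 \<le> t"
  shows "emeasure sphere_measure {\<sigma>. (1 - \<omega> \<bullet> \<sigma>) / 2 \<le> t} \<le> ennreal (96 * t)"
proof (cases "t \<le> 1/2")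
  case False
  have "emeasure sphere_measure {\<sigma>. (1 - \<omega> \<bullet> \<sigma>) / 2 \<le> t} \<le> emeasure sphere_measure UNIV"
    by (rule emeasure_mono) auto
  also have "\<dots> \<le> ennreal 24"
    using emeasure_sphere_measure_UNIV by simp
  also have "\<dots> \<le> ennreal (96 * t)"
    using False by (intro ennreal_leI) auto
  finally show ?thesis .
next
  case True
  obtain f :: "real^3 \<Rightarrow> real^3" where f: "orthogonal_transformation f" "f \<omega> = axis 1 1"
    using orthogonal_transformation_exists_1[of \<omega> "axis 1 1"] assms(1) by auto
  let ?S = "{x. norm x < 1 \<and> (1 / norm x) *\<^sub>R x \<in> {\<sigma>. (1 - \<omega> \<bullet> \<sigma>) / 2 \<le> t}}"
  let ?r = "2 * sqrt t"
  have "f x \<in> cbox (- vector [1, ?r, ?r]) (vector [1, ?r, ?r])" if "x \<in> ?S" for x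
  proof (cases "x = 0")
    case True
    then show ?thesis
      using f assms by (simp add: mem_box_cart forall_3 orthogonal_transformation_def linear_0)
  next
    case False
    have nx: "norm (f x) = norm x"
      using f by (simp add: orthogonal_transformation)
    have \<omega>: "\<omega> \<bullet> x = f x $ 1"
      using f unfolding orthogonal_transformation_def
      by (metis inner_commute inner_axis inner_real_def mult.right_neutral)
    have "(1 - 2 * t) * norm x \<le> f x $ 1"
      using that False \<omega> by (auto simp: field_simps)
    then have cap: "((1 - 2 * t) * norm x)\<^sup>2 \<le> (f x $ 1)\<^sup>2"
      using True by (intro power_mono) auto
    have s: "(norm x)\<^sup>2 = (f x $ 1)\<^sup>2 + (f x $ 2)\<^sup>2 + (f x $ 3)\<^sup>2"
      unfolding nx[symmetric] by (simp add: norm_vec_def L2_set_def sum_3 sum_nonneg)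
    have "(f x $ 2)\<^sup>2 + (f x $ 3)\<^sup>2 \<le> (4 * t - 4 * t\<^sup>2) * (norm x)\<^sup>2"
    proof -
      have "((1 - 2 * t) * norm x)\<^sup>2 = (norm x)\<^sup>2 - (4 * t - 4 * t\<^sup>2) * (norm x)\<^sup>2"
        by algebra
      then show ?thesis
        using cap s by linarith
    qed
    also have "\<dots> \<le> (4 * t) * 1"
    proof (rule mult_mono)
      show "(norm x)\<^sup>2 \<le> 1"
        using that by (intro power_le_one) auto
    qed (use assms in auto)
    also have "\<dots> = ?r\<^sup>2"
      using assms by simp
    finally have "(f x $ 2)\<^sup>2 \<le> ?r\<^sup>2" "(f x $ 3)\<^sup>2 \<le> ?r\<^sup>2"
      by (smt (verit) zero_le_power2)+
    then have "\<bar>f x $ 2\<bar> \<le> ?r" "\<bar>f x $ 3\<bar> \<le> ?r"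
      using assms(2) abs_le_square_iff[of "f x $ 2" ?r] abs_le_square_iff[of "f x $ 3" ?r] by auto
    moreover have "\<bar>f x $ 1\<bar> \<le> 1"
      using component_le_norm_cart[of "f x" 1] nx that by auto
    ultimately show ?thesis
      by (simp add: mem_box_cart forall_3 abs_le_iff minus_le_iff)
  qed
  then have "emeasure lborel ?S \<le> emeasure lborel (cbox (- vector [1, ?r, ?r]) (vector [1, ?r, ?r] :: real^3))"
    by (intro emeasure_lborel_orthogonal_image_le[OF f(1)]) auto
  also have "\<dots> = ennreal (32 * t)"
    using assms by (simp add: emeasure_cbox_real3)
  finally have "3 * emeasure lborel ?S \<le> ennreal 3 * ennreal (32 * t)"
    by (intro mult_mono) auto
  also have "\<dots> = ennreal (96 * t)"
    using assms(2) by (subst ennreal_mult[symmetric]) auto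
  finally show ?thesis
    by (subst emeasure_sphere_measure) auto
qed

section \<open>Integrals of powers from linear bounds on sublevel sets\<close>

text \<open>Dyadic decomposition: for 2^(-j-1) <= u <= 2^(-j) the integrand is at most 2^(p(j+1)),
  on a set of measure at most K 2^(-j). The resulting series is geometric with ratio 2^(p-1), which
  is below 1 because p < 1. Points with u = 0 contribute nothing, since \<open>0 powr x\<close> is
  0.\<close>

lemma nn_integral_powr_neg_le:
  assumes [measurable]: "u \<in> borel_measurable M"
    and u: "AE x in M. 0 \<le> u x \<and> u x \<le> 1"
    and K: "0 \<le> K" "\<And>t. 0 \<le> t \<Longrightarrow> emeasure M {x \<in> space M. u x \<le> t} \<le> ennreal (K * t)"
    and p: "0 \<le> p" "p < 1"
  shows "(\<integral>\<^sup>+x. ennreal (u x powr - p) \<partial>M) \<le> ennreal (K * (2 / (1 - 2 powr (p - 1))))"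
proof -
  let ?q = "2 powr (p - 1) :: real"
  have q: "0 < ?q" "?q < 1"
    using p by (auto intro!: powr_less_one)
  define c where "c = (\<lambda>j. 2 powr (p * (real j + 1)))"
  have pw: "ennreal (u x powr - p) \<le> (\<Sum>j. ennreal (c j) * indicator {x \<in> space M. u x \<le> (1/2)^j} x)"
    if x: "x \<in> space M" and ux: "0 \<le> u x \<and> u x \<le> 1" for x
  proof (cases "u x = 0")
    case False
    with ux have ux: "0 < u x" "u x \<le> 1" by auto
    define j where "j = nat \<lfloor>- log 2 (u x)\<rfloor>"
    have l: "0 \<le> - log 2 (u x)"
      using ux by simp
    have j: "real j \<le> - log 2 (u x)" "- log 2 (u x) \<le> real j + 1"
      using l unfolding j_def by linarith+
    have "u x = 2 powr (log 2 (u x))"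
      using ux by simp
    also have "\<dots> \<le> 2 powr (- real j)"
      using j by (intro powr_mono) auto
    finally have 1: "u x \<le> (1/2)^j"
      by (simp add: powr_minus powr_realpow power_divide field_simps)
    have "u x powr - p = 2 powr (log 2 (u x) * (-p))"
      using ux by (simp add: powr_def log_def)
    also have "\<dots> \<le> c j"
      unfolding c_def using j p
      by (intro powr_mono) (simp_all, metis minus_mult_left mult.commute mult_left_mono)
    finally have "ennreal (u x powr - p) \<le> ennreal (c j) * indicator {x \<in> space M. u x \<le> (1/2)^j} x"
      using 1 x by (simp add: ennreal_leI)
    also have "\<dots> \<le> (\<Sum>j. ennreal (c j) * indicator {x \<in> space M. u x \<le> (1/2)^j} x)"
      using sum_le_suminf[of "\<lambda>j. ennreal (c j) * indicator {x \<in> space M. u x \<le> (1/2)^j} x" "{j}"]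
      by (simp del: sum_mult_indicator)
    finally show ?thesis .
  qed simp
  have "(\<integral>\<^sup>+x. ennreal (u x powr - p) \<partial>M)
      \<le> (\<integral>\<^sup>+x. (\<Sum>j. ennreal (c j) * indicator {x \<in> space M. u x \<le> (1/2)^j} x) \<partial>M)"
    using u by (intro nn_integral_mono_AE, elim AE_mp) (blast intro: AE_I2 pw)
  also have "\<dots> = (\<Sum>j. \<integral>\<^sup>+x. ennreal (c j) * indicator {x \<in> space M. u x \<le> (1/2)^j} x \<partial>M)"
    by (intro nn_integral_suminf) auto
  also have "\<dots> = (\<Sum>j. ennreal (c j) * emeasure M {x \<in> space M. u x \<le> (1/2)^j})"
    by (simp add: nn_integral_cmult_indicator)
  also have "\<dots> \<le> (\<Sum>j. ennreal (K * 2 powr p * ?q ^ j))"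
  proof (intro suminf_le allI)
    fix j
    have "ennreal (c j) * emeasure M {x \<in> space M. u x \<le> (1/2)^j} \<le> ennreal (c j) * ennreal (K * (1/2)^j)"
      by (intro mult_left_mono K) auto
    also have "\<dots> = ennreal (c j * (K * (1/2)^j))"
      using K by (simp add: c_def ennreal_mult)
    also have "c j * (K * (1/2)^j) = K * 2 powr p * ?q ^ j"
    proof -
      have "c j * (1/2)^j = 2 powr p * 2 powr (real j * (p - 1))"
      proof -
        have h: "(1/2::real)^j = 2 powr (- real j)"
          by (simp add: powr_minus powr_realpow power_one_over inverse_eq_divide)
        have "p * (real j + 1) + - real j = p + real j * (p - 1)"
          by (simp add: algebra_simps)
        then show ?thesis
          unfolding c_def h powr_add[symmetric] by simp
      qed
      also have "2 powr (real j * (p - 1)) = ?q ^ j"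
        by (simp add: powr_realpow[symmetric] powr_powr mult.commute)
      finally show ?thesis by simp
    qed
    finally show "ennreal (c j) * emeasure M {x \<in> space M. u x \<le> (1/2)^j} \<le> ennreal (K * 2 powr p * ?q ^ j)" .
  qed auto
  also have "\<dots> = ennreal (K * 2 powr p * (1 / (1 - ?q)))"
    using q K by (intro suminf_ennreal_eq sums_mult geometric_sums) auto
  also have "\<dots> \<le> ennreal (K * (2 / (1 - ?q)))"
  proof (rule ennreal_leI)
    have "2 powr p \<le> 2 powr (1::real)"
      using p by (intro powr_mono) auto
    then have "2 powr p * (1 / (1 - ?q)) \<le> 2 * (1 / (1 - ?q))"
      using q by (intro mult_right_mono) auto
    from mult_left_mono[OF this K(1)] show "K * 2 powr p * (1 / (1 - ?q)) \<le> K * (2 / (1 - ?q))"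
      by (simp add: mult.assoc)
  qed
  finally show ?thesis .
qed

text \<open>For j <= q u <= j + 1 one has (1 - u)^q <= exp(-q u) <= exp(-j) <= 2^(-j), on a set of
  measure at most K (j+1)/q. The sum of (j+1) 2^(-j) is 4. The decay in q later becomes the decay in
  k.\<close>

lemma nn_integral_one_minus_powr_le:
  assumes [measurable]: "u \<in> borel_measurable M"
    and u: "AE x in M. 0 \<le> u x \<and> u x \<le> 1"
    and K: "0 \<le> K" "\<And>t. 0 \<le> t \<Longrightarrow> emeasure M {x \<in> space M. u x \<le> t} \<le> ennreal (K * t)"
    and q: "0 < q"
  shows "(\<integral>\<^sup>+x. ennreal ((1 - u x) powr q) \<partial>M) \<le> ennreal (4 * K / q)"
proof -
  have pw: "ennreal ((1 - u x) powr q) \<le> (\<Sum>j. ennreal ((1/2)^j) * indicator {x \<in> space M. u x \<le> real (Suc j) / q} x)"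
    if x: "x \<in> space M" and ux: "0 \<le> u x \<and> u x \<le> 1" for x
  proof -
    define j where "j = nat \<lfloor>q * u x\<rfloor>"
    have "0 \<le> q * u x"
      using q ux by simp
    then have j: "real j \<le> q * u x" "q * u x \<le> real (Suc j)"
      unfolding j_def by linarith+
    have 1: "u x \<le> real (Suc j) / q"
      using j q by (simp add: field_simps)
    have "(1 - u x) powr q \<le> exp (- u x) powr q"
      using exp_ge_add_one_self[of "- u x"] ux q by (intro powr_mono2) auto
    also have "\<dots> = exp (- (q * u x))"
      by (simp add: powr_def)
    also have "\<dots> \<le> exp (- real j)"
      using j by simp
    also have "\<dots> = exp (-1) ^ j"
      by (simp flip: exp_of_nat_mult)
    also have "\<dots> \<le> (1/2) ^ j"
    proof (rule power_mono)
      have "2 \<le> exp (1::real)"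
        using exp_ge_add_one_self[of 1] by simp
      then show "exp (-1) \<le> (1/2::real)"
        by (simp add: exp_minus field_simps)
    qed simp
    finally have "ennreal ((1 - u x) powr q) \<le> ennreal ((1/2)^j) * indicator {x \<in> space M. u x \<le> real (Suc j) / q} x"
      using 1 x by (simp add: ennreal_leI)
    also have "\<dots> \<le> (\<Sum>j. ennreal ((1/2)^j) * indicator {x \<in> space M. u x \<le> real (Suc j) / q} x)"
      using sum_le_suminf[of "\<lambda>j. ennreal ((1/2)^j) * indicator {x \<in> space M. u x \<le> real (Suc j) / q} x" "{j}"]
      by (simp del: of_nat_Suc sum_mult_indicator)
    finally show ?thesis .
  qed
  have "(\<integral>\<^sup>+x. ennreal ((1 - u x) powr q) \<partial>M)
      \<le> (\<integral>\<^sup>+x. (\<Sum>j. ennreal ((1/2)^j) * indicator {x \<in> space M. u x \<le> real (Suc j) / q} x) \<partial>M)"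
    using u by (intro nn_integral_mono_AE, elim AE_mp) (blast intro: AE_I2 pw)
  also have "\<dots> = (\<Sum>j. \<integral>\<^sup>+x. ennreal ((1/2)^j) * indicator {x \<in> space M. u x \<le> real (Suc j) / q} x \<partial>M)"
    by (intro nn_integral_suminf) auto
  also have "\<dots> = (\<Sum>j. ennreal ((1/2)^j) * emeasure M {x \<in> space M. u x \<le> real (Suc j) / q})"
    by (simp add: nn_integral_cmult_indicator)
  also have "\<dots> \<le> (\<Sum>j. ennreal (K / q * (real (Suc j) * (1/2) ^ j)))"
  proof (intro suminf_le allI)
    fix j
    have "ennreal ((1/2)^j) * emeasure M {x \<in> space M. u x \<le> real (Suc j) / q}
        \<le> ennreal ((1/2)^j) * ennreal (K * (real (Suc j) / q))"
      using q by (intro mult_left_mono K) auto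
    also have "\<dots> = ennreal ((1/2)^j * (K * (real (Suc j) / q)))"
      using K q by (intro ennreal_mult[symmetric]) auto
    also have "(1/2)^j * (K * (real (Suc j) / q)) = K / q * (real (Suc j) * (1/2) ^ j)"
      by simp
    finally show "ennreal ((1/2)^j) * emeasure M {x \<in> space M. u x \<le> real (Suc j) / q}
       \<le> ennreal (K / q * (real (Suc j) * (1/2) ^ j))" .
  qed auto
  also have "\<dots> = ennreal (K / q * (1 / (1 - 1/2)^2))"
    using q K by (intro suminf_ennreal_eq sums_mult geometric_deriv_sums) auto
  also have "K / q * (1 / (1 - 1/2)^2) = 4 * K / q"
    by (simp add: power2_eq_square)
  finally show ?thesis .
qed

section \<open>The change of variables \<open>v\<^sub>* \<mapsto> v'\<close>\<close>

text \<open>An inequality suffices, so the image of \<open>S\<close> need not be identified. It is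
  proved first for measures: the push-forward of \<open>J\<close> times Lebesgue measure on
  \<open>S\<close> gives a Borel set A of finite measure the volume of the image of \<open>S\<close>
  \<inter> g^(-1)(A), which lies inside A. Integrals follow by monotonicity in the measure.\<close>

lemma nn_integral_change_of_variables_le:
  fixes g :: "real^'n::{finite,wellorder} \<Rightarrow> real^'n::_" and J :: "real^'n::_ \<Rightarrow> real"
  assumes S [measurable]: "S \<in> sets borel"
    and g [measurable]: "g \<in> borel_measurable borel"
    and J [measurable]: "J \<in> borel_measurable borel"
    and F [measurable]: "F \<in> borel_measurable borel"
    and der: "\<And>x. x \<in> S \<Longrightarrow> (g has_derivative g' x) (at x)"
    and inj: "inj_on g S"
    and det: "\<And>x. x \<in> S \<Longrightarrow> \<bar>det (matrix (g' x))\<bar> = J x"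
  shows "(\<integral>\<^sup>+x. indicator S x * ennreal (J x) * F (g x) \<partial>lborel) \<le> (\<integral>\<^sup>+x. F x \<partial>lborel)"
proof -
  let ?D = "density lborel (\<lambda>x. indicator S x * ennreal (J x))"
  let ?N = "distr ?D lborel g"
  have "?N \<le> lborel"
  proof (subst le_measure, simp, intro ballI)
    fix A :: "(real^'n::_) set" assume "A \<in> sets ?N"
    then have A [measurable]: "A \<in> sets borel" by simp
    show "emeasure ?N A \<le> emeasure lborel A"
    proof (cases "emeasure lborel A = \<infinity>")
      case False
      define T where "T = S \<inter> g -` A"
      have T_borel [measurable]: "T \<in> sets borel"
        unfolding T_def using measurable_sets_borel[OF g A] S by auto
      have derT: "(g has_derivative g' x) (at x within T)" if "x \<in> T" for x
        using der that by (auto simp: T_def intro: has_derivative_at_withinI)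
      have A_lm: "A \<in> lmeasurable"
        using False A by (auto simp: fmeasurable_def top.not_eq_extremum)
      have "g ` T \<in> sets lebesgue"
        using derT by (intro differentiable_image_in_sets_lebesgue)
          (auto simp: differentiable_on_def differentiable_def)
      moreover have "g ` T \<subseteq> A"
        by (auto simp: T_def)
      ultimately have gT: "g ` T \<in> lmeasurable" "measure lebesgue (g ` T) \<le> measure lebesgue A"
        using A_lm fmeasurableI2 measure_mono_fmeasurable by blast+
      have injT: "inj_on g T"
        using inj by (rule inj_on_subset) (auto simp: T_def)
      have "((\<lambda>x. \<bar>det (matrix (g' x))\<bar>) has_integral measure lebesgue (g ` T)) T"
        using has_measure_differentiable_image[of T g g' "measure lebesgue (g ` T)"] derT injT gT(1) T_borel
        by auto
      then have "(\<integral>\<^sup>+x. indicator T x * \<bar>det (matrix (g' x))\<bar> \<partial>lborel) = measure lebesgue (g ` T)"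
        by (intro nn_integral_has_integral_lebesgue) auto
      moreover have "emeasure ?N A = (\<integral>\<^sup>+x. indicator T x * \<bar>det (matrix (g' x))\<bar> \<partial>lborel)"
      proof -
        have "emeasure ?N A = emeasure ?D (g -` A)"
          by (subst emeasure_distr) auto
        also have "\<dots> = (\<integral>\<^sup>+x. (indicator S x * ennreal (J x)) * indicator (g -` A) x \<partial>lborel)"
          using measurable_sets_borel[OF g A] by (subst emeasure_density) auto
        also have "\<dots> = (\<integral>\<^sup>+x. indicator T x * \<bar>det (matrix (g' x))\<bar> \<partial>lborel)"
          by (intro nn_integral_cong) (auto simp: T_def det indicator_def)
        finally show ?thesis .
      qed
      moreover have "ennreal (measure lebesgue A) = emeasure lborel A"
        using emeasure_eq_measure2[OF A_lm] A by simp
      ultimately show ?thesis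
        using gT(2) by (metis ennreal_leI)
    qed simp
  qed
  then have "nn_integral ?N F \<le> nn_integral lborel F"
    by (intro nn_integral_mono_measure) auto
  moreover have "nn_integral ?N F = (\<integral>\<^sup>+x. F (g x) \<partial>?D)"
    by (rule nn_integral_distr) measurable
  moreover have "(\<integral>\<^sup>+x. F (g x) \<partial>?D) = (\<integral>\<^sup>+x. indicator S x * ennreal (J x) * F (g x) \<partial>lborel)"
    by (rule nn_integral_density) measurable
  ultimately show ?thesis by simp
qed

text \<open>This is \<open>sin (\<theta>/2)\<close> for the deviation angle \<open>\<theta>\<close>; it is \<open>0\<close> when \<open>v = w\<close>.\<close>

definition sinhalf :: "real^3 \<Rightarrow> real^3 \<Rightarrow> real^3 \<Rightarrow> real" where
  "sinhalf v w \<sigma> = norm (vprime v w \<sigma> - v) / norm (v - w)"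

section \<open>Geometry of a single collision\<close>

lemma vprime_same [simp]: "vprime v v \<sigma> = v"
  unfolding vprime_def using scaleR_half_double[of v] by simp

lemma vprime_minus_left: "vprime v w \<sigma> - v = (1/2) *\<^sub>R (norm (v - w) *\<^sub>R \<sigma> - (v - w))"
  by (simp add: vprime_def vec_eq_iff field_simps)

lemma vprime_inner:
  assumes "norm \<sigma> = 1"
  shows "(vprime v w \<sigma> - v) \<bullet> \<sigma> = (norm (v - w) - (v - w) \<bullet> \<sigma>) / 2"
  using assms by (simp add: vprime_minus_left inner_diff_left dot_square_norm)

text \<open>With z = v - w both sides equal (|z|^2 - |z| z . \<sigma>)/2. The identity recovers |v -
  w|, and hence w, from v' - v and \<sigma>, and it exhibits s as a cosine.\<close>

lemma norm_vprime_minus_left: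
  assumes "norm \<sigma> = 1"
  shows "(norm (vprime v w \<sigma> - v))\<^sup>2 = norm (v - w) * ((vprime v w \<sigma> - v) \<bullet> \<sigma>)"
proof -
  have "(norm (vprime v w \<sigma> - v))\<^sup>2
      = ((norm (v - w))\<^sup>2 * (\<sigma> \<bullet> \<sigma>) - 2 * norm (v - w) * ((v - w) \<bullet> \<sigma>) + (v - w) \<bullet> (v - w)) / 4"
  proof -
    have "(norm ((1/2) *\<^sub>R (n *\<^sub>R \<sigma> - z)))\<^sup>2 = (n\<^sup>2 * (\<sigma> \<bullet> \<sigma>) - 2 * n * (z \<bullet> \<sigma>) + z \<bullet> z) / 4" for n z
      unfolding power2_norm_eq_inner
      by (simp add: inner_diff_left inner_diff_right inner_commute power2_eq_square field_simps)
    then show ?thesis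
      unfolding vprime_minus_left .
  qed
  also have "\<dots> = norm (v - w) * ((vprime v w \<sigma> - v) \<bullet> \<sigma>)"
    using assms by (simp add: vprime_inner dot_square_norm power2_eq_square field_simps)
  finally show ?thesis .
qed

text \<open>The half-angle formula, with cos \<theta> the inner product of \<sigma> and the unit
  relative velocity. It makes s^2, not s, the variable in which caps have linear area.\<close>

lemma sinhalf_sq:
  assumes "norm \<sigma> = 1" "v \<noteq> w"
  shows "(sinhalf v w \<sigma>)\<^sup>2 = (1 - ((1 / norm (v - w)) *\<^sub>R (v - w)) \<bullet> \<sigma>) / 2"
proof -
  have "(sinhalf v w \<sigma>)\<^sup>2 = (norm (v - w) * ((vprime v w \<sigma> - v) \<bullet> \<sigma>)) / (norm (v - w))\<^sup>2"
    by (simp add: sinhalf_def power_divide norm_vprime_minus_left assms)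
  also have "\<dots> = (1 - ((1 / norm (v - w)) *\<^sub>R (v - w)) \<bullet> \<sigma>) / 2"
    unfolding inner_scaleR_left using assms by (simp add: vprime_inner power2_eq_square field_simps)
  finally show ?thesis .
qed

lemma sinhalf_nonneg: "0 \<le> sinhalf v w \<sigma>"
  by (simp add: sinhalf_def)

lemma sinhalf_le_1:
  assumes "norm \<sigma> = 1"
  shows "sinhalf v w \<sigma> \<le> 1"
proof -
  have "norm (vprime v w \<sigma> - v) = norm (norm (v - w) *\<^sub>R \<sigma> - (v - w)) / 2"
    by (simp add: vprime_minus_left)
  also have "\<dots> \<le> (norm (v - w) + norm (v - w)) / 2"
    using norm_triangle_ineq4[of "norm (v - w) *\<^sub>R \<sigma>" "v - w"] assms by simp
  finally show ?thesis
    by (simp add: sinhalf_def divide_le_eq_1)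
qed

text \<open>After the change of variables w -> v' only v' and \<sigma> are left, so s has to be
  readable from them. Dividing \<open>norm_vprime_minus_left\<close> by |v - w| |v' - v| achieves
  this.\<close>

lemma sinhalf_eq_inner:
  assumes "norm \<sigma> = 1" "vprime v w \<sigma> \<noteq> v"
  shows "sinhalf v w \<sigma> = ((1 / norm (vprime v w \<sigma> - v)) *\<^sub>R (vprime v w \<sigma> - v)) \<bullet> \<sigma>"
proof -
  have "v \<noteq> w"
    using assms(2) by auto
  moreover have "norm (vprime v w \<sigma> - v) \<noteq> 0"
    using assms(2) by simp
  ultimately have "sinhalf v w \<sigma> = (norm (vprime v w \<sigma> - v))\<^sup>2 / (norm (v - w) * norm (vprime v w \<sigma> - v))"
    by (simp add: sinhalf_def power2_eq_square)
  also have "\<dots> = ((vprime v w \<sigma> - v) \<bullet> \<sigma>) / norm (vprime v w \<sigma> - v)"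
    using \<open>v \<noteq> w\<close> by (subst norm_vprime_minus_left[OF assms(1)]) simp
  finally show ?thesis by simp
qed

lemma borel_measurable_vprime' [measurable (raw)]:
  assumes "f \<in> borel_measurable M" "g \<in> borel_measurable M" "h \<in> borel_measurable M"
  shows "(\<lambda>x. vprime (f x) (g x) (h x)) \<in> borel_measurable M"
  using assms unfolding vprime_def by measurable

lemma borel_measurable_vsprime' [measurable (raw)]:
  assumes "f \<in> borel_measurable M" "g \<in> borel_measurable M" "h \<in> borel_measurable M"
  shows "(\<lambda>x. vsprime (f x) (g x) (h x)) \<in> borel_measurable M"
  using assms unfolding vsprime_def by measurable

lemma borel_measurable_sinhalf [measurable (raw)]:
  assumes "f \<in> borel_measurable M" "g \<in> borel_measurable M" "h \<in> borel_measurable M"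
  shows "(\<lambda>x. sinhalf (f x) (g x) (h x)) \<in> borel_measurable M"
  using assms unfolding sinhalf_def by measurable

lemma has_derivative_vprime:
  assumes "v \<noteq> w"
  shows "((\<lambda>w. vprime v w \<sigma>) has_derivative
    (\<lambda>h. (1/2) *\<^sub>R h + ((h \<bullet> ((1 / norm (w - v)) *\<^sub>R (w - v))) / 2) *\<^sub>R \<sigma>)) (at w)"
proof -
  have "(norm has_derivative (\<lambda>h. h \<bullet> sgn (w - v))) (at (w - v))"
    using assms by (intro has_derivative_norm) simp
  moreover have "((\<lambda>w. w - v) has_derivative (\<lambda>h. h)) (at w)"
    by (auto intro!: derivative_eq_intros)
  ultimately have n: "((\<lambda>w. norm (w - v)) has_derivative (\<lambda>h. h \<bullet> sgn (w - v))) (at w)"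
    using has_derivative_compose[of "\<lambda>w. w - v" "\<lambda>h. h" w UNIV norm] by simp
  have "((\<lambda>w. (1/2) *\<^sub>R (v + w) + (norm (w - v) / 2) *\<^sub>R \<sigma>) has_derivative
    (\<lambda>h. (1/2) *\<^sub>R (0 + h) + ((h \<bullet> sgn (w - v)) / 2) *\<^sub>R \<sigma>)) (at w)"
    by (intro has_derivative_add has_derivative_scaleR_right has_derivative_scaleR_left
        has_derivative_const has_derivative_ident bounded_linear.has_derivative[OF bounded_linear_divide] n)
  moreover have "sgn (w - v) = (1 / norm (w - v)) *\<^sub>R (w - v)"
    unfolding sgn_div_norm inverse_eq_divide ..
  moreover have "vprime v w \<sigma> = (1/2) *\<^sub>R (v + w) + (norm (w - v) / 2) *\<^sub>R \<sigma>" for w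
    unfolding vprime_def norm_minus_commute[of v w] ..
  ultimately show ?thesis
    by (simp only: add_0_left)
qed

text \<open>The matrix is one half of the identity plus a rank-one matrix with trace n . \<sigma>,
  so the determinant is (1/2)^3 (1 + n . \<sigma>). For n = (w - v)/|w - v| this is s^2/4.\<close>

lemma det_matrix_vprime_derivative:
  fixes n \<sigma> :: "real^3"
  shows "det (matrix (\<lambda>h. (1/2) *\<^sub>R h + ((h \<bullet> n) / 2) *\<^sub>R \<sigma>)) = (1 + n \<bullet> \<sigma>) / 8"
  unfolding det_3 matrix_def
  by (simp add: axis_def inner_vec_def sum_3) (simp add: field_simps)

text \<open>For nonzero y = v' - v the identity |y|^2 = |v - w| (y . \<sigma>) determines |v - w|,
  and then \<open>vprime_minus_left\<close> determines w. The half-line v - w = t \<sigma>, t >= 0,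
  is mapped to the single point v and has to be excluded; \<open>sinhalf\<close> vanishes on it, so
  the integral in \<open>nn_integral_vprime_le\<close> does not see it.\<close>

lemma inj_on_vprime:
  assumes "norm \<sigma> = 1"
  shows "inj_on (\<lambda>w. vprime v w \<sigma>) {w. vprime v w \<sigma> \<noteq> v}"
proof (rule inj_onI)
  fix w1 w2 assume "w1 \<in> {w. vprime v w \<sigma> \<noteq> v}" "w2 \<in> {w. vprime v w \<sigma> \<noteq> v}"
    and eq: "vprime v w1 \<sigma> = vprime v w2 \<sigma>"
  define y where "y = vprime v w1 \<sigma> - v"
  have "y \<noteq> 0"
    using \<open>w1 \<in> _\<close> by (simp add: y_def)
  have 1: "(norm y)\<^sup>2 = norm (v - w1) * (y \<bullet> \<sigma>)" "(norm y)\<^sup>2 = norm (v - w2) * (y \<bullet> \<sigma>)"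
    using norm_vprime_minus_left[OF assms, of v w1] norm_vprime_minus_left[OF assms, of v w2] eq
    by (auto simp: y_def)
  with \<open>y \<noteq> 0\<close> have n: "norm (v - w1) = norm (v - w2)"
    by (metis mult_cancel_right mult_zero_right norm_eq_zero zero_eq_power2)
  have "(1/2) *\<^sub>R (norm (v - w1) *\<^sub>R \<sigma> - (v - w1)) = (1/2) *\<^sub>R (norm (v - w2) *\<^sub>R \<sigma> - (v - w2))"
    unfolding vprime_minus_left[symmetric] eq ..
  then have "norm (v - w1) *\<^sub>R \<sigma> - (v - w1) = norm (v - w2) *\<^sub>R \<sigma> - (v - w2)"
    unfolding scaleR_cancel_left by simp
  then show "w1 = w2"
    unfolding n by simp
qed

lemma nn_integral_vprime_le:
  assumes \<sigma>: "norm \<sigma> = 1" and [measurable]: "F \<in> borel_measurable borel"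
  shows "(\<integral>\<^sup>+w. ennreal ((sinhalf v w \<sigma>)\<^sup>2 / 4) * F (vprime v w \<sigma>) \<partial>lborel) \<le> (\<integral>\<^sup>+y. F y \<partial>lborel)"
proof -
  define S where "S = {w. vprime v w \<sigma> \<noteq> v}"
  have S: "S \<in> sets borel"
    unfolding S_def by measurable
  have vw: "v \<noteq> w" if "w \<in> S" for w
    using that by (auto simp: S_def)
  have "(\<integral>\<^sup>+w. ennreal ((sinhalf v w \<sigma>)\<^sup>2 / 4) * F (vprime v w \<sigma>) \<partial>lborel)
      = (\<integral>\<^sup>+w. indicator S w * ennreal ((sinhalf v w \<sigma>)\<^sup>2 / 4) * F (vprime v w \<sigma>) \<partial>lborel)"
    by (intro nn_integral_cong) (auto simp: S_def indicator_def sinhalf_def)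
  also have "\<dots> \<le> (\<integral>\<^sup>+y. F y \<partial>lborel)"
  proof (rule nn_integral_change_of_variables_le[OF S])
    show "((\<lambda>w. vprime v w \<sigma>) has_derivative
      (\<lambda>h. (1/2) *\<^sub>R h + ((h \<bullet> ((1 / norm (w - v)) *\<^sub>R (w - v))) / 2) *\<^sub>R \<sigma>)) (at w)" if "w \<in> S" for w
      using vw[OF that] by (rule has_derivative_vprime)
    show "inj_on (\<lambda>w. vprime v w \<sigma>) S"
      unfolding S_def using \<sigma> by (rule inj_on_vprime)
    show "\<bar>det (matrix (\<lambda>h. (1/2) *\<^sub>R h + ((h \<bullet> ((1 / norm (w - v)) *\<^sub>R (w - v))) / 2) *\<^sub>R \<sigma>))\<bar>
        = (sinhalf v w \<sigma>)\<^sup>2 / 4" if "w \<in> S" for w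
    proof -
      have "(1 + ((1 / norm (w - v)) *\<^sub>R (w - v)) \<bullet> \<sigma>) / 8 = (sinhalf v w \<sigma>)\<^sup>2 / 4"
        unfolding sinhalf_sq[OF \<sigma> vw[OF that]]
        by (simp add: norm_minus_commute inner_diff_left diff_divide_distrib)
      moreover have "\<bar>(sinhalf v w \<sigma>)\<^sup>2 / 4\<bar> = (sinhalf v w \<sigma>)\<^sup>2 / 4"
        by simp
      ultimately show ?thesis
        unfolding det_matrix_vprime_derivative by argo
    qed
  qed auto
  finally show ?thesis .
qed

section \<open>Polar coordinates and the pre-post-collisional change of variables\<close>

lemma nn_integral_lborel_affine:
  fixes f :: "'a::euclidean_space \<Rightarrow> ennreal"
  assumes [measurable]: "f \<in> borel_measurable borel" and c: "c \<noteq> 0"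
  shows "(\<integral>\<^sup>+x. f x \<partial>lborel) = ennreal (\<bar>c\<bar> ^ DIM('a)) * (\<integral>\<^sup>+x. f (t + c *\<^sub>R x) \<partial>lborel)"
  by (subst lborel_affine[OF c, of t])
     (simp add: nn_integral_density nn_integral_distr nn_integral_cmult)

lemma nn_integral_translate:
  fixes f :: "'a::euclidean_space \<Rightarrow> ennreal"
  assumes "f \<in> borel_measurable borel"
  shows "(\<integral>\<^sup>+x. f (t + x) \<partial>lborel) = (\<integral>\<^sup>+x. f x \<partial>lborel)"
  using nn_integral_lborel_affine[OF assms, of 1 t] by simp

lemma nn_integral_reflect_translate:
  fixes f :: "'a::euclidean_space \<Rightarrow> ennreal"
  assumes "f \<in> borel_measurable borel"
  shows "(\<integral>\<^sup>+x. f (t - x) \<partial>lborel) = (\<integral>\<^sup>+x. f x \<partial>lborel)"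
  using nn_integral_lborel_affine[OF assms, of "-1" t] by simp

lemma nn_integral_inverse_power4:
  assumes "0 < (a::real)"
  shows "(\<integral>\<^sup>+t. ennreal (indicator {a<..} t * (3 / t ^ 4)) \<partial>lborel) = ennreal (1 / a ^ 3)"
proof -
  have "(\<integral>\<^sup>+t. ennreal (indicator {a<..} t * (3 / t ^ 4)) \<partial>lborel)
      = (\<integral>\<^sup>+t. ennreal (3 / t ^ 4) * indicator {a..} t \<partial>lborel)"
  proof (rule nn_integral_cong_AE)
    show "AE t in lborel. ennreal (indicator {a<..} t * (3 / t ^ 4)) = ennreal (3 / t ^ 4) * indicator {a..} t"
      using AE_lborel_singleton[of a] by eventually_elim (auto simp: indicator_def)
  qed
  also have "\<dots> = ennreal (0 - (- (1 / a ^ 3)))"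
  proof (rule nn_integral_FTC_atLeast)
    show "((\<lambda>t. - (1 / t ^ 3)) has_real_derivative 3 / x ^ 4) (at x)" if "a \<le> x" for x
    proof -
      have x: "x \<noteq> 0"
        using that assms by simp
      have "((\<lambda>t. - inverse (t ^ 3)) has_real_derivative inverse (x ^ 3) * (3 * x\<^sup>2) * inverse (x ^ 3)) (at x)"
        using x by (auto intro!: derivative_eq_intros)
      also have "inverse (x ^ 3) * (3 * x\<^sup>2) * inverse (x ^ 3) = 3 / x ^ 4"
        using x by (simp add: divide_simps flip: power_add)
      finally show ?thesis
        by (simp only: inverse_eq_divide)
    qed
    have "((\<lambda>t::real. 1 / t ^ 3) \<longlongrightarrow> 0) at_top"
      by (intro tendsto_divide_0[OF tendsto_const] filterlim_at_top_imp_at_infinity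
          filterlim_pow_at_top filterlim_ident) auto
    then show "((\<lambda>t::real. - (1 / t ^ 3)) \<longlongrightarrow> 0) at_top"
      using tendsto_minus by fastforce
  qed (use assms in auto)
  finally show ?thesis by simp
qed

lemma sigma_finite_sphere_measure: "sigma_finite_measure sphere_measure"
  using finite_measure_sphere_measure by (simp add: finite_measure_def)

interpretation sphere: sigma_finite_measure sphere_measure
  by (rule sigma_finite_sphere_measure)

text \<open>Scaling alone gives this from the cone definition of the surface measure. With x in the
  unit ball in place of \<sigma> and r = |x| t, the point r x/|x| becomes t x and the density 3
  |x|^3 t^2. Substituting y = t x at fixed t turns it into 3 |y|^3 / t^4 on |y| < t, and
  \<open>nn_integral_inverse_power4\<close> shows that the integral over t cancels |y|^3.\<close>

lemma nn_integral_polar: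
  fixes \<Phi> :: "real^3 \<Rightarrow> ennreal"
  assumes [measurable]: "\<Phi> \<in> borel_measurable borel"
  shows "(\<integral>\<^sup>+x. \<Phi> x \<partial>lborel)
    = (\<integral>\<^sup>+\<sigma>. \<integral>\<^sup>+r. ennreal (indicator {0<..} r * r\<^sup>2) * \<Phi> (r *\<^sub>R \<sigma>) \<partial>lborel \<partial>sphere_measure)"
proof -
  have [measurable]: "ball (0::real^3) 1 \<in> sets borel"
    by simp
  define B :: "real^3 \<Rightarrow> real" where "B = indicator (ball 0 1)"
  have [measurable]: "B \<in> borel_measurable borel"
    unfolding B_def by simp
  have B0: "0 \<le> B x" for x
    by (simp add: B_def)
  have "(\<integral>\<^sup>+\<sigma>. \<integral>\<^sup>+r. ennreal (indicator {0<..} r * r\<^sup>2) * \<Phi> (r *\<^sub>R \<sigma>) \<partial>lborel \<partial>sphere_measure)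
      = (\<integral>\<^sup>+x. ennreal (3 * B x) * (\<integral>\<^sup>+r. ennreal (indicator {0<..} r * r\<^sup>2) * \<Phi> (r *\<^sub>R ((1 / norm x) *\<^sub>R x)) \<partial>lborel) \<partial>lborel)"
    unfolding B_def by (subst nn_integral_sphere_measure) simp_all
  also have "\<dots> = (\<integral>\<^sup>+x. \<integral>\<^sup>+t. ennreal (indicator {0<..} t * (3 * B x * norm x ^ 3 * t\<^sup>2)) * \<Phi> (t *\<^sub>R x) \<partial>lborel \<partial>lborel)"
  proof (rule nn_integral_cong_AE, rule AE_mp[OF AE_lborel_singleton[of 0]], rule AE_I2, rule impI)
    fix x :: "real^3" assume x: "x \<noteq> 0"
    define f where "f r = ennreal (indicator {0<..} r * r\<^sup>2) * \<Phi> (r *\<^sub>R ((1 / norm x) *\<^sub>R x))" for r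
    have [measurable]: "f \<in> borel_measurable borel"
      unfolding f_def by measurable
    have "(\<integral>\<^sup>+r. f r \<partial>lborel) = ennreal (norm x) * (\<integral>\<^sup>+t. f (norm x * t) \<partial>lborel)"
      using nn_integral_real_affine[of f "norm x" 0] x by simp
    then have "ennreal (3 * B x) * (\<integral>\<^sup>+r. f r \<partial>lborel)
       = (\<integral>\<^sup>+t. ennreal (3 * B x) * (ennreal (norm x) * f (norm x * t)) \<partial>lborel)"
      by (simp only:) (simp add: nn_integral_cmult)
    also have "\<dots> = (\<integral>\<^sup>+t. ennreal (indicator {0<..} t * (3 * B x * norm x ^ 3 * t\<^sup>2)) * \<Phi> (t *\<^sub>R x) \<partial>lborel)"
    proof (rule nn_integral_cong)
      fix t :: real
      have i: "indicator {0<..} (norm x * t) = (indicator {0<..} t :: real)"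
        using x by (simp add: indicator_def zero_less_mult_iff)
      have r: "(norm x * t) *\<^sub>R ((1 / norm x) *\<^sub>R x) = t *\<^sub>R x"
        using x by simp
      have "ennreal (3 * B x) * (ennreal (norm x) * ennreal (indicator {0<..} t * (norm x * t)\<^sup>2))
        = ennreal (3 * B x * (norm x * (indicator {0<..} t * (norm x * t)\<^sup>2)))"
        using B0[of x] by (simp only: ennreal_mult' norm_ge_zero mult_nonneg_nonneg zero_le_numeral)
      also have "3 * B x * (norm x * (indicator {0<..} t * (norm x * t)\<^sup>2))
          = indicator {0<..} t * (3 * B x * norm x ^ 3 * t\<^sup>2)"
        by (simp add: power_mult_distrib power2_eq_square power3_eq_cube mult_ac)
      finally show "ennreal (3 * B x) * (ennreal (norm x) * f (norm x * t))
         = ennreal (indicator {0<..} t * (3 * B x * norm x ^ 3 * t\<^sup>2)) * \<Phi> (t *\<^sub>R x)"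
        unfolding f_def i r by (metis mult.assoc)
    qed
    finally show "ennreal (3 * B x) * (\<integral>\<^sup>+r. ennreal (indicator {0<..} r * r\<^sup>2) * \<Phi> (r *\<^sub>R ((1 / norm x) *\<^sub>R x)) \<partial>lborel)
       = (\<integral>\<^sup>+t. ennreal (indicator {0<..} t * (3 * B x * norm x ^ 3 * t\<^sup>2)) * \<Phi> (t *\<^sub>R x) \<partial>lborel)"
      unfolding f_def .
  qed
  also have "\<dots> = (\<integral>\<^sup>+t. \<integral>\<^sup>+x. ennreal (indicator {0<..} t * (3 * B x * norm x ^ 3 * t\<^sup>2)) * \<Phi> (t *\<^sub>R x) \<partial>lborel \<partial>lborel)"
    by (rule lborel_pair.Fubini') measurable
  also have "\<dots> = (\<integral>\<^sup>+t. \<integral>\<^sup>+y. ennreal (indicator {norm y<..} t * (3 / t ^ 4)) * (ennreal (norm y ^ 3) * \<Phi> y) \<partial>lborel \<partial>lborel)"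
  proof (rule nn_integral_cong)
    fix t :: real
    show "(\<integral>\<^sup>+x. ennreal (indicator {0<..} t * (3 * B x * norm x ^ 3 * t\<^sup>2)) * \<Phi> (t *\<^sub>R x) \<partial>lborel)
      = (\<integral>\<^sup>+y. ennreal (indicator {norm y<..} t * (3 / t ^ 4)) * (ennreal (norm y ^ 3) * \<Phi> y) \<partial>lborel)"
    proof (cases "0 < t")
      case False
      then have "t \<notin> {norm y<..}" for y :: "real^3"
        using norm_ge_zero[of y] by (auto simp del: norm_ge_zero)
      with False show ?thesis by simp
    next
      case True
      define f where "f y = ennreal (indicator {norm y<..} t * (3 / t ^ 4)) * (ennreal (norm y ^ 3) * \<Phi> y)" for y
      have "Measurable.pred borel (\<lambda>y::real^3. norm y < t)"
        by measurable
      then have [measurable]: "f \<in> borel_measurable borel"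
        unfolding f_def indicator_def greaterThan_iff by measurable
      have "(\<integral>\<^sup>+y. f y \<partial>lborel) = ennreal (t ^ 3) * (\<integral>\<^sup>+x. f (t *\<^sub>R x) \<partial>lborel)"
        using nn_integral_lborel_affine[of f t 0] True by simp
      also have "\<dots> = (\<integral>\<^sup>+x. ennreal (t ^ 3) * f (t *\<^sub>R x) \<partial>lborel)"
        by (subst nn_integral_cmult) auto
      also have "\<dots> = (\<integral>\<^sup>+x. ennreal (indicator {0<..} t * (3 * B x * norm x ^ 3 * t\<^sup>2)) * \<Phi> (t *\<^sub>R x) \<partial>lborel)"
      proof (rule nn_integral_cong)
        fix x :: "real^3"
        have n: "norm (t *\<^sub>R x) = t * norm x"
          using True by simp
        have i: "indicator {t * norm x<..} t = (B x :: real)" "indicator {0<..} t = (1::real)"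
          using True by (auto simp: B_def indicator_def)
        have "ennreal (t ^ 3) * (ennreal (B x * (3 / t ^ 4)) * ennreal ((t * norm x) ^ 3))
           = ennreal (t ^ 3 * (B x * (3 / t ^ 4) * (t * norm x) ^ 3))"
        proof -
          have m: "ennreal a * (ennreal b * ennreal c) = ennreal (a * (b * c))" if "0 \<le> a" "0 \<le> b" "0 \<le> c" for a b c :: real
            using that by (simp add: ennreal_mult)
          show ?thesis
            by (rule m) (use True B0[of x] in auto)
        qed
        also have "t ^ 3 * (B x * (3 / t ^ 4) * (t * norm x) ^ 3) = 1 * (3 * B x * norm x ^ 3 * t\<^sup>2)"
          using True by (simp add: field_simps flip: power_add)
        finally show "ennreal (t ^ 3) * f (t *\<^sub>R x)
           = ennreal (indicator {0<..} t * (3 * B x * norm x ^ 3 * t\<^sup>2)) * \<Phi> (t *\<^sub>R x)"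
          unfolding f_def n i by (metis mult.assoc)
      qed
      finally have "(\<integral>\<^sup>+y. f y \<partial>lborel) =
          (\<integral>\<^sup>+x. ennreal (indicator {0<..} t * (3 * B x * norm x ^ 3 * t\<^sup>2)) * \<Phi> (t *\<^sub>R x) \<partial>lborel)" .
      then show ?thesis
        unfolding f_def ..
    qed
  qed
  also have "\<dots> = (\<integral>\<^sup>+y. \<integral>\<^sup>+t. ennreal (indicator {norm y<..} t * (3 / t ^ 4)) * (ennreal (norm y ^ 3) * \<Phi> y) \<partial>lborel \<partial>lborel)"
  proof (rule lborel_pair.Fubini')
    have "Measurable.pred (borel \<Otimes>\<^sub>M borel) (\<lambda>(y::real^3, t::real). norm y < t)"
      by measurable
    then show "(\<lambda>(y, t). ennreal (indicator {norm y<..} t * (3 / t ^ 4)) * (ennreal (norm y ^ 3) * \<Phi> y))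
      \<in> borel_measurable (lborel \<Otimes>\<^sub>M lborel)"
      unfolding indicator_def greaterThan_iff by measurable
  qed
  also have "\<dots> = (\<integral>\<^sup>+y. \<Phi> y \<partial>lborel)"
  proof (rule nn_integral_cong_AE, rule AE_mp[OF AE_lborel_singleton[of 0]], rule AE_I2, rule impI)
    fix y :: "real^3" assume y: "y \<noteq> 0"
    have "(\<integral>\<^sup>+t. ennreal (indicator {norm y<..} t * (3 / t ^ 4)) * (ennreal (norm y ^ 3) * \<Phi> y) \<partial>lborel)
      = (\<integral>\<^sup>+t. ennreal (indicator {norm y<..} t * (3 / t ^ 4)) \<partial>lborel) * (ennreal (norm y ^ 3) * \<Phi> y)"
      by (rule nn_integral_multc) measurable
    also have "(\<integral>\<^sup>+t. ennreal (indicator {norm y<..} t * (3 / t ^ 4)) \<partial>lborel) = ennreal (1 / norm y ^ 3)"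
      using y by (intro nn_integral_inverse_power4) simp
    also have "ennreal (1 / norm y ^ 3) * (ennreal (norm y ^ 3) * \<Phi> y) = ennreal (1 / norm y ^ 3 * norm y ^ 3) * \<Phi> y"
      by (simp add: ennreal_mult mult.assoc del: times_divide_eq_left)
    finally show "(\<integral>\<^sup>+t. ennreal (indicator {norm y<..} t * (3 / t ^ 4)) * (ennreal (norm y ^ 3) * \<Phi> y) \<partial>lborel) = \<Phi> y"
      using y by simp
  qed
  finally show ?thesis ..
qed

interpretation sphere_lborel3: pair_sigma_finite sphere_measure "lborel :: (real^3) measure" ..
interpretation sphere_lborel: pair_sigma_finite sphere_measure "lborel :: real measure" ..
interpretation sphere_sphere: pair_sigma_finite sphere_measure sphere_measure ..

text \<open>In polar coordinates z = r \<sigma> the measure is r^2 dr d\<sigma> d\<omega>, symmetric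
  in the two unit vectors. Exchanging them is the collisional change of variables for the relative
  velocity.\<close>

lemma nn_integral_swap_direction:
  fixes \<Psi> :: "real^3 \<Rightarrow> real^3 \<Rightarrow> ennreal"
  assumes [measurable]: "(\<lambda>(z, \<omega>). \<Psi> z \<omega>) \<in> borel_measurable (borel \<Otimes>\<^sub>M borel)"
  shows "(\<integral>\<^sup>+z. \<integral>\<^sup>+\<omega>. \<Psi> z \<omega> \<partial>sphere_measure \<partial>lborel)
    = (\<integral>\<^sup>+z. \<integral>\<^sup>+\<omega>. \<Psi> (norm z *\<^sub>R \<omega>) ((1 / norm z) *\<^sub>R z) \<partial>sphere_measure \<partial>lborel)"
proof -
  define k where "k r = ennreal (indicator {0<..} r * r\<^sup>2)" for r :: real
  have [measurable]: "k \<in> borel_measurable borel"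
    unfolding k_def by measurable
  have "(\<integral>\<^sup>+z. \<integral>\<^sup>+\<omega>. \<Psi> z \<omega> \<partial>sphere_measure \<partial>lborel)
      = (\<integral>\<^sup>+\<sigma>. \<integral>\<^sup>+r. k r * (\<integral>\<^sup>+\<omega>. \<Psi> (r *\<^sub>R \<sigma>) \<omega> \<partial>sphere_measure) \<partial>lborel \<partial>sphere_measure)"
    unfolding k_def by (rule nn_integral_polar) measurable
  also have "\<dots> = (\<integral>\<^sup>+r. \<integral>\<^sup>+\<sigma>. k r * (\<integral>\<^sup>+\<omega>. \<Psi> (r *\<^sub>R \<sigma>) \<omega> \<partial>sphere_measure) \<partial>sphere_measure \<partial>lborel)"
    by (rule sphere_lborel.Fubini'[symmetric]) measurable
  also have "\<dots> = (\<integral>\<^sup>+r. k r * (\<integral>\<^sup>+\<sigma>. \<integral>\<^sup>+\<omega>. \<Psi> (r *\<^sub>R \<sigma>) \<omega> \<partial>sphere_measure \<partial>sphere_measure) \<partial>lborel)"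
    by (intro nn_integral_cong nn_integral_cmult) measurable
  also have "\<dots> = (\<integral>\<^sup>+r. k r * (\<integral>\<^sup>+\<sigma>. \<integral>\<^sup>+\<omega>. \<Psi> (r *\<^sub>R \<omega>) \<sigma> \<partial>sphere_measure \<partial>sphere_measure) \<partial>lborel)"
  proof (rule nn_integral_cong)
    fix r :: real
    have "(\<integral>\<^sup>+\<sigma>. \<integral>\<^sup>+\<omega>. \<Psi> (r *\<^sub>R \<omega>) \<sigma> \<partial>sphere_measure \<partial>sphere_measure)
        = (\<integral>\<^sup>+\<sigma>. \<integral>\<^sup>+\<omega>. \<Psi> (r *\<^sub>R \<sigma>) \<omega> \<partial>sphere_measure \<partial>sphere_measure)"
      by (rule sphere_sphere.Fubini') measurable
    then show "k r * (\<integral>\<^sup>+\<sigma>. \<integral>\<^sup>+\<omega>. \<Psi> (r *\<^sub>R \<sigma>) \<omega> \<partial>sphere_measure \<partial>sphere_measure)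
        = k r * (\<integral>\<^sup>+\<sigma>. \<integral>\<^sup>+\<omega>. \<Psi> (r *\<^sub>R \<omega>) \<sigma> \<partial>sphere_measure \<partial>sphere_measure)"
      by simp
  qed
  also have "\<dots> = (\<integral>\<^sup>+r. \<integral>\<^sup>+\<sigma>. k r * (\<integral>\<^sup>+\<omega>. \<Psi> (r *\<^sub>R \<omega>) \<sigma> \<partial>sphere_measure) \<partial>sphere_measure \<partial>lborel)"
    by (intro nn_integral_cong nn_integral_cmult[symmetric]) measurable
  also have "\<dots> = (\<integral>\<^sup>+\<sigma>. \<integral>\<^sup>+r. k r * (\<integral>\<^sup>+\<omega>. \<Psi> (r *\<^sub>R \<omega>) \<sigma> \<partial>sphere_measure) \<partial>lborel \<partial>sphere_measure)"
    by (rule sphere_lborel.Fubini') measurable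
  also have "\<dots> = (\<integral>\<^sup>+\<sigma>. \<integral>\<^sup>+r. k r * (\<integral>\<^sup>+\<omega>. \<Psi> (norm (r *\<^sub>R \<sigma>) *\<^sub>R \<omega>) ((1 / norm (r *\<^sub>R \<sigma>)) *\<^sub>R (r *\<^sub>R \<sigma>)) \<partial>sphere_measure) \<partial>lborel \<partial>sphere_measure)"
  proof (rule nn_integral_cong_AE, rule AE_mp[OF AE_norm_sphere_measure], rule AE_I2, rule impI, rule nn_integral_cong)
    fix \<sigma> :: "real^3" and r :: real assume "norm \<sigma> = 1"
    then show "k r * (\<integral>\<^sup>+\<omega>. \<Psi> (r *\<^sub>R \<omega>) \<sigma> \<partial>sphere_measure)
      = k r * (\<integral>\<^sup>+\<omega>. \<Psi> (norm (r *\<^sub>R \<sigma>) *\<^sub>R \<omega>) ((1 / norm (r *\<^sub>R \<sigma>)) *\<^sub>R (r *\<^sub>R \<sigma>)) \<partial>sphere_measure)"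
      by (cases "0 < r") (simp_all add: k_def)
  qed
  also have "\<dots> = (\<integral>\<^sup>+z. \<integral>\<^sup>+\<omega>. \<Psi> (norm z *\<^sub>R \<omega>) ((1 / norm z) *\<^sub>R z) \<partial>sphere_measure \<partial>lborel)"
    unfolding k_def by (rule nn_integral_polar[symmetric]) measurable
  finally show ?thesis .
qed

text \<open>The substitution is w = v - z followed by v = V + z/2. Each step is a reflection or a
  translation with the other variable fixed, so no Jacobian appears.\<close>

lemma nn_integral_center_of_mass:
  fixes f :: "real^3 \<Rightarrow> real^3 \<Rightarrow> ennreal"
  assumes [measurable]: "(\<lambda>(v, w). f v w) \<in> borel_measurable (borel \<Otimes>\<^sub>M borel)"
  shows "(\<integral>\<^sup>+v. \<integral>\<^sup>+w. f v w \<partial>lborel \<partial>lborel)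
    = (\<integral>\<^sup>+z. \<integral>\<^sup>+V. f ((1/2) *\<^sub>R z + V) (V - (1/2) *\<^sub>R z) \<partial>lborel \<partial>lborel)"
proof -
  have "(\<integral>\<^sup>+v. \<integral>\<^sup>+w. f v w \<partial>lborel \<partial>lborel) = (\<integral>\<^sup>+v. \<integral>\<^sup>+z. f v (v - z) \<partial>lborel \<partial>lborel)"
    by (intro nn_integral_cong nn_integral_reflect_translate[symmetric]) measurable
  also have "\<dots> = (\<integral>\<^sup>+z. \<integral>\<^sup>+v. f v (v - z) \<partial>lborel \<partial>lborel)"
    by (rule lborel_pair.Fubini') measurable
  also have "\<dots> = (\<integral>\<^sup>+z. \<integral>\<^sup>+V. f ((1/2) *\<^sub>R z + V) ((1/2) *\<^sub>R z + V - z) \<partial>lborel \<partial>lborel)"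
    by (intro nn_integral_cong nn_integral_translate[symmetric]) measurable
  also have "\<dots> = (\<integral>\<^sup>+z. \<integral>\<^sup>+V. f ((1/2) *\<^sub>R z + V) (V - (1/2) *\<^sub>R z) \<partial>lborel \<partial>lborel)"
  proof -
    have "(1/2) *\<^sub>R z + V - z = V - (1/2) *\<^sub>R z" for z V :: "real^3"
      by (simp add: vec_eq_iff)
    then show ?thesis by (simp only:)
  qed
  finally show ?thesis .
qed

text \<open>In centre-of-mass coordinates a collision keeps V and |z| and replaces z by |z|
  \<sigma>. Hence \<open>nn_integral_swap_direction\<close>, applied after V has been integrated
  out, exchanges pre- and post-collisional velocities.\<close>

lemma nn_integral_pre_post_collision:
  fixes \<Xi> :: "real^3 \<Rightarrow> real^3 \<Rightarrow> real^3 \<Rightarrow> real^3 \<Rightarrow> ennreal"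
  assumes \<Xi>: "(\<lambda>(a, b, c, d). \<Xi> a b c d) \<in> borel_measurable (borel \<Otimes>\<^sub>M borel \<Otimes>\<^sub>M borel \<Otimes>\<^sub>M borel)"
  shows "(\<integral>\<^sup>+v. \<integral>\<^sup>+w. \<integral>\<^sup>+\<sigma>. \<Xi> v w (vprime v w \<sigma>) (vsprime v w \<sigma>) \<partial>sphere_measure \<partial>lborel \<partial>lborel)
    = (\<integral>\<^sup>+v. \<integral>\<^sup>+w. \<integral>\<^sup>+\<sigma>. \<Xi> (vprime v w \<sigma>) (vsprime v w \<sigma>) v w \<partial>sphere_measure \<partial>lborel \<partial>lborel)"
proof -
  have [measurable (raw)]: "(\<lambda>x. \<Xi> (f1 x) (f2 x) (f3 x) (f4 x)) \<in> borel_measurable M"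
    if [measurable]: "f1 \<in> borel_measurable M" "f2 \<in> borel_measurable M" "f3 \<in> borel_measurable M"
      "f4 \<in> borel_measurable M" for f1 f2 f3 f4 and M :: "'z measure"
  proof -
    have "(\<lambda>x. (f1 x, f2 x, f3 x, f4 x)) \<in> M \<rightarrow>\<^sub>M borel \<Otimes>\<^sub>M borel \<Otimes>\<^sub>M borel \<Otimes>\<^sub>M borel"
      by measurable
    from measurable_compose[OF this \<Xi>] show ?thesis by simp
  qed
  have vp: "vprime ((1/2) *\<^sub>R z + V) (V - (1/2) *\<^sub>R z) \<sigma> = (1/2) *\<^sub>R (norm z *\<^sub>R \<sigma>) + V"
    "vsprime ((1/2) *\<^sub>R z + V) (V - (1/2) *\<^sub>R z) \<sigma> = V - (1/2) *\<^sub>R (norm z *\<^sub>R \<sigma>)" for z V \<sigma>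
  proof -
    have "(1/2) *\<^sub>R z + V - (V - (1/2) *\<^sub>R z) = z" "(1/2) *\<^sub>R ((1/2) *\<^sub>R z + V + (V - (1/2) *\<^sub>R z)) = V"
      by (simp_all add: vec_eq_iff)
    then show "vprime ((1/2) *\<^sub>R z + V) (V - (1/2) *\<^sub>R z) \<sigma> = (1/2) *\<^sub>R (norm z *\<^sub>R \<sigma>) + V"
      "vsprime ((1/2) *\<^sub>R z + V) (V - (1/2) *\<^sub>R z) \<sigma> = V - (1/2) *\<^sub>R (norm z *\<^sub>R \<sigma>)"
      unfolding vprime_def vsprime_def by simp_all
  qed
  define \<Psi> where "\<Psi> z \<sigma> = (\<integral>\<^sup>+V. \<Xi> ((1/2) *\<^sub>R z + V) (V - (1/2) *\<^sub>R z)
    ((1/2) *\<^sub>R (norm z *\<^sub>R \<sigma>) + V) (V - (1/2) *\<^sub>R (norm z *\<^sub>R \<sigma>)) \<partial>lborel)" for z \<sigma>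
  have [measurable]: "(\<lambda>(z, \<sigma>). \<Psi> z \<sigma>) \<in> borel_measurable (borel \<Otimes>\<^sub>M borel)"
    unfolding \<Psi>_def by measurable
  have "(\<integral>\<^sup>+v. \<integral>\<^sup>+w. \<integral>\<^sup>+\<sigma>. \<Xi> v w (vprime v w \<sigma>) (vsprime v w \<sigma>) \<partial>sphere_measure \<partial>lborel \<partial>lborel)
    = (\<integral>\<^sup>+z. \<integral>\<^sup>+V. \<integral>\<^sup>+\<sigma>. \<Xi> ((1/2) *\<^sub>R z + V) (V - (1/2) *\<^sub>R z)
        ((1/2) *\<^sub>R (norm z *\<^sub>R \<sigma>) + V) (V - (1/2) *\<^sub>R (norm z *\<^sub>R \<sigma>)) \<partial>sphere_measure \<partial>lborel \<partial>lborel)"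
    unfolding vp[symmetric] by (rule nn_integral_center_of_mass) measurable
  also have "\<dots> = (\<integral>\<^sup>+z. \<integral>\<^sup>+\<sigma>. \<Psi> z \<sigma> \<partial>sphere_measure \<partial>lborel)"
    unfolding \<Psi>_def by (intro nn_integral_cong sphere_lborel3.Fubini') measurable
  also have "\<dots> = (\<integral>\<^sup>+z. \<integral>\<^sup>+\<sigma>. \<Psi> (norm z *\<^sub>R \<sigma>) ((1 / norm z) *\<^sub>R z) \<partial>sphere_measure \<partial>lborel)"
    by (rule nn_integral_swap_direction) measurable
  also have "\<dots> = (\<integral>\<^sup>+z. \<integral>\<^sup>+\<sigma>. \<integral>\<^sup>+V. \<Xi> ((1/2) *\<^sub>R (norm z *\<^sub>R \<sigma>) + V) (V - (1/2) *\<^sub>R (norm z *\<^sub>R \<sigma>))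
    ((1/2) *\<^sub>R z + V) (V - (1/2) *\<^sub>R z) \<partial>lborel \<partial>sphere_measure \<partial>lborel)"
  proof (rule nn_integral_cong, rule nn_integral_cong_AE, rule AE_mp[OF AE_norm_sphere_measure], rule AE_I2, rule impI)
    fix z \<sigma> :: "real^3" assume "norm \<sigma> = 1"
    then have "norm (norm z *\<^sub>R \<sigma>) *\<^sub>R ((1 / norm z) *\<^sub>R z) = z"
      by simp
    then show "\<Psi> (norm z *\<^sub>R \<sigma>) ((1 / norm z) *\<^sub>R z)
      = (\<integral>\<^sup>+V. \<Xi> ((1/2) *\<^sub>R (norm z *\<^sub>R \<sigma>) + V) (V - (1/2) *\<^sub>R (norm z *\<^sub>R \<sigma>))
          ((1/2) *\<^sub>R z + V) (V - (1/2) *\<^sub>R z) \<partial>lborel)"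
      unfolding \<Psi>_def by (simp only:)
  qed
  also have "\<dots> = (\<integral>\<^sup>+z. \<integral>\<^sup>+V. \<integral>\<^sup>+\<sigma>. \<Xi> ((1/2) *\<^sub>R (norm z *\<^sub>R \<sigma>) + V) (V - (1/2) *\<^sub>R (norm z *\<^sub>R \<sigma>))
    ((1/2) *\<^sub>R z + V) (V - (1/2) *\<^sub>R z) \<partial>sphere_measure \<partial>lborel \<partial>lborel)"
    by (intro nn_integral_cong sphere_lborel3.Fubini'[symmetric]) measurable
  also have "\<dots> = (\<integral>\<^sup>+v. \<integral>\<^sup>+w. \<integral>\<^sup>+\<sigma>. \<Xi> (vprime v w \<sigma>) (vsprime v w \<sigma>) v w \<partial>sphere_measure \<partial>lborel \<partial>lborel)"
    unfolding vp[symmetric] by (rule nn_integral_center_of_mass[symmetric]) measurable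
  finally show ?thesis .
qed

section \<open>A trilinear estimate\<close>

text \<open>The bound of \<open>nn_integral_powr_neg_le\<close> at p = 2/3 with the cap constant K =
  96; the band constant 24 gives a quarter of it.\<close>

definition angular_const :: real where
  "angular_const = 96 * (2 / (1 - 2 powr (2/3 - 1)))"

lemma angular_const_nonneg: "0 \<le> angular_const"
  using powr_mono[of "2/3 - 1" 0 "2::real"] by (simp add: angular_const_def)

lemma nn_integral_sphere_cap:
  fixes \<omega> :: "real^3"
  assumes \<omega>: "norm \<omega> = 1"
  shows "(\<integral>\<^sup>+\<sigma>. ennreal (((1 - \<omega> \<bullet> \<sigma>) / 2) powr - (2/3)) \<partial>sphere_measure) \<le> ennreal angular_const"
  unfolding angular_const_def
proof (rule nn_integral_powr_neg_le)
  show "AE \<sigma> in sphere_measure. 0 \<le> (1 - \<omega> \<bullet> \<sigma>) / 2 \<and> (1 - \<omega> \<bullet> \<sigma>) / 2 \<le> 1"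
    using AE_norm_sphere_measure
  proof eventually_elim
    case (elim \<sigma>)
    then have "\<bar>\<omega> \<bullet> \<sigma>\<bar> \<le> 1"
      using Cauchy_Schwarz_ineq2[of \<omega> \<sigma>] \<omega> by simp
    then show ?case by auto
  qed
qed (use sphere_measure_cap[OF \<omega>] in simp_all)

lemma nn_integral_sphere_band:
  fixes \<omega> :: "real^3"
  assumes \<omega>: "norm \<omega> = 1"
  shows "(\<integral>\<^sup>+\<sigma>. ennreal (\<bar>\<omega> \<bullet> \<sigma>\<bar> powr - (2/3)) \<partial>sphere_measure) \<le> ennreal (angular_const / 4)"
proof -
  have "(\<integral>\<^sup>+\<sigma>. ennreal (\<bar>\<omega> \<bullet> \<sigma>\<bar> powr - (2/3)) \<partial>sphere_measure) \<le> ennreal (24 * (2 / (1 - 2 powr (2/3 - 1))))"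
  proof (rule nn_integral_powr_neg_le)
    show "AE \<sigma> in sphere_measure. 0 \<le> \<bar>\<omega> \<bullet> \<sigma>\<bar> \<and> \<bar>\<omega> \<bullet> \<sigma>\<bar> \<le> 1"
    using AE_norm_sphere_measure
  proof eventually_elim
    case (elim \<sigma>)
    then show ?case
      using Cauchy_Schwarz_ineq2[of \<omega> \<sigma>] \<omega> by simp
  qed
qed (use sphere_measure_band[OF \<omega>] in simp_all)
  moreover have "(96 * x) / 4 = 24 * x" for x :: real
    by simp
  ultimately show ?thesis
    unfolding angular_const_def by (simp only:)
qed

text \<open>Large powers of s concentrate near s = 1, so the cap is centred at the direction
  opposite to v - w, where (1 - \<omega> . \<sigma>)/2 = 1 - s^2. The constant is 384 = 4 *
  96.\<close>

lemma nn_integral_sinhalf_powr_large: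
  assumes "v \<noteq> w" "0 < q"
  shows "(\<integral>\<^sup>+\<sigma>. ennreal (((sinhalf v w \<sigma>)\<^sup>2) powr q) \<partial>sphere_measure) \<le> ennreal (384 / q)"
proof -
  define \<omega> where "\<omega> = - ((1 / norm (v - w)) *\<^sub>R (v - w))"
  have \<omega>: "norm \<omega> = 1"
    using assms by (simp add: \<omega>_def)
  have "(\<integral>\<^sup>+\<sigma>. ennreal (((sinhalf v w \<sigma>)\<^sup>2) powr q) \<partial>sphere_measure)
      = (\<integral>\<^sup>+\<sigma>. ennreal ((1 - (1 - \<omega> \<bullet> \<sigma>) / 2) powr q) \<partial>sphere_measure)"
  proof (rule nn_integral_cong_AE, use AE_norm_sphere_measure in eventually_elim)
    case (elim \<sigma>)
    have "(sinhalf v w \<sigma>)\<^sup>2 = (1 + \<omega> \<bullet> \<sigma>) / 2"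
      unfolding sinhalf_sq[OF elim assms(1)] \<omega>_def inner_minus_left by simp
    also have "\<dots> = 1 - (1 - \<omega> \<bullet> \<sigma>) / 2"
      by (simp add: field_simps)
    finally show ?case by simp
  qed
  also have "\<dots> \<le> ennreal (4 * 96 / q)"
  proof (rule nn_integral_one_minus_powr_le)
    show "AE \<sigma> in sphere_measure. 0 \<le> (1 - \<omega> \<bullet> \<sigma>) / 2 \<and> (1 - \<omega> \<bullet> \<sigma>) / 2 \<le> 1"
      using AE_norm_sphere_measure
    proof eventually_elim
      case (elim \<sigma>)
      then have "\<bar>\<omega> \<bullet> \<sigma>\<bar> \<le> 1"
        using Cauchy_Schwarz_ineq2[of \<omega> \<sigma>] \<omega> by simp
      then show ?case by auto
    qed
  qed (use sphere_measure_cap[OF \<omega>] assms(2) in simp_all)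
  finally show ?thesis by simp
qed

lemma nn_integral_sinhalf_powr_neg:
  assumes "v \<noteq> w"
  shows "(\<integral>\<^sup>+\<sigma>. ennreal (((sinhalf v w \<sigma>)\<^sup>2) powr - (2/3)) \<partial>sphere_measure)
    \<le> ennreal angular_const"
proof -
  define \<omega> where "\<omega> = (1 / norm (v - w)) *\<^sub>R (v - w)"
  have \<omega>: "norm \<omega> = 1"
    using assms by (simp add: \<omega>_def)
  have "(\<integral>\<^sup>+\<sigma>. ennreal (((sinhalf v w \<sigma>)\<^sup>2) powr - (2/3)) \<partial>sphere_measure)
      = (\<integral>\<^sup>+\<sigma>. ennreal (((1 - \<omega> \<bullet> \<sigma>) / 2) powr - (2/3)) \<partial>sphere_measure)"
  proof (rule nn_integral_cong_AE, use AE_norm_sphere_measure in eventually_elim)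
    case (elim \<sigma>)
    show ?case
      unfolding sinhalf_sq[OF elim assms(1)] \<omega>_def ..
  qed
  also note nn_integral_sphere_cap[OF \<omega>]
  finally show ?thesis .
qed

text \<open>Permits division by powers of s under the integral: the exceptional set is a cap of size
  t = 0.\<close>

lemma AE_sinhalf_nonzero:
  assumes "v \<noteq> w"
  shows "AE \<sigma> in sphere_measure. sinhalf v w \<sigma> \<noteq> 0"
proof -
  define \<omega> where "\<omega> = (1 / norm (v - w)) *\<^sub>R (v - w)"
  have \<omega>: "norm \<omega> = 1"
    using assms by (simp add: \<omega>_def)
  have "emeasure sphere_measure {\<sigma>. (1 - \<omega> \<bullet> \<sigma>) / 2 \<le> 0} = 0"
    using sphere_measure_cap[OF \<omega>, of 0] by simp
  then have "AE \<sigma> in sphere_measure. \<not> (1 - \<omega> \<bullet> \<sigma>) / 2 \<le> 0"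
    by (intro AE_I[where N = "{\<sigma>. (1 - \<omega> \<bullet> \<sigma>) / 2 \<le> 0}"]) auto
  with AE_norm_sphere_measure show ?thesis
  proof eventually_elim
    case (elim \<sigma>)
    then have "(sinhalf v w \<sigma>)\<^sup>2 > 0"
      unfolding sinhalf_sq[OF elim(1) assms] \<omega>_def by linarith
    then show ?case by auto
  qed
qed

text \<open>With \<open>n y\<close> the unit vector from v to y, s^(4/3) is the product of s^2/4 and
  4 |n(v') . \<sigma>|^(-2/3). The first factor is the Jacobian at fixed \<sigma>; the second
  depends on y = v' and \<sigma> only. The integral over \<sigma> at fixed y then costs 4 times the
  band bound \<open>angular_const / 4\<close>.\<close>

lemma nn_integral_vprime_sphere_le:
  fixes H :: "real^3 \<Rightarrow> real"
  assumes [measurable]: "H \<in> borel_measurable borel"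
  shows "(\<integral>\<^sup>+w. \<integral>\<^sup>+\<sigma>. ennreal ((H (vprime v w \<sigma>))\<^sup>2 * sinhalf v w \<sigma> powr (4/3)) \<partial>sphere_measure \<partial>lborel)
    \<le> ennreal angular_const * (\<integral>\<^sup>+y. ennreal ((H y)\<^sup>2) \<partial>lborel)"
proof -
  define n where "n y = (1 / norm (y - v)) *\<^sub>R (y - v)" for y
  have [measurable]: "n \<in> borel_measurable borel"
    unfolding n_def by measurable
  have "(\<integral>\<^sup>+w. \<integral>\<^sup>+\<sigma>. ennreal ((H (vprime v w \<sigma>))\<^sup>2 * sinhalf v w \<sigma> powr (4/3)) \<partial>sphere_measure \<partial>lborel)
    = (\<integral>\<^sup>+\<sigma>. \<integral>\<^sup>+w. ennreal ((H (vprime v w \<sigma>))\<^sup>2 * sinhalf v w \<sigma> powr (4/3)) \<partial>lborel \<partial>sphere_measure)"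
    by (rule sphere_lborel3.Fubini') measurable
  also have "\<dots> \<le> (\<integral>\<^sup>+\<sigma>. \<integral>\<^sup>+y. ennreal (4 * (H y)\<^sup>2 * \<bar>n y \<bullet> \<sigma>\<bar> powr - (2/3)) \<partial>lborel \<partial>sphere_measure)"
  proof (rule nn_integral_mono_AE, use AE_norm_sphere_measure in eventually_elim)
    case (elim \<sigma>)
    have "(\<integral>\<^sup>+w. ennreal ((H (vprime v w \<sigma>))\<^sup>2 * sinhalf v w \<sigma> powr (4/3)) \<partial>lborel)
      = (\<integral>\<^sup>+w. ennreal ((sinhalf v w \<sigma>)\<^sup>2 / 4) *
          ennreal (4 * (H (vprime v w \<sigma>))\<^sup>2 * \<bar>n (vprime v w \<sigma>) \<bullet> \<sigma>\<bar> powr - (2/3)) \<partial>lborel)"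
    proof (rule nn_integral_cong)
      fix w
      show "ennreal ((H (vprime v w \<sigma>))\<^sup>2 * sinhalf v w \<sigma> powr (4/3))
        = ennreal ((sinhalf v w \<sigma>)\<^sup>2 / 4) *
          ennreal (4 * (H (vprime v w \<sigma>))\<^sup>2 * \<bar>n (vprime v w \<sigma>) \<bullet> \<sigma>\<bar> powr - (2/3))"
      proof (cases "vprime v w \<sigma> = v")
        case True
        then show ?thesis by (simp add: sinhalf_def)
      next
        case False
        have s: "\<bar>n (vprime v w \<sigma>) \<bullet> \<sigma>\<bar> = sinhalf v w \<sigma>"
          unfolding n_def sinhalf_eq_inner[OF elim False, symmetric] using sinhalf_nonneg by simp
        have p: "sinhalf v w \<sigma> > 0"
        proof -
          have "v \<noteq> w"
            using False by auto
          with False show ?thesis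
            by (simp add: sinhalf_def)
        qed
        have "sinhalf v w \<sigma> powr (4/3) = (sinhalf v w \<sigma>)\<^sup>2 * sinhalf v w \<sigma> powr - (2/3)"
          using p by (simp add: powr_add[symmetric] flip: powr_numeral)
        then show ?thesis
          unfolding s by (subst ennreal_mult[symmetric]) auto
      qed
    qed
    also have "\<dots> \<le> (\<integral>\<^sup>+y. ennreal (4 * (H y)\<^sup>2 * \<bar>n y \<bullet> \<sigma>\<bar> powr - (2/3)) \<partial>lborel)"
      by (rule nn_integral_vprime_le[OF elim]) measurable
    finally show ?case .
  qed
  also have "\<dots> = (\<integral>\<^sup>+y. \<integral>\<^sup>+\<sigma>. ennreal (4 * (H y)\<^sup>2 * \<bar>n y \<bullet> \<sigma>\<bar> powr - (2/3)) \<partial>sphere_measure \<partial>lborel)"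
    by (rule sphere_lborel3.Fubini'[symmetric]) measurable
  also have "\<dots> \<le> (\<integral>\<^sup>+y. ennreal angular_const * ennreal ((H y)\<^sup>2) \<partial>lborel)"
  proof (rule nn_integral_mono_AE, use AE_lborel_singleton[of v] in eventually_elim)
    case (elim y)
    have n1: "norm (n y) = 1"
      using elim by (simp add: n_def)
    have "(\<integral>\<^sup>+\<sigma>. ennreal (4 * (H y)\<^sup>2 * \<bar>n y \<bullet> \<sigma>\<bar> powr - (2/3)) \<partial>sphere_measure)
      = (\<integral>\<^sup>+\<sigma>. ennreal (4 * (H y)\<^sup>2) * ennreal (\<bar>n y \<bullet> \<sigma>\<bar> powr - (2/3)) \<partial>sphere_measure)"
      by (intro nn_integral_cong ennreal_mult) auto
    also have "\<dots> = ennreal (4 * (H y)\<^sup>2) * (\<integral>\<^sup>+\<sigma>. ennreal (\<bar>n y \<bullet> \<sigma>\<bar> powr - (2/3)) \<partial>sphere_measure)"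
      by (rule nn_integral_cmult) measurable
    also have "\<dots> \<le> ennreal (4 * (H y)\<^sup>2) * ennreal (angular_const / 4)"
      by (intro mult_left_mono nn_integral_sphere_band n1) auto
    also have "\<dots> = ennreal (4 * (H y)\<^sup>2 * (angular_const / 4))"
      by (rule ennreal_mult[symmetric]) (use angular_const_nonneg in auto)
    also have "4 * (H y)\<^sup>2 * (angular_const / 4) = angular_const * (H y)\<^sup>2"
      by simp
    also have "ennreal \<dots> = ennreal angular_const * ennreal ((H y)\<^sup>2)"
      by (rule ennreal_mult) (use angular_const_nonneg in auto)
    finally show ?case .
  qed
  also have "\<dots> = ennreal angular_const * (\<integral>\<^sup>+y. ennreal ((H y)\<^sup>2) \<partial>lborel)"
    by (rule nn_integral_cmult) measurable
  finally show ?thesis .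
qed

lemma nn_integral_triple:
  assumes f [measurable]: "(\<lambda>(v, w, \<sigma>). f v w \<sigma>) \<in> borel_measurable (borel \<Otimes>\<^sub>M borel \<Otimes>\<^sub>M borel)"
  shows "(\<integral>\<^sup>+x. (case x of (v, w, \<sigma>) \<Rightarrow> f v w \<sigma>) \<partial>((lborel :: (real^3) measure) \<Otimes>\<^sub>M ((lborel :: (real^3) measure) \<Otimes>\<^sub>M sphere_measure)))
    = (\<integral>\<^sup>+v. \<integral>\<^sup>+w. \<integral>\<^sup>+\<sigma>. f v w \<sigma> \<partial>sphere_measure \<partial>lborel \<partial>lborel)"
proof -
  interpret ls: pair_sigma_finite "lborel :: (real^3) measure" sphere_measure ..
  have "(\<integral>\<^sup>+x. (case x of (v, w, \<sigma>) \<Rightarrow> f v w \<sigma>) \<partial>((lborel :: (real^3) measure) \<Otimes>\<^sub>M ((lborel :: (real^3) measure) \<Otimes>\<^sub>M sphere_measure)))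
    = (\<integral>\<^sup>+v. \<integral>\<^sup>+y. (case (v, y) of (v, w, \<sigma>) \<Rightarrow> f v w \<sigma>) \<partial>((lborel :: (real^3) measure) \<Otimes>\<^sub>M sphere_measure) \<partial>lborel)"
    by (rule sigma_finite_measure.nn_integral_fst[symmetric]) (rule ls.P.sigma_finite_measure_axioms, measurable)
  also have "\<dots> = (\<integral>\<^sup>+v. \<integral>\<^sup>+w. \<integral>\<^sup>+\<sigma>. (case (v, w, \<sigma>) of (v, w, \<sigma>) \<Rightarrow> f v w \<sigma>) \<partial>sphere_measure \<partial>lborel \<partial>lborel)"
    by (intro nn_integral_cong sphere.nn_integral_fst[symmetric]) measurable
  finally show ?thesis by simp
qed

lemma Cauchy_Schwarz_nn_integral_triple:
  assumes "(\<lambda>(v, w, \<sigma>). f v w \<sigma>) \<in> borel_measurable (borel \<Otimes>\<^sub>M borel \<Otimes>\<^sub>M borel)"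
    "(\<lambda>(v, w, \<sigma>). g v w \<sigma>) \<in> borel_measurable (borel \<Otimes>\<^sub>M borel \<Otimes>\<^sub>M borel)"
  shows "(\<integral>\<^sup>+v. \<integral>\<^sup>+w. \<integral>\<^sup>+\<sigma>. f v w \<sigma> * g v w \<sigma> \<partial>sphere_measure \<partial>(lborel :: (real^3) measure) \<partial>(lborel :: (real^3) measure))\<^sup>2
    \<le> (\<integral>\<^sup>+v. \<integral>\<^sup>+w. \<integral>\<^sup>+\<sigma>. (f v w \<sigma>)\<^sup>2 \<partial>sphere_measure \<partial>lborel \<partial>lborel)
      * (\<integral>\<^sup>+v. \<integral>\<^sup>+w. \<integral>\<^sup>+\<sigma>. (g v w \<sigma>)\<^sup>2 \<partial>sphere_measure \<partial>lborel \<partial>lborel)"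
proof -
  have [measurable]: "(\<lambda>x. f (fst x) (fst (snd x)) (snd (snd x))) \<in> borel_measurable (borel \<Otimes>\<^sub>M borel \<Otimes>\<^sub>M borel)"
    "(\<lambda>x. g (fst x) (fst (snd x)) (snd (snd x))) \<in> borel_measurable (borel \<Otimes>\<^sub>M borel \<Otimes>\<^sub>M borel)"
    using assms by (simp_all add: case_prod_beta')
  have "(\<integral>\<^sup>+x. (case x of (v, w, \<sigma>) \<Rightarrow> f v w \<sigma>) * (case x of (v, w, \<sigma>) \<Rightarrow> g v w \<sigma>) \<partial>((lborel :: (real^3) measure) \<Otimes>\<^sub>M ((lborel :: (real^3) measure) \<Otimes>\<^sub>M sphere_measure)))\<^sup>2
    \<le> (\<integral>\<^sup>+x. (case x of (v, w, \<sigma>) \<Rightarrow> f v w \<sigma>)\<^sup>2 \<partial>(lborel \<Otimes>\<^sub>M (lborel \<Otimes>\<^sub>M sphere_measure)))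
     * (\<integral>\<^sup>+x. (case x of (v, w, \<sigma>) \<Rightarrow> g v w \<sigma>)\<^sup>2 \<partial>(lborel \<Otimes>\<^sub>M (lborel \<Otimes>\<^sub>M sphere_measure)))"
    by (rule Cauchy_Schwarz_nn_integral) measurable
  also have "(\<lambda>x. (case x of (v, w, \<sigma>) \<Rightarrow> f v w \<sigma>) * (case x of (v, w, \<sigma>) \<Rightarrow> g v w \<sigma>))
    = (\<lambda>x. case x of (v, w, \<sigma>) \<Rightarrow> f v w \<sigma> * g v w \<sigma>)"
    by auto
  also have "(\<integral>\<^sup>+x. (case x of (v, w, \<sigma>) \<Rightarrow> f v w \<sigma> * g v w \<sigma>) \<partial>((lborel :: (real^3) measure) \<Otimes>\<^sub>M ((lborel :: (real^3) measure) \<Otimes>\<^sub>M sphere_measure)))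
    = (\<integral>\<^sup>+v. \<integral>\<^sup>+w. \<integral>\<^sup>+\<sigma>. f v w \<sigma> * g v w \<sigma> \<partial>sphere_measure \<partial>lborel \<partial>lborel)"
    by (rule nn_integral_triple) measurable
  also have "(\<lambda>x. (case x of (v, w, \<sigma>) \<Rightarrow> f v w \<sigma>)\<^sup>2) = (\<lambda>x. case x of (v, w, \<sigma>) \<Rightarrow> (f v w \<sigma>)\<^sup>2)"
    by auto
  also have "(\<integral>\<^sup>+x. (case x of (v, w, \<sigma>) \<Rightarrow> (f v w \<sigma>)\<^sup>2) \<partial>((lborel :: (real^3) measure) \<Otimes>\<^sub>M ((lborel :: (real^3) measure) \<Otimes>\<^sub>M sphere_measure)))
    = (\<integral>\<^sup>+v. \<integral>\<^sup>+w. \<integral>\<^sup>+\<sigma>. (f v w \<sigma>)\<^sup>2 \<partial>sphere_measure \<partial>lborel \<partial>lborel)"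
    by (rule nn_integral_triple) measurable
  also have "(\<lambda>x. (case x of (v, w, \<sigma>) \<Rightarrow> g v w \<sigma>)\<^sup>2) = (\<lambda>x. case x of (v, w, \<sigma>) \<Rightarrow> (g v w \<sigma>)\<^sup>2)"
    by auto
  also have "(\<integral>\<^sup>+x. (case x of (v, w, \<sigma>) \<Rightarrow> (g v w \<sigma>)\<^sup>2) \<partial>((lborel :: (real^3) measure) \<Otimes>\<^sub>M ((lborel :: (real^3) measure) \<Otimes>\<^sub>M sphere_measure)))
    = (\<integral>\<^sup>+v. \<integral>\<^sup>+w. \<integral>\<^sup>+\<sigma>. (g v w \<sigma>)\<^sup>2 \<partial>sphere_measure \<partial>lborel \<partial>lborel)"
    by (rule nn_integral_triple) measurable
  finally show ?thesis .
qed

lemma ennreal_mult3: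
  "0 \<le> a \<Longrightarrow> 0 \<le> b \<Longrightarrow> 0 \<le> c \<Longrightarrow> ennreal (a * (b * c)) = ennreal a * (ennreal b * ennreal c)"
  by (simp add: ennreal_mult)

text \<open>\<open>G\<close> is split as sqrt G times sqrt G, so both squared factors contain it to
  the first power; therefore it enters through its L^1 norm, while \<open>F\<close> and
  \<open>H\<close> enter through L^2. In the square of \<open>A\<close> the \<sigma>-integral at
  fixed v, w gives \<open>K\<close>; in the square of \<open>B\<close> the integral over w and
  \<sigma> at fixed v is \<open>nn_integral_vprime_sphere_le\<close>.\<close>

lemma nn_integral_trilinear_sinhalf:
  fixes F G H :: "real^3 \<Rightarrow> real" and \<beta> :: "real \<Rightarrow> real"
  assumes [measurable]: "F \<in> borel_measurable borel" "G \<in> borel_measurable borel" "H \<in> borel_measurable borel"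
    "\<beta> \<in> borel_measurable borel"
    and nonneg: "\<And>v. 0 \<le> F v" "\<And>v. 0 \<le> G v" "\<And>v. 0 \<le> H v" "\<And>s. 0 \<le> \<beta> s"
    and K: "\<And>v w. v \<noteq> w \<Longrightarrow>
      (\<integral>\<^sup>+\<sigma>. ennreal ((\<beta> (sinhalf v w \<sigma>))\<^sup>2 * sinhalf v w \<sigma> powr - (4/3)) \<partial>sphere_measure) \<le> K"
  shows "(\<integral>\<^sup>+v. \<integral>\<^sup>+w. \<integral>\<^sup>+\<sigma>. ennreal (F w * G v * H (vprime v w \<sigma>) * \<beta> (sinhalf v w \<sigma>))
        \<partial>sphere_measure \<partial>lborel \<partial>lborel)\<^sup>2
    \<le> K * ennreal angular_const * (\<integral>\<^sup>+v. ennreal ((F v)\<^sup>2) \<partial>lborel)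
      * (\<integral>\<^sup>+v. ennreal (G v) \<partial>lborel)\<^sup>2 * (\<integral>\<^sup>+v. ennreal ((H v)\<^sup>2) \<partial>lborel)"
proof -
  define A where "A v w \<sigma> = ennreal (F w * sqrt (G v) * \<beta> (sinhalf v w \<sigma>) * sinhalf v w \<sigma> powr - (2/3))" for v w \<sigma>
  define B where "B v w \<sigma> = ennreal (sqrt (G v) * H (vprime v w \<sigma>) * sinhalf v w \<sigma> powr (2/3))" for v w \<sigma>
  have AB_borel: "(\<lambda>(v, w, \<sigma>). A v w \<sigma>) \<in> borel_measurable (borel \<Otimes>\<^sub>M borel \<Otimes>\<^sub>M borel)"
    "(\<lambda>(v, w, \<sigma>). B v w \<sigma>) \<in> borel_measurable (borel \<Otimes>\<^sub>M borel \<Otimes>\<^sub>M borel)"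
    unfolding A_def B_def by measurable
  have AB: "A v w \<sigma> * B v w \<sigma> = ennreal (F w * G v * H (vprime v w \<sigma>) * \<beta> (sinhalf v w \<sigma>))"
    if "sinhalf v w \<sigma> \<noteq> 0" for v w \<sigma>
  proof -
    have "sinhalf v w \<sigma> powr - (2/3) * sinhalf v w \<sigma> powr (2/3) = 1"
      using that by (simp flip: powr_add)
    then have "F w * sqrt (G v) * \<beta> (sinhalf v w \<sigma>) * sinhalf v w \<sigma> powr - (2/3) *
        (sqrt (G v) * H (vprime v w \<sigma>) * sinhalf v w \<sigma> powr (2/3))
      = F w * (sqrt (G v))\<^sup>2 * H (vprime v w \<sigma>) * \<beta> (sinhalf v w \<sigma>)"
      by algebra
    then show ?thesis
      unfolding A_def B_def using nonneg by (subst ennreal_mult[symmetric]) auto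
  qed
  have A2: "(A v w \<sigma>)\<^sup>2 = ennreal (G v) * (ennreal ((F w)\<^sup>2)
      * ennreal ((\<beta> (sinhalf v w \<sigma>))\<^sup>2 * sinhalf v w \<sigma> powr - (4/3)))" for v w \<sigma>
  proof -
    have "(sinhalf v w \<sigma> powr - (2/3))\<^sup>2 = sinhalf v w \<sigma> powr - (4/3)"
      by (simp add: power2_eq_square flip: powr_add)
    then have "(F w * sqrt (G v) * \<beta> (sinhalf v w \<sigma>) * sinhalf v w \<sigma> powr - (2/3))\<^sup>2
      = G v * ((F w)\<^sup>2 * ((\<beta> (sinhalf v w \<sigma>))\<^sup>2 * sinhalf v w \<sigma> powr - (4/3)))"
      using nonneg by (simp add: power_mult_distrib)
    then show ?thesis
      unfolding A_def using nonneg by (subst ennreal_power) (simp_all add: ennreal_mult3)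
  qed
  have B2: "(B v w \<sigma>)\<^sup>2 = ennreal (G v) * ennreal ((H (vprime v w \<sigma>))\<^sup>2 * sinhalf v w \<sigma> powr (4/3))" for v w \<sigma>
  proof -
    have "(sinhalf v w \<sigma> powr (2/3))\<^sup>2 = sinhalf v w \<sigma> powr (4/3)"
      by (simp add: power2_eq_square flip: powr_add)
    then have "(sqrt (G v) * H (vprime v w \<sigma>) * sinhalf v w \<sigma> powr (2/3))\<^sup>2
      = G v * ((H (vprime v w \<sigma>))\<^sup>2 * sinhalf v w \<sigma> powr (4/3))"
      using nonneg by (simp add: power_mult_distrib)
    then show ?thesis
      unfolding B_def using nonneg by (subst ennreal_power) (simp_all add: ennreal_mult')
  qed
  have "(\<integral>\<^sup>+v. \<integral>\<^sup>+w. \<integral>\<^sup>+\<sigma>. ennreal (F w * G v * H (vprime v w \<sigma>) * \<beta> (sinhalf v w \<sigma>))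
        \<partial>sphere_measure \<partial>lborel \<partial>lborel)
      = (\<integral>\<^sup>+v. \<integral>\<^sup>+w. \<integral>\<^sup>+\<sigma>. A v w \<sigma> * B v w \<sigma> \<partial>sphere_measure \<partial>lborel \<partial>lborel)"
  proof (rule nn_integral_cong)
    fix v :: "real^3"
    show "(\<integral>\<^sup>+w. \<integral>\<^sup>+\<sigma>. ennreal (F w * G v * H (vprime v w \<sigma>) * \<beta> (sinhalf v w \<sigma>)) \<partial>sphere_measure \<partial>lborel)
      = (\<integral>\<^sup>+w. \<integral>\<^sup>+\<sigma>. A v w \<sigma> * B v w \<sigma> \<partial>sphere_measure \<partial>lborel)"
    proof (rule nn_integral_cong_AE, use AE_lborel_singleton[of v] in eventually_elim)
      case (elim w)
      show ?case
        by (rule nn_integral_cong_AE, use AE_sinhalf_nonzero[OF elim[symmetric]] in eventually_elim) (simp add: AB)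
    qed
  qed
  also have "\<dots>\<^sup>2 \<le> (\<integral>\<^sup>+v. \<integral>\<^sup>+w. \<integral>\<^sup>+\<sigma>. (A v w \<sigma>)\<^sup>2 \<partial>sphere_measure \<partial>lborel \<partial>lborel)
      * (\<integral>\<^sup>+v. \<integral>\<^sup>+w. \<integral>\<^sup>+\<sigma>. (B v w \<sigma>)\<^sup>2 \<partial>sphere_measure \<partial>lborel \<partial>lborel)"
    by (rule Cauchy_Schwarz_nn_integral_triple[OF AB_borel])
  also have "\<dots> \<le> ((\<integral>\<^sup>+v. ennreal (G v) \<partial>lborel) * (K * (\<integral>\<^sup>+v. ennreal ((F v)\<^sup>2) \<partial>lborel)))
      * ((\<integral>\<^sup>+v. ennreal (G v) \<partial>lborel) * (ennreal angular_const * (\<integral>\<^sup>+v. ennreal ((H v)\<^sup>2) \<partial>lborel)))"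
  proof (rule mult_mono)
    have "(\<integral>\<^sup>+v. \<integral>\<^sup>+w. \<integral>\<^sup>+\<sigma>. (A v w \<sigma>)\<^sup>2 \<partial>sphere_measure \<partial>lborel \<partial>lborel)
      = (\<integral>\<^sup>+v. \<integral>\<^sup>+w. ennreal (G v) * (ennreal ((F w)\<^sup>2)
      * (\<integral>\<^sup>+\<sigma>. ennreal ((\<beta> (sinhalf v w \<sigma>))\<^sup>2 * sinhalf v w \<sigma> powr - (4/3)) \<partial>sphere_measure)) \<partial>lborel \<partial>lborel)"
      unfolding A2 by (simp add: nn_integral_cmult)
    also have "\<dots> \<le> (\<integral>\<^sup>+v. \<integral>\<^sup>+w. ennreal (G v) * (ennreal ((F w)\<^sup>2) * K) \<partial>lborel \<partial>lborel)"
    proof (rule nn_integral_mono, rule nn_integral_mono_AE)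
      fix v :: "real^3"
      show "AE w in lborel. ennreal (G v) * (ennreal ((F w)\<^sup>2)
          * (\<integral>\<^sup>+\<sigma>. ennreal ((\<beta> (sinhalf v w \<sigma>))\<^sup>2 * sinhalf v w \<sigma> powr - (4/3)) \<partial>sphere_measure))
        \<le> ennreal (G v) * (ennreal ((F w)\<^sup>2) * K)"
        using AE_lborel_singleton[of v] by eventually_elim (intro mult_left_mono K, auto)
    qed
    also have "\<dots> = (\<integral>\<^sup>+v. ennreal (G v) \<partial>lborel) * (K * (\<integral>\<^sup>+v. ennreal ((F v)\<^sup>2) \<partial>lborel))"
      by (simp add: nn_integral_cmult nn_integral_multc mult_ac)
    finally show "(\<integral>\<^sup>+v. \<integral>\<^sup>+w. \<integral>\<^sup>+\<sigma>. (A v w \<sigma>)\<^sup>2 \<partial>sphere_measure \<partial>lborel \<partial>lborel)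
      \<le> (\<integral>\<^sup>+v. ennreal (G v) \<partial>lborel) * (K * (\<integral>\<^sup>+v. ennreal ((F v)\<^sup>2) \<partial>lborel))" .
    have "(\<integral>\<^sup>+v. \<integral>\<^sup>+w. \<integral>\<^sup>+\<sigma>. (B v w \<sigma>)\<^sup>2 \<partial>sphere_measure \<partial>lborel \<partial>lborel)
      = (\<integral>\<^sup>+v. ennreal (G v) * (\<integral>\<^sup>+w. \<integral>\<^sup>+\<sigma>. ennreal ((H (vprime v w \<sigma>))\<^sup>2 * sinhalf v w \<sigma> powr (4/3)) \<partial>sphere_measure \<partial>lborel) \<partial>lborel)"
      unfolding B2 by (simp add: nn_integral_cmult)
    also have "\<dots> \<le> (\<integral>\<^sup>+v. ennreal (G v) * (ennreal angular_const * (\<integral>\<^sup>+y. ennreal ((H y)\<^sup>2) \<partial>lborel)) \<partial>lborel)"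
      by (intro nn_integral_mono mult_left_mono nn_integral_vprime_sphere_le) auto
    also have "\<dots> = (\<integral>\<^sup>+v. ennreal (G v) \<partial>lborel) * (ennreal angular_const * (\<integral>\<^sup>+v. ennreal ((H v)\<^sup>2) \<partial>lborel))"
      by (rule nn_integral_multc) measurable
    finally show "(\<integral>\<^sup>+v. \<integral>\<^sup>+w. \<integral>\<^sup>+\<sigma>. (B v w \<sigma>)\<^sup>2 \<partial>sphere_measure \<partial>lborel \<partial>lborel)
      \<le> (\<integral>\<^sup>+v. ennreal (G v) \<partial>lborel) * (ennreal angular_const * (\<integral>\<^sup>+v. ennreal ((H v)\<^sup>2) \<partial>lborel))" .
  qed auto
  also have "\<dots> = K * ennreal angular_const * (\<integral>\<^sup>+v. ennreal ((F v)\<^sup>2) \<partial>lborel)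
      * (\<integral>\<^sup>+v. ennreal (G v) \<partial>lborel)\<^sup>2 * (\<integral>\<^sup>+v. ennreal ((H v)\<^sup>2) \<partial>lborel)"
    by (simp only: power2_eq_square mult_ac)
  finally show ?thesis .
qed

section \<open>Weights\<close>

lemma jb_ge_1: "1 \<le> jb v"
  by (simp add: jb_def)

lemma jb_pos: "0 < jb v"
  using jb_ge_1[of v] by linarith

lemma jb_sq: "(jb v)\<^sup>2 = 1 + (norm v)\<^sup>2"
  by (simp add: jb_def)

lemma borel_measurable_jb [measurable]: "jb \<in> borel_measurable borel"
  unfolding jb_def by measurable

text \<open>The gap (1 + |v|^2)(1 + |w|^2) - (|v| + |w|)^2 is the square (|v||w| - 1)^2.\<close>

lemma norm_diff_le_jb: "norm (v - w) \<le> jb v * jb w"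
proof -
  have "norm (v - w) \<le> norm v + norm w"
    by (rule norm_triangle_ineq4)
  also have "\<dots> \<le> jb v * jb w"
  proof (rule power2_le_imp_le)
    have "0 \<le> (norm v * norm w - 1)\<^sup>2"
      by simp
    then show "(norm v + norm w)\<^sup>2 \<le> (jb v * jb w)\<^sup>2"
      unfolding power_mult_distrib jb_sq by (simp add: power2_eq_square algebra_simps)
    show "0 \<le> jb v * jb w"
      using jb_pos[of v] jb_pos[of w] by simp
  qed
  finally show ?thesis .
qed

lemma norm_vprime_diff: "norm (vprime v w \<sigma> - v) = sinhalf v w \<sigma> * norm (v - w)"
  by (cases "v = w") (auto simp: sinhalf_def)

text \<open>The coefficient of \<open>jb w\<close> has to be exactly s: an additional constant
  factor above 1 would grow exponentially under the k-th power and spoil C_1. The 2 before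
  \<open>jb v\<close> affects only \<open>weight_const k\<close>. The constant 1 in
  \<open>jb\<close> costs nothing, since squaring the right-hand side produces the constants s^2 +
  4.\<close>

lemma jb_vprime_le:
  assumes "norm \<sigma> = 1"
  shows "jb (vprime v w \<sigma>) \<le> sinhalf v w \<sigma> * jb w + 2 * jb v"
proof (rule power2_le_imp_le)
  let ?s = "sinhalf v w \<sigma>"
  note s = sinhalf_nonneg[of v w \<sigma>] sinhalf_le_1[OF assms, of v w]
  have n: "norm v \<le> jb v" "norm w \<le> jb w"
    unfolding jb_def by (auto intro!: real_le_rsqrt)
  have "norm (vprime v w \<sigma>) \<le> norm (vprime v w \<sigma> - v) + norm v"
    using norm_triangle_ineq[of "vprime v w \<sigma> - v" v] by simp
  also have "\<dots> \<le> ?s * (norm v + norm w) + norm v"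
    unfolding norm_vprime_diff using s by (intro add_right_mono mult_left_mono norm_triangle_ineq4)
  also have "\<dots> \<le> ?s * norm w + 2 * norm v"
    using mult_right_mono[OF s(2), of "norm v"] by (simp add: algebra_simps)
  finally have "(norm (vprime v w \<sigma>))\<^sup>2 \<le> (?s * norm w + 2 * norm v)\<^sup>2"
    by (intro power_mono) auto
  also have "\<dots> = ?s\<^sup>2 * (norm w)\<^sup>2 + 4 * (norm v)\<^sup>2 + 4 * ?s * (norm w * norm v)"
    by algebra
  also have "\<dots> \<le> ?s\<^sup>2 * (norm w)\<^sup>2 + 4 * (norm v)\<^sup>2 + 4 * ?s * (jb w * jb v)"
    using s n jb_pos[of w] by (intro add_left_mono mult_left_mono mult_mono) auto
  finally have *: "(norm (vprime v w \<sigma>))\<^sup>2 \<le> ?s\<^sup>2 * (norm w)\<^sup>2 + 4 * (norm v)\<^sup>2 + 4 * ?s * (jb w * jb v)" .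
  have "(?s * jb w + 2 * jb v)\<^sup>2 = ?s\<^sup>2 * (jb w)\<^sup>2 + 4 * (jb v)\<^sup>2 + 4 * ?s * (jb w * jb v)"
    by algebra
  also have "\<dots> = ?s\<^sup>2 + ?s\<^sup>2 * (norm w)\<^sup>2 + 4 + 4 * (norm v)\<^sup>2 + 4 * ?s * (jb w * jb v)"
    unfolding jb_sq by (simp add: algebra_simps)
  finally show "(jb (vprime v w \<sigma>))\<^sup>2 \<le> (?s * jb w + 2 * jb v)\<^sup>2"
    unfolding jb_sq[of "vprime v w \<sigma>"] using * zero_le_power2[of ?s] by linarith
  show "0 \<le> ?s * jb w + 2 * jb v"
    using s jb_pos[of v] jb_pos[of w] by simp
qed

text \<open>With \<delta> = 2^(1/k) - 1, chosen so that (1 + \<delta>)^k = 2, this is (2/\<delta> +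
  2)^k: the cost of the case in which s a is at most (2/\<delta>) b.\<close>

definition weight_const :: "real \<Rightarrow> real" where
  "weight_const k = (2 / (2 powr (1 / k) - 1) + 2) powr k"

lemma weight_const_nonneg: "0 \<le> weight_const k"
  by (simp add: weight_const_def)

text \<open>Either \<open>b\<close> is so small that \<open>(s a + 2 b)\<^sup>k \<le> 2 (s a)\<^sup>k\<close>, or \<open>s a\<close> is at most a multiple of \<open>b\<close>.\<close>
lemma powr_weight_split:
  assumes "1 \<le> k" "0 \<le> s" "0 < b" "b \<le> a"
  shows "(s * a + 2 * b) powr k \<le> 2 * (s powr k * a powr k) + weight_const k * (b * a powr (k - 1))"
proof -
  define \<delta> where "\<delta> = 2 powr (1 / k) - 1"
  have \<delta>: "0 < \<delta>"
    using assms by (simp add: \<delta>_def)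
  have nn: "0 \<le> s powr k * a powr k" "0 \<le> weight_const k * (b * a powr (k - 1))"
    using assms by (auto simp: weight_const_def)
  show ?thesis
  proof (cases "2 * b \<le> \<delta> * (s * a)")
    case True
    then have "(s * a + 2 * b) powr k \<le> ((1 + \<delta>) * (s * a)) powr k"
      using assms by (intro powr_mono2) (auto simp: algebra_simps)
    also have "\<dots> = (1 + \<delta>) powr k * (s powr k * a powr k)"
      using assms \<delta> by (simp add: powr_mult)
    also have "(1 + \<delta>) powr k = 2"
      using assms by (simp add: \<delta>_def powr_powr)
    finally show ?thesis
      using nn by linarith
  next
    case False
    then have "s * a \<le> 2 / \<delta> * b"
      using \<delta> by (simp add: field_simps)
    then have "(s * a + 2 * b) powr k \<le> ((2 / \<delta> + 2) * b) powr k"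
      using assms by (intro powr_mono2) (auto simp: algebra_simps)
    also have "\<dots> = weight_const k * b powr k"
      using assms \<delta> by (simp add: powr_mult weight_const_def \<delta>_def)
    also have "b powr k = b * b powr (k - 1)"
      using assms by (simp add: powr_mult_base)
    also have "weight_const k * (b * b powr (k - 1)) \<le> weight_const k * (b * a powr (k - 1))"
      using assms by (intro mult_left_mono powr_mono2 weight_const_nonneg) auto
    finally show ?thesis
      using nn by linarith
  qed
qed

text \<open>In the main term l powers of |v - w| are paired with s^l and become |v' - v|^l <=
  (<v><v'>)^l, which puts weight l on v'; the other \<gamma> - l powers are bounded by
  (<v><w>)^(\<gamma>-l). What remains of s^k is s^(k-l) <= s^(k-1), since s <= 1 and l <= 1. In the
  lower-order term \<gamma> <= 1 gives |v - w|^\<gamma> <= <v><w>, which uses up the power of <w>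
  saved by \<open>powr_weight_split\<close>, so no weight above k arises and the constant is
  independent of \<gamma>.\<close>

lemma collision_weight_le:
  assumes \<sigma>: "norm \<sigma> = 1" and vw: "jb v \<le> jb w"
    and k: "1 \<le> k" and l: "0 \<le> l" "l \<le> \<gamma>" "\<gamma> \<le> 1"
  shows "norm (v - w) powr \<gamma> * jb (vprime v w \<sigma>) powr k
    \<le> 2 * (sinhalf v w \<sigma> powr (k - 1) * jb w powr (k + \<gamma> - l) * jb v powr \<gamma> * jb (vprime v w \<sigma>) powr l)
      + weight_const k * (jb w powr k * (jb v)\<^sup>2)"
proof -
  let ?s = "sinhalf v w \<sigma>" and ?z = "norm (v - w)" and ?a = "jb w" and ?b = "jb v" and ?c = "jb (vprime v w \<sigma>)"
  note s = sinhalf_nonneg[of v w \<sigma>] sinhalf_le_1[OF \<sigma>, of v w]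
  have pos: "0 < ?a" "0 < ?b" "0 < ?c"
    by (rule jb_pos)+
  have z: "?z \<le> ?a * ?b" "?s * ?z \<le> ?b * ?c"
    using norm_diff_le_jb[of w v] norm_diff_le_jb[of v "vprime v w \<sigma>"]
    unfolding norm_minus_commute[of w v] norm_minus_commute[of v "vprime v w \<sigma>"] norm_vprime_diff .
  have "?c powr k \<le> (?s * ?a + 2 * ?b) powr k"
    using pos k jb_vprime_le[OF \<sigma>] by (intro powr_mono2) auto
  also have "\<dots> \<le> 2 * (?s powr k * ?a powr k) + weight_const k * (?b * ?a powr (k - 1))"
    by (rule powr_weight_split[OF k s(1) pos(2) vw])
  finally have "?z powr \<gamma> * ?c powr k
      \<le> ?z powr \<gamma> * (2 * (?s powr k * ?a powr k) + weight_const k * (?b * ?a powr (k - 1)))"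
    by (intro mult_left_mono) auto
  also have "\<dots> = 2 * (?z powr \<gamma> * (?s powr k * ?a powr k)) + weight_const k * (?z powr \<gamma> * (?b * ?a powr (k - 1)))"
    by (simp add: algebra_simps)
  also have "\<dots> \<le> 2 * (?s powr (k - 1) * ?a powr (k + \<gamma> - l) * ?b powr \<gamma> * ?c powr l)
      + weight_const k * (?a powr k * ?b\<^sup>2)"
  proof (intro add_mono mult_left_mono weight_const_nonneg)
    have "?z powr \<gamma> * (?s powr k * ?a powr k)
        = ?z powr (\<gamma> - l) * ((?s * ?z) powr l * (?s powr (k - l) * ?a powr k))"
      using s(1) powr_add[of ?z "\<gamma> - l" l] powr_add[of ?s "k - l" l] by (simp add: powr_mult mult_ac)
    also have "\<dots> \<le> (?a * ?b) powr (\<gamma> - l) * ((?b * ?c) powr l * (?s powr (k - 1) * ?a powr k))"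
    proof -
      have "?z powr (\<gamma> - l) \<le> (?a * ?b) powr (\<gamma> - l)"
        using l z by (intro powr_mono2) auto
      moreover have "(?s * ?z) powr l \<le> (?b * ?c) powr l"
        using s l z by (intro powr_mono2) auto
      moreover have "?s powr (k - l) \<le> ?s powr (k - 1)"
        using s l by (intro powr_mono') auto
      ultimately show ?thesis
        using pos by (intro mult_mono) auto
    qed
    also have "\<dots> = ?s powr (k - 1) * (?a powr (\<gamma> - l) * ?a powr k) * (?b powr (\<gamma> - l) * ?b powr l) * ?c powr l"
      using pos by (simp add: powr_mult)
    also have "\<dots> = ?s powr (k - 1) * ?a powr (k + \<gamma> - l) * ?b powr \<gamma> * ?c powr l"
      by (simp add: algebra_simps flip: powr_add)
    finally show "?z powr \<gamma> * (?s powr k * ?a powr k) \<le> \<dots>" .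
    have "?z powr \<gamma> \<le> (?a * ?b) powr \<gamma>"
      using z l pos by (intro powr_mono2) auto
    also have "\<dots> \<le> (?a * ?b) powr 1"
      using l mult_mono[OF jb_ge_1[of w] jb_ge_1[of v]] pos by (intro powr_mono) auto
    finally have "?z powr \<gamma> \<le> ?a * ?b"
      using pos by simp
    then have "?z powr \<gamma> * (?b * ?a powr (k - 1)) \<le> (?a * ?b) * (?b * ?a powr (k - 1))"
      using pos by (intro mult_right_mono) auto
    also have "\<dots> = ?a powr k * ?b\<^sup>2"
      using pos powr_mult_base[of ?a "k - 1"] by (simp add: power2_eq_square mult_ac)
    finally show "?z powr \<gamma> * (?b * ?a powr (k - 1)) \<le> ?a powr k * ?b\<^sup>2" .
  qed auto
  finally show ?thesis .
qed

text \<open>The exponent is 2(2 - k) at k = 8, as called for by \<open>nn_integral_jb_sq_le\<close>.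
  The radial density r^2/(1 + r^2)^6 is at most 1/(1 + r^2), with integral pi/2; the area bound 24
  does the rest.\<close>

lemma nn_integral_jb_powr_finite: "(\<integral>\<^sup>+v. ennreal (jb v powr - 12) \<partial>lborel) \<le> ennreal (12 * pi)"
proof -
  have "(\<integral>\<^sup>+v. ennreal (jb v powr - 12) \<partial>lborel)
      = (\<integral>\<^sup>+\<sigma>. \<integral>\<^sup>+r. ennreal (indicator {0<..} r * r\<^sup>2) * ennreal (jb (r *\<^sub>R \<sigma>) powr - 12) \<partial>lborel \<partial>sphere_measure)"
    by (rule nn_integral_polar) measurable
  also have "\<dots> \<le> (\<integral>\<^sup>+\<sigma>. ennreal (pi / 2) \<partial>sphere_measure)"
  proof (rule nn_integral_mono_AE, use AE_norm_sphere_measure in eventually_elim)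
    case (elim \<sigma>)
    have "(\<integral>\<^sup>+r. ennreal (indicator {0<..} r * r\<^sup>2) * ennreal (jb (r *\<^sub>R \<sigma>) powr - 12) \<partial>lborel)
        \<le> (\<integral>\<^sup>+r. ennreal (1 / (1 + r\<^sup>2)) * indicator {0..} r \<partial>lborel)"
    proof (rule nn_integral_mono)
      fix r :: real
      have jb: "jb (r *\<^sub>R \<sigma>) powr - 12 = 1 / (1 + r\<^sup>2) ^ 6"
      proof -
        have "jb (r *\<^sub>R \<sigma>) ^ 12 = ((jb (r *\<^sub>R \<sigma>))\<^sup>2) ^ 6"
          by (simp flip: power_mult)
        also have "\<dots> = (1 + r\<^sup>2) ^ 6"
          unfolding jb_sq using elim by simp
        finally show ?thesis
          using jb_pos[of "r *\<^sub>R \<sigma>"] by (simp add: powr_minus_divide)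
      qed
      have "r\<^sup>2 * (1 / (1 + r\<^sup>2) ^ 6) \<le> (1 + r\<^sup>2) ^ 5 * (1 / (1 + r\<^sup>2) ^ 6)"
      proof (rule mult_right_mono)
        have "r\<^sup>2 \<le> (1 + r\<^sup>2) ^ 1" by simp
        also have "\<dots> \<le> (1 + r\<^sup>2) ^ 5"
          by (rule power_increasing) auto
        finally show "r\<^sup>2 \<le> (1 + r\<^sup>2) ^ 5" .
      qed simp
      also have "\<dots> = 1 / (1 + r\<^sup>2)"
      proof -
        have "1 + r\<^sup>2 > 0"
          by (simp add: add_pos_nonneg)
        then show ?thesis
          by (simp add: eval_nat_numeral)
      qed
      finally have "r\<^sup>2 * (1 / (1 + r\<^sup>2) ^ 6) \<le> 1 / (1 + r\<^sup>2)" .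
      then show "ennreal (indicator {0<..} r * r\<^sup>2) * ennreal (jb (r *\<^sub>R \<sigma>) powr - 12)
          \<le> ennreal (1 / (1 + r\<^sup>2)) * indicator {0..} r"
        unfolding jb by (auto simp: indicator_def ennreal_mult[symmetric] intro!: ennreal_leI)
    qed
    also have "\<dots> = ennreal (pi / 2 - arctan 0)"
    proof (rule nn_integral_FTC_atLeast)
      show "(arctan has_real_derivative 1 / (1 + x\<^sup>2)) (at x)" for x
        using DERIV_arctan[of x] by (simp add: inverse_eq_divide)
    qed (auto intro: tendsto_arctan_at_top)
    finally show ?case by simp
  qed
  also have "\<dots> = ennreal (pi / 2) * emeasure sphere_measure UNIV"
    by simp
  also have "\<dots> \<le> ennreal (pi / 2) * ennreal 24"
    using emeasure_sphere_measure_UNIV by (intro mult_left_mono) auto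
  also have "\<dots> = ennreal (12 * pi)"
    by (subst ennreal_mult[symmetric]) auto
  finally show ?thesis .
qed

section \<open>Weighted norms as nonnegative integrals\<close>

lemma in_wL_borel: "in_wL p l f \<Longrightarrow> f \<in> borel_measurable borel"
  by (simp add: in_wL_def)

lemma abs_powr_2: "\<bar>x\<bar> powr 2 = (x::real)\<^sup>2"
  by (cases "x = 0") auto

lemma wint_2_eq: "wint 2 l f = (\<integral>\<^sup>+v. ennreal ((\<bar>f v\<bar> * jb v powr l)\<^sup>2) \<partial>lborel)"
  unfolding wint_def abs_powr_2
  by (intro nn_integral_cong) (simp add: power_mult_distrib power2_eq_square[of "_ powr _"] mult.commute[of l 2] flip: powr_add)

lemma wnorm_nonneg: "0 \<le> wnorm p l f"
  by (simp add: wnorm_def)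

lemma wint_2_wnorm:
  assumes "in_wL 2 l f"
  shows "wint 2 l f = ennreal ((wnorm 2 l f)\<^sup>2)"
proof -
  have "(wnorm 2 l f)\<^sup>2 = enn2real (wint 2 l f)"
    by (simp add: wnorm_def powr_half_sqrt)
  then show ?thesis
    using assms by (simp add: in_wL_def)
qed

lemma wint_1_wnorm:
  assumes "in_wL 1 l f"
  shows "(\<integral>\<^sup>+v. ennreal (\<bar>f v\<bar> * jb v powr l) \<partial>lborel) = ennreal (wnorm 1 l f)"
proof -
  have "wint 1 l f = (\<integral>\<^sup>+v. ennreal (\<bar>f v\<bar> * jb v powr l) \<partial>lborel)"
    unfolding wint_def by (intro nn_integral_cong) simp
  moreover have "wint 1 l f = ennreal (wnorm 1 l f)"
    using assms by (simp add: in_wL_def wnorm_def)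
  ultimately show ?thesis by simp
qed

lemma in_wL_2_mono:
  assumes "in_wL 2 m f" "l \<le> m"
  shows "in_wL 2 l f"
proof -
  have "wint 2 l f \<le> wint 2 m f"
    unfolding wint_def using assms(2) jb_ge_1
    by (intro nn_integral_mono ennreal_leI mult_left_mono powr_mono) auto
  then show ?thesis
    using assms(1) by (auto simp: in_wL_def)
qed

lemma le_ennreal_of_square:
  assumes "x\<^sup>2 \<le> ennreal (y\<^sup>2)" "0 \<le> y"
  shows "x \<le> ennreal y"
proof (cases x)
  case (real r)
  then have "r\<^sup>2 \<le> y\<^sup>2"
    using assms by (simp add: ennreal_power)
  then have "r \<le> y"
    using assms(2) by (rule power2_le_imp_le)
  then show ?thesis
    using real by (simp add: ennreal_leI)
next
  case top
  then show ?thesis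
    using assms by (simp add: power2_eq_square ennreal_mult_top top_unique)
qed

text \<open>Cauchy-Schwarz against <v>^(2-k), whose square is integrable for k >= 8. This absorbs
  the L^1 factor of the lower-order term, two powers of <v> included, into the norm of
  L^2_k.\<close>

lemma nn_integral_jb_sq_le:
  assumes g: "in_wL 2 k g" and k: "8 \<le> k"
  shows "(\<integral>\<^sup>+v. ennreal (\<bar>g v\<bar> * (jb v)\<^sup>2) \<partial>lborel) \<le> ennreal (sqrt (12 * pi) * wnorm 2 k g)"
proof (rule le_ennreal_of_square)
  note in_wL_borel[OF g, measurable]
  have "(\<integral>\<^sup>+v. ennreal (\<bar>g v\<bar> * (jb v)\<^sup>2) \<partial>lborel)
      = (\<integral>\<^sup>+v. ennreal (\<bar>g v\<bar> * jb v powr k) * ennreal (jb v powr (2 - k)) \<partial>lborel)"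
  proof (rule nn_integral_cong)
    fix v
    have "jb v powr k * jb v powr (2 - k) = (jb v)\<^sup>2"
      using jb_pos[of v] by (simp flip: powr_add)
    then show "ennreal (\<bar>g v\<bar> * (jb v)\<^sup>2) = ennreal (\<bar>g v\<bar> * jb v powr k) * ennreal (jb v powr (2 - k))"
      by (subst ennreal_mult[symmetric]) (auto simp: mult.assoc)
  qed
  also have "\<dots>\<^sup>2 \<le> (\<integral>\<^sup>+v. (ennreal (\<bar>g v\<bar> * jb v powr k))\<^sup>2 \<partial>lborel) * (\<integral>\<^sup>+v. (ennreal (jb v powr (2 - k)))\<^sup>2 \<partial>lborel)"
    by (rule Cauchy_Schwarz_nn_integral) measurable
  also have "\<dots> \<le> ennreal ((wnorm 2 k g)\<^sup>2) * ennreal (12 * pi)"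
  proof (rule mult_mono)
    show "(\<integral>\<^sup>+v. (ennreal (\<bar>g v\<bar> * jb v powr k))\<^sup>2 \<partial>lborel) \<le> ennreal ((wnorm 2 k g)\<^sup>2)"
      unfolding wint_2_wnorm[OF g, symmetric] wint_2_eq by (simp add: ennreal_power)
    have "(\<integral>\<^sup>+v. (ennreal (jb v powr (2 - k)))\<^sup>2 \<partial>lborel) \<le> (\<integral>\<^sup>+v. ennreal (jb v powr - 12) \<partial>lborel)"
    proof (rule nn_integral_mono)
      fix v
      have "(jb v powr (2 - k))\<^sup>2 = jb v powr (2 * (2 - k))"
        by (simp add: power2_eq_square flip: powr_add)
      also have "\<dots> \<le> jb v powr - 12"
        using k jb_ge_1 by (intro powr_mono) auto
      finally show "(ennreal (jb v powr (2 - k)))\<^sup>2 \<le> ennreal (jb v powr - 12)"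
        by (simp add: ennreal_power ennreal_leI)
    qed
    also note nn_integral_jb_powr_finite
    finally show "(\<integral>\<^sup>+v. (ennreal (jb v powr (2 - k)))\<^sup>2 \<partial>lborel) \<le> ennreal (12 * pi)" .
  qed auto
  also have "\<dots> = ennreal ((sqrt (12 * pi) * wnorm 2 k g)\<^sup>2)"
    by (subst ennreal_mult[symmetric]) (auto simp: power_mult_distrib mult.commute)
  finally show "(\<integral>\<^sup>+v. ennreal (\<bar>g v\<bar> * (jb v)\<^sup>2) \<partial>lborel)\<^sup>2 \<le> ennreal ((sqrt (12 * pi) * wnorm 2 k g)\<^sup>2)" .
qed (simp add: wnorm_nonneg)

section \<open>The gain and loss terms\<close>

lemma sinhalf_powr_sq: "(sinhalf v w \<sigma> powr a)\<^sup>2 * sinhalf v w \<sigma> powr - (4/3) = ((sinhalf v w \<sigma>)\<^sup>2) powr (a - 2/3)"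
proof (cases "sinhalf v w \<sigma> = 0")
  case False
  then have s: "0 < sinhalf v w \<sigma>"
    using sinhalf_nonneg[of v w \<sigma>] by linarith
  have "(sinhalf v w \<sigma>)\<^sup>2 powr (a - 2/3) = sinhalf v w \<sigma> powr (2 * (a - 2/3))"
    using s by (simp add: powr_powr flip: powr_numeral)
  also have "2 * (a - 2/3) = a + a + - (4/3)"
    by simp
  also have "sinhalf v w \<sigma> powr \<dots> = (sinhalf v w \<sigma> powr a)\<^sup>2 * sinhalf v w \<sigma> powr - (4/3)"
    by (simp only: powr_add power2_eq_square)
  finally show ?thesis ..
qed simp

lemma ennreal_mult5_square:
  assumes "0 \<le> a" "0 \<le> b" "0 \<le> c" "0 \<le> d" "0 \<le> e"
  shows "ennreal a * ennreal b * ennreal (c\<^sup>2) * (ennreal d)\<^sup>2 * ennreal (e\<^sup>2) = ennreal ((sqrt (a * b) * d * c * e)\<^sup>2)"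
proof -
  have "(sqrt (a * b) * d * c * e)\<^sup>2 = a * b * c\<^sup>2 * d\<^sup>2 * e\<^sup>2"
    using assms by (simp add: power_mult_distrib mult_ac)
  then show ?thesis
    using assms by (simp add: ennreal_power ennreal_mult)
qed

text \<open>The case \<beta>(s) = s^(k-1) of \<open>nn_integral_trilinear_sinhalf\<close>. The
  angular integral is that of (s^2)^(k-1-2/3), at most 384/(k - 5/3) <= 768/k, and the final square
  root leaves 1/sqrt k.\<close>

lemma trilinear_main_le:
  assumes k: "8 \<le> k" and g: "in_wL 1 \<gamma> g" and f: "in_wL 2 m f" and H: "in_wL 2 l H"
  shows "(\<integral>\<^sup>+v. \<integral>\<^sup>+w. \<integral>\<^sup>+\<sigma>. ennreal ((\<bar>f w\<bar> * jb w powr m) * (\<bar>g v\<bar> * jb v powr \<gamma>)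
      * (\<bar>H (vprime v w \<sigma>)\<bar> * jb (vprime v w \<sigma>) powr l) * sinhalf v w \<sigma> powr (k - 1)) \<partial>sphere_measure \<partial>lborel \<partial>lborel)
    \<le> ennreal (sqrt (768 * angular_const) / sqrt k * wnorm 1 \<gamma> g * wnorm 2 m f * wnorm 2 l H)"
proof (rule le_ennreal_of_square)
  note [measurable] = in_wL_borel[OF f] in_wL_borel[OF g] in_wL_borel[OF H]
  have "(\<integral>\<^sup>+v. \<integral>\<^sup>+w. \<integral>\<^sup>+\<sigma>. ennreal ((\<bar>f w\<bar> * jb w powr m) * (\<bar>g v\<bar> * jb v powr \<gamma>)
      * (\<bar>H (vprime v w \<sigma>)\<bar> * jb (vprime v w \<sigma>) powr l) * sinhalf v w \<sigma> powr (k - 1)) \<partial>sphere_measure \<partial>lborel \<partial>lborel)\<^sup>2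
    \<le> ennreal (768 / k) * ennreal angular_const * (\<integral>\<^sup>+v. ennreal ((\<bar>f v\<bar> * jb v powr m)\<^sup>2) \<partial>lborel)
      * (\<integral>\<^sup>+v. ennreal (\<bar>g v\<bar> * jb v powr \<gamma>) \<partial>lborel)\<^sup>2 * (\<integral>\<^sup>+v. ennreal ((\<bar>H v\<bar> * jb v powr l)\<^sup>2) \<partial>lborel)"
  proof (rule nn_integral_trilinear_sinhalf[where \<beta> = "\<lambda>s. s powr (k - 1)"])
    fix v w :: "real^3" assume "v \<noteq> w"
    have "(\<integral>\<^sup>+\<sigma>. ennreal ((sinhalf v w \<sigma> powr (k - 1))\<^sup>2 * sinhalf v w \<sigma> powr - (4/3)) \<partial>sphere_measure)
      \<le> ennreal (384 / (k - 1 - 2/3))"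
      unfolding sinhalf_powr_sq using k by (intro nn_integral_sinhalf_powr_large \<open>v \<noteq> w\<close>) auto
    also have "\<dots> \<le> ennreal (768 / k)"
      using k by (intro ennreal_leI) (simp add: field_simps)
    finally show "(\<integral>\<^sup>+\<sigma>. ennreal ((sinhalf v w \<sigma> powr (k - 1))\<^sup>2 * sinhalf v w \<sigma> powr - (4/3)) \<partial>sphere_measure)
      \<le> ennreal (768 / k)" .
  qed auto
  also have "\<dots> = ennreal ((sqrt (768 / k * angular_const) * wnorm 1 \<gamma> g * wnorm 2 m f * wnorm 2 l H)\<^sup>2)"
    unfolding wint_1_wnorm[OF g] wint_2_eq[symmetric] wint_2_wnorm[OF f] wint_2_wnorm[OF H]
    using k by (intro ennreal_mult5_square wnorm_nonneg angular_const_nonneg) auto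
  also have "sqrt (768 / k * angular_const) = sqrt (768 * angular_const) / sqrt k"
    by (simp add: real_sqrt_mult real_sqrt_divide)
  finally show "(\<integral>\<^sup>+v. \<integral>\<^sup>+w. \<integral>\<^sup>+\<sigma>. ennreal ((\<bar>f w\<bar> * jb w powr m) * (\<bar>g v\<bar> * jb v powr \<gamma>)
      * (\<bar>H (vprime v w \<sigma>)\<bar> * jb (vprime v w \<sigma>) powr l) * sinhalf v w \<sigma> powr (k - 1)) \<partial>sphere_measure \<partial>lborel \<partial>lborel)\<^sup>2
    \<le> ennreal ((sqrt (768 * angular_const) / sqrt k * wnorm 1 \<gamma> g * wnorm 2 m f * wnorm 2 l H)\<^sup>2)" .
qed (use k angular_const_nonneg wnorm_nonneg in auto)

text \<open>The case \<beta> = 1: the angular integral is that of (s^2)^(-2/3), with no decay in k.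
  None is wanted here, because this term ends up in C_k.\<close>

lemma trilinear_lower_order_le:
  assumes k: "8 \<le> k" and g: "in_wL 2 k g" and f: "in_wL 2 k f" and H: "in_wL 2 0 H"
  shows "(\<integral>\<^sup>+v. \<integral>\<^sup>+w. \<integral>\<^sup>+\<sigma>. ennreal ((\<bar>f w\<bar> * jb w powr k) * (\<bar>g v\<bar> * (jb v)\<^sup>2)
      * \<bar>H (vprime v w \<sigma>)\<bar>) \<partial>sphere_measure \<partial>lborel \<partial>lborel)
    \<le> ennreal (angular_const * (sqrt (12 * pi) * wnorm 2 k g) * wnorm 2 k f * wnorm 2 0 H)"
proof (rule le_ennreal_of_square)
  note [measurable] = in_wL_borel[OF f] in_wL_borel[OF g] in_wL_borel[OF H]
  have "(\<integral>\<^sup>+v. \<integral>\<^sup>+w. \<integral>\<^sup>+\<sigma>. ennreal ((\<bar>f w\<bar> * jb w powr k) * (\<bar>g v\<bar> * (jb v)\<^sup>2)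
      * \<bar>H (vprime v w \<sigma>)\<bar> * (\<lambda>_. 1) (sinhalf v w \<sigma>)) \<partial>sphere_measure \<partial>lborel \<partial>lborel)\<^sup>2
    \<le> ennreal angular_const * ennreal angular_const * (\<integral>\<^sup>+v. ennreal ((\<bar>f v\<bar> * jb v powr k)\<^sup>2) \<partial>lborel)
      * (\<integral>\<^sup>+v. ennreal (\<bar>g v\<bar> * (jb v)\<^sup>2) \<partial>lborel)\<^sup>2 * (\<integral>\<^sup>+v. ennreal (\<bar>H v\<bar>\<^sup>2) \<partial>lborel)"
  proof (rule nn_integral_trilinear_sinhalf)
    fix v w :: "real^3" assume "v \<noteq> w"
    have "1\<^sup>2 * sinhalf v w \<sigma> powr - (4/3) = ((sinhalf v w \<sigma>)\<^sup>2) powr - (2/3)" for \<sigma>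
      using sinhalf_powr_sq[of v w \<sigma> 0] by (cases "sinhalf v w \<sigma> = 0") auto
    then show "(\<integral>\<^sup>+\<sigma>. ennreal (1\<^sup>2 * sinhalf v w \<sigma> powr - (4/3)) \<partial>sphere_measure) \<le> ennreal angular_const"
      using nn_integral_sinhalf_powr_neg[OF \<open>v \<noteq> w\<close>] by (simp only:)
  qed auto
  also have "\<dots> \<le> ennreal angular_const * ennreal angular_const * (\<integral>\<^sup>+v. ennreal ((\<bar>f v\<bar> * jb v powr k)\<^sup>2) \<partial>lborel)
      * (ennreal (sqrt (12 * pi) * wnorm 2 k g))\<^sup>2 * (\<integral>\<^sup>+v. ennreal (\<bar>H v\<bar>\<^sup>2) \<partial>lborel)"
    by (intro mult_right_mono mult_left_mono power_mono_ennreal nn_integral_jb_sq_le[OF g k]) auto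
  also have "(\<integral>\<^sup>+v. ennreal (\<bar>H v\<bar>\<^sup>2) \<partial>lborel) = wint 2 0 H"
    unfolding wint_2_eq by (intro nn_integral_cong) (simp add: less_imp_neq[OF jb_pos, symmetric])
  also have "ennreal angular_const * ennreal angular_const * (\<integral>\<^sup>+v. ennreal ((\<bar>f v\<bar> * jb v powr k)\<^sup>2) \<partial>lborel)
      * (ennreal (sqrt (12 * pi) * wnorm 2 k g))\<^sup>2 * wint 2 0 H
    = ennreal ((sqrt (angular_const * angular_const) * (sqrt (12 * pi) * wnorm 2 k g) * wnorm 2 k f * wnorm 2 0 H)\<^sup>2)"
    unfolding wint_2_eq[of k, symmetric] wint_2_wnorm[OF f] wint_2_wnorm[OF H]
    by (intro ennreal_mult5_square wnorm_nonneg angular_const_nonneg mult_nonneg_nonneg) auto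
  also have "sqrt (angular_const * angular_const) = angular_const"
    using angular_const_nonneg by simp
  finally show "(\<integral>\<^sup>+v. \<integral>\<^sup>+w. \<integral>\<^sup>+\<sigma>. ennreal ((\<bar>f w\<bar> * jb w powr k) * (\<bar>g v\<bar> * (jb v)\<^sup>2)
      * \<bar>H (vprime v w \<sigma>)\<bar>) \<partial>sphere_measure \<partial>lborel \<partial>lborel)\<^sup>2
    \<le> ennreal ((angular_const * (sqrt (12 * pi) * wnorm 2 k g) * wnorm 2 k f * wnorm 2 0 H)\<^sup>2)"
    by simp
qed (use angular_const_nonneg wnorm_nonneg in auto)

text \<open>Where <v> <= <w> the function \<open>f\<close>, evaluated at w, carries the large
  weight. In the main term only <v>^\<gamma> falls on \<open>g\<close>, which accounts for its L^1
  norm with weight \<gamma>.\<close>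

lemma half_gain_le:
  assumes k: "8 \<le> k" and l: "0 \<le> l" "l \<le> \<gamma>" "\<gamma> \<le> 1"
    and f: "in_wL 2 (k + \<gamma> - l) f" and g: "in_wL 1 \<gamma> g" "in_wL 2 k g" and H: "in_wL 2 l H"
  shows "(\<integral>\<^sup>+v. \<integral>\<^sup>+w. \<integral>\<^sup>+\<sigma>. ennreal (if jb v \<le> jb w then norm (v - w) powr \<gamma> * \<bar>f w\<bar> * \<bar>g v\<bar>
      * (\<bar>H (vprime v w \<sigma>)\<bar> * jb (vprime v w \<sigma>) powr k) else 0) \<partial>sphere_measure \<partial>lborel \<partial>lborel)
    \<le> ennreal (2 * sqrt (768 * angular_const) / sqrt k * wnorm 1 \<gamma> g * wnorm 2 (k + \<gamma> - l) f * wnorm 2 l H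
        + weight_const k * angular_const * sqrt (12 * pi) * wnorm 2 k f * wnorm 2 k g * wnorm 2 0 H)"
proof -
  note [measurable] = in_wL_borel[OF f] in_wL_borel[OF g(1)] in_wL_borel[OF H]
  have f': "in_wL 2 k f" and H': "in_wL 2 0 H"
    using in_wL_2_mono[OF f, of k] in_wL_2_mono[OF H, of 0] l by auto
  define A where "A v w \<sigma> = (\<bar>f w\<bar> * jb w powr (k + \<gamma> - l)) * (\<bar>g v\<bar> * jb v powr \<gamma>)
      * (\<bar>H (vprime v w \<sigma>)\<bar> * jb (vprime v w \<sigma>) powr l) * sinhalf v w \<sigma> powr (k - 1)" for v w \<sigma>
  define B where "B v w \<sigma> = (\<bar>f w\<bar> * jb w powr k) * (\<bar>g v\<bar> * (jb v)\<^sup>2) * \<bar>H (vprime v w \<sigma>)\<bar>" for v w \<sigma>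
  have AB0: "0 \<le> A v w \<sigma>" "0 \<le> B v w \<sigma>" for v w \<sigma>
    by (simp_all add: A_def B_def)
  have "(\<integral>\<^sup>+v. \<integral>\<^sup>+w. \<integral>\<^sup>+\<sigma>. ennreal (if jb v \<le> jb w then norm (v - w) powr \<gamma> * \<bar>f w\<bar> * \<bar>g v\<bar>
      * (\<bar>H (vprime v w \<sigma>)\<bar> * jb (vprime v w \<sigma>) powr k) else 0) \<partial>sphere_measure \<partial>lborel \<partial>lborel)
    \<le> (\<integral>\<^sup>+v. \<integral>\<^sup>+w. \<integral>\<^sup>+\<sigma>. (ennreal 2 * ennreal (A v w \<sigma>) + ennreal (weight_const k) * ennreal (B v w \<sigma>)) \<partial>sphere_measure \<partial>lborel \<partial>lborel)"
  proof (rule nn_integral_mono, rule nn_integral_mono, rule nn_integral_mono_AE, use AE_norm_sphere_measure in eventually_elim)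
    case (elim v w \<sigma>)
    have "(if jb v \<le> jb w then norm (v - w) powr \<gamma> * \<bar>f w\<bar> * \<bar>g v\<bar>
      * (\<bar>H (vprime v w \<sigma>)\<bar> * jb (vprime v w \<sigma>) powr k) else 0) \<le> 2 * A v w \<sigma> + weight_const k * B v w \<sigma>"
    proof (cases "jb v \<le> jb w")
      case True
      have "norm (v - w) powr \<gamma> * \<bar>f w\<bar> * \<bar>g v\<bar> * (\<bar>H (vprime v w \<sigma>)\<bar> * jb (vprime v w \<sigma>) powr k)
        = \<bar>f w\<bar> * \<bar>g v\<bar> * \<bar>H (vprime v w \<sigma>)\<bar> * (norm (v - w) powr \<gamma> * jb (vprime v w \<sigma>) powr k)"
        by (simp only: mult_ac)
      also have "\<dots> \<le> \<bar>f w\<bar> * \<bar>g v\<bar> * \<bar>H (vprime v w \<sigma>)\<bar> *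
         (2 * (sinhalf v w \<sigma> powr (k - 1) * jb w powr (k + \<gamma> - l) * jb v powr \<gamma> * jb (vprime v w \<sigma>) powr l)
           + weight_const k * (jb w powr k * (jb v)\<^sup>2))"
        using k l by (intro mult_left_mono collision_weight_le[OF elim(3) True]) auto
      also have "\<dots> = 2 * A v w \<sigma> + weight_const k * B v w \<sigma>"
        unfolding A_def B_def by (simp only: distrib_left mult_ac)
      finally show ?thesis
        using True by simp
    qed (use AB0 weight_const_nonneg in auto)
    then have "ennreal (if jb v \<le> jb w then norm (v - w) powr \<gamma> * \<bar>f w\<bar> * \<bar>g v\<bar>
      * (\<bar>H (vprime v w \<sigma>)\<bar> * jb (vprime v w \<sigma>) powr k) else 0) \<le> ennreal (2 * A v w \<sigma> + weight_const k * B v w \<sigma>)"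
      by (rule ennreal_leI)
    also have "\<dots> = ennreal 2 * ennreal (A v w \<sigma>) + ennreal (weight_const k) * ennreal (B v w \<sigma>)"
      using AB0 weight_const_nonneg by (simp add: ennreal_mult)
    finally show ?case .
  qed
  also have "\<dots> = ennreal 2 * (\<integral>\<^sup>+v. \<integral>\<^sup>+w. \<integral>\<^sup>+\<sigma>. ennreal (A v w \<sigma>) \<partial>sphere_measure \<partial>lborel \<partial>lborel)
     + ennreal (weight_const k) * (\<integral>\<^sup>+v. \<integral>\<^sup>+w. \<integral>\<^sup>+\<sigma>. ennreal (B v w \<sigma>) \<partial>sphere_measure \<partial>lborel \<partial>lborel)"
    unfolding A_def B_def by (simp add: nn_integral_add nn_integral_cmult)
  also have "\<dots> \<le> ennreal 2 * ennreal (sqrt (768 * angular_const) / sqrt k * wnorm 1 \<gamma> g * wnorm 2 (k + \<gamma> - l) f * wnorm 2 l H)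
     + ennreal (weight_const k) * ennreal (angular_const * (sqrt (12 * pi) * wnorm 2 k g) * wnorm 2 k f * wnorm 2 0 H)"
    unfolding A_def B_def
    by (intro add_mono mult_left_mono trilinear_main_le[OF k g(1) f H] trilinear_lower_order_le[OF k g(2) f' H']) auto
  also have "\<dots> = ennreal (2 * (sqrt (768 * angular_const) / sqrt k * wnorm 1 \<gamma> g * wnorm 2 (k + \<gamma> - l) f * wnorm 2 l H)
     + weight_const k * (angular_const * (sqrt (12 * pi) * wnorm 2 k g) * wnorm 2 k f * wnorm 2 0 H))"
  proof -
    have "0 \<le> sqrt (768 * angular_const) / sqrt k * wnorm 1 \<gamma> g * wnorm 2 (k + \<gamma> - l) f * wnorm 2 l H"
      "0 \<le> angular_const * (sqrt (12 * pi) * wnorm 2 k g) * wnorm 2 k f * wnorm 2 0 H"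
      using k by (intro mult_nonneg_nonneg divide_nonneg_nonneg wnorm_nonneg angular_const_nonneg real_sqrt_ge_zero; simp add: angular_const_nonneg)+
    then show ?thesis
      using weight_const_nonneg[of k] by (simp only: ennreal_mult[symmetric] ennreal_plus[symmetric] mult_nonneg_nonneg zero_le_numeral)
  qed
  finally show ?thesis
    by (simp add: mult_ac)
qed

lemma vprime_commute: "vprime v w \<sigma> = vprime w v \<sigma>"
  by (simp add: vprime_def add.commute norm_minus_commute)

text \<open>Renaming v and w in the region <w> <= <v> exchanges the roles of \<open>f\<close> and
  \<open>g\<close>, so the second summand is the first with the two functions swapped. The overlap
  <v> = <w> is counted twice, which is harmless in an upper bound.\<close>

lemma gain_le:
  assumes k: "8 \<le> k" and l: "0 \<le> l" "l \<le> \<gamma>" "\<gamma> \<le> 1"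
    and f: "in_wL 1 \<gamma> f" "in_wL 2 (k + \<gamma> - l) f" and g: "in_wL 1 \<gamma> g" "in_wL 2 (k + \<gamma> - l) g" and H: "in_wL 2 l H"
  shows "(\<integral>\<^sup>+v. \<integral>\<^sup>+w. \<integral>\<^sup>+\<sigma>. ennreal (norm (v - w) powr \<gamma> * \<bar>f w\<bar> * \<bar>g v\<bar>
      * (\<bar>H (vprime v w \<sigma>)\<bar> * jb (vprime v w \<sigma>) powr k)) \<partial>sphere_measure \<partial>lborel \<partial>lborel)
    \<le> ennreal (2 * sqrt (768 * angular_const) / sqrt k * wnorm 1 \<gamma> g * wnorm 2 (k + \<gamma> - l) f * wnorm 2 l H
        + weight_const k * angular_const * sqrt (12 * pi) * wnorm 2 k f * wnorm 2 k g * wnorm 2 0 H)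
    + ennreal (2 * sqrt (768 * angular_const) / sqrt k * wnorm 1 \<gamma> f * wnorm 2 (k + \<gamma> - l) g * wnorm 2 l H
        + weight_const k * angular_const * sqrt (12 * pi) * wnorm 2 k g * wnorm 2 k f * wnorm 2 0 H)"
proof -
  note [measurable] = in_wL_borel[OF f(1)] in_wL_borel[OF g(1)] in_wL_borel[OF H]
  have f': "in_wL 2 k f" and g': "in_wL 2 k g"
    using in_wL_2_mono[OF f(2), of k] in_wL_2_mono[OF g(2), of k] l by auto
  define \<phi> where "\<phi> v w \<sigma> = norm (v - w) powr \<gamma> * \<bar>f w\<bar> * \<bar>g v\<bar>
      * (\<bar>H (vprime v w \<sigma>)\<bar> * jb (vprime v w \<sigma>) powr k)" for v w \<sigma>
  have "(\<integral>\<^sup>+v. \<integral>\<^sup>+w. \<integral>\<^sup>+\<sigma>. ennreal (\<phi> v w \<sigma>) \<partial>sphere_measure \<partial>lborel \<partial>lborel)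
    \<le> (\<integral>\<^sup>+v. \<integral>\<^sup>+w. \<integral>\<^sup>+\<sigma>. (ennreal (if jb v \<le> jb w then \<phi> v w \<sigma> else 0)
        + ennreal (if jb w \<le> jb v then \<phi> v w \<sigma> else 0)) \<partial>sphere_measure \<partial>lborel \<partial>lborel)"
    by (intro nn_integral_mono) auto
  also have "\<dots> = (\<integral>\<^sup>+v. \<integral>\<^sup>+w. \<integral>\<^sup>+\<sigma>. ennreal (if jb v \<le> jb w then \<phi> v w \<sigma> else 0) \<partial>sphere_measure \<partial>lborel \<partial>lborel)
      + (\<integral>\<^sup>+v. \<integral>\<^sup>+w. \<integral>\<^sup>+\<sigma>. ennreal (if jb w \<le> jb v then \<phi> v w \<sigma> else 0) \<partial>sphere_measure \<partial>lborel \<partial>lborel)"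
    unfolding \<phi>_def by (simp add: nn_integral_add)
  also have "(\<integral>\<^sup>+v. \<integral>\<^sup>+w. \<integral>\<^sup>+\<sigma>. ennreal (if jb w \<le> jb v then \<phi> v w \<sigma> else 0) \<partial>sphere_measure \<partial>lborel \<partial>lborel)
    = (\<integral>\<^sup>+v. \<integral>\<^sup>+w. \<integral>\<^sup>+\<sigma>. ennreal (if jb v \<le> jb w then \<phi> w v \<sigma> else 0) \<partial>sphere_measure \<partial>lborel \<partial>lborel)"
    unfolding \<phi>_def by (rule lborel_pair.Fubini') measurable
  also have "\<dots> = (\<integral>\<^sup>+v. \<integral>\<^sup>+w. \<integral>\<^sup>+\<sigma>. ennreal (if jb v \<le> jb w then norm (v - w) powr \<gamma> * \<bar>g w\<bar> * \<bar>f v\<bar>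
      * (\<bar>H (vprime v w \<sigma>)\<bar> * jb (vprime v w \<sigma>) powr k) else 0) \<partial>sphere_measure \<partial>lborel \<partial>lborel)"
  proof -
    have "\<phi> w v \<sigma> = norm (v - w) powr \<gamma> * \<bar>g w\<bar> * \<bar>f v\<bar> * (\<bar>H (vprime v w \<sigma>)\<bar> * jb (vprime v w \<sigma>) powr k)" for v w \<sigma>
      unfolding \<phi>_def vprime_commute[of w v] norm_minus_commute[of w v] by (simp only: mult_ac)
    then show ?thesis by (simp only:)
  qed
  also have "(\<integral>\<^sup>+v. \<integral>\<^sup>+w. \<integral>\<^sup>+\<sigma>. ennreal (if jb v \<le> jb w then \<phi> v w \<sigma> else 0) \<partial>sphere_measure \<partial>lborel \<partial>lborel) + \<dots>
    \<le> ennreal (2 * sqrt (768 * angular_const) / sqrt k * wnorm 1 \<gamma> g * wnorm 2 (k + \<gamma> - l) f * wnorm 2 l H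
        + weight_const k * angular_const * sqrt (12 * pi) * wnorm 2 k f * wnorm 2 k g * wnorm 2 0 H)
    + ennreal (2 * sqrt (768 * angular_const) / sqrt k * wnorm 1 \<gamma> f * wnorm 2 (k + \<gamma> - l) g * wnorm 2 l H
        + weight_const k * angular_const * sqrt (12 * pi) * wnorm 2 k g * wnorm 2 k f * wnorm 2 0 H)"
    unfolding \<phi>_def
    by (rule add_mono[OF half_gain_le[OF k l f(2) g(1) g' H] half_gain_le[OF k l g(2) f(1) f' H]])
  finally show ?thesis
    unfolding \<phi>_def .
qed

text \<open>Bounding the kernel by <v>^\<gamma> <w>^\<gamma> decouples w from v. The weight k +
  \<gamma> at v is shared as k + \<gamma> - l on \<open>g\<close> and l on \<open>H\<close>, and the
  sphere contributes its area bound 24.\<close>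

lemma loss_le:
  assumes l: "0 \<le> \<gamma>" and f: "in_wL 1 \<gamma> f" and g: "in_wL 2 (k + \<gamma> - l) g" and H: "in_wL 2 l H"
  shows "(\<integral>\<^sup>+v. \<integral>\<^sup>+w. \<integral>\<^sup>+\<sigma>. ennreal (norm (v - w) powr \<gamma> * \<bar>f w\<bar> * \<bar>g v\<bar>
      * (\<bar>H v\<bar> * jb v powr k)) \<partial>sphere_measure \<partial>lborel \<partial>lborel)
    \<le> ennreal (24 * wnorm 1 \<gamma> f * wnorm 2 (k + \<gamma> - l) g * wnorm 2 l H)"
proof -
  note [measurable] = in_wL_borel[OF f] in_wL_borel[OF g] in_wL_borel[OF H]
  have CS: "(\<integral>\<^sup>+v. ennreal (\<bar>g v\<bar> * jb v powr (k + \<gamma> - l)) * ennreal (\<bar>H v\<bar> * jb v powr l) \<partial>lborel)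
    \<le> ennreal (wnorm 2 (k + \<gamma> - l) g * wnorm 2 l H)"
  proof (rule le_ennreal_of_square)
    have "(\<integral>\<^sup>+v. ennreal (\<bar>g v\<bar> * jb v powr (k + \<gamma> - l)) * ennreal (\<bar>H v\<bar> * jb v powr l) \<partial>lborel)\<^sup>2
      \<le> (\<integral>\<^sup>+v. (ennreal (\<bar>g v\<bar> * jb v powr (k + \<gamma> - l)))\<^sup>2 \<partial>lborel) * (\<integral>\<^sup>+v. (ennreal (\<bar>H v\<bar> * jb v powr l))\<^sup>2 \<partial>lborel)"
      by (rule Cauchy_Schwarz_nn_integral) measurable
    also have "\<dots> = wint 2 (k + \<gamma> - l) g * wint 2 l H"
      unfolding wint_2_eq by (simp add: ennreal_power)
    also have "\<dots> = ennreal ((wnorm 2 (k + \<gamma> - l) g * wnorm 2 l H)\<^sup>2)"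
      unfolding wint_2_wnorm[OF g] wint_2_wnorm[OF H] by (subst ennreal_mult[symmetric]) (auto simp: power_mult_distrib)
    finally show "(\<integral>\<^sup>+v. ennreal (\<bar>g v\<bar> * jb v powr (k + \<gamma> - l)) * ennreal (\<bar>H v\<bar> * jb v powr l) \<partial>lborel)\<^sup>2 \<le> \<dots>" .
  qed (simp add: wnorm_nonneg)
  have "(\<integral>\<^sup>+v. \<integral>\<^sup>+w. \<integral>\<^sup>+\<sigma>. ennreal (norm (v - w) powr \<gamma> * \<bar>f w\<bar> * \<bar>g v\<bar>
      * (\<bar>H v\<bar> * jb v powr k)) \<partial>sphere_measure \<partial>lborel \<partial>lborel)
    \<le> (\<integral>\<^sup>+v. \<integral>\<^sup>+w. \<integral>\<^sup>+\<sigma>. (ennreal (\<bar>g v\<bar> * jb v powr (k + \<gamma> - l)) * ennreal (\<bar>H v\<bar> * jb v powr l))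
        * ennreal (\<bar>f w\<bar> * jb w powr \<gamma>) \<partial>(sphere_measure) \<partial>lborel \<partial>lborel)"
  proof (intro nn_integral_mono)
    fix v w \<sigma> :: "real^3"
    have "norm (v - w) powr \<gamma> \<le> (jb v * jb w) powr \<gamma>"
      using l norm_diff_le_jb by (intro powr_mono2) auto
    also have "\<dots> = jb v powr \<gamma> * jb w powr \<gamma>"
      using jb_pos by (simp add: powr_mult less_imp_le)
    finally have "norm (v - w) powr \<gamma> * (\<bar>f w\<bar> * \<bar>g v\<bar> * (\<bar>H v\<bar> * jb v powr k))
        \<le> (jb v powr \<gamma> * jb w powr \<gamma>) * (\<bar>f w\<bar> * \<bar>g v\<bar> * (\<bar>H v\<bar> * jb v powr k))"
      by (rule mult_right_mono) simp
    also have "\<dots> = (\<bar>g v\<bar> * (jb v powr \<gamma> * jb v powr k)) * \<bar>H v\<bar> * (\<bar>f w\<bar> * jb w powr \<gamma>)"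
      by (simp only: mult_ac)
    also have "jb v powr \<gamma> * jb v powr k = jb v powr (k + \<gamma> - l) * jb v powr l"
      by (simp add: add.commute flip: powr_add)
    also have "(\<bar>g v\<bar> * (jb v powr (k + \<gamma> - l) * jb v powr l)) * \<bar>H v\<bar> * (\<bar>f w\<bar> * jb w powr \<gamma>)
      = ((\<bar>g v\<bar> * jb v powr (k + \<gamma> - l)) * (\<bar>H v\<bar> * jb v powr l)) * (\<bar>f w\<bar> * jb w powr \<gamma>)"
      by (simp only: mult_ac)
    finally have "norm (v - w) powr \<gamma> * \<bar>f w\<bar> * \<bar>g v\<bar> * (\<bar>H v\<bar> * jb v powr k)
      \<le> (\<bar>g v\<bar> * jb v powr (k + \<gamma> - l)) * (\<bar>H v\<bar> * jb v powr l) * (\<bar>f w\<bar> * jb w powr \<gamma>)"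
      by (simp only: mult.assoc)
    moreover have "ennreal a * ennreal b * ennreal c = ennreal (a * b * c)" if "0 \<le> a" "0 \<le> b" "0 \<le> c" for a b c
      using that by (simp add: ennreal_mult)
    ultimately show "ennreal (norm (v - w) powr \<gamma> * \<bar>f w\<bar> * \<bar>g v\<bar> * (\<bar>H v\<bar> * jb v powr k))
      \<le> (ennreal (\<bar>g v\<bar> * jb v powr (k + \<gamma> - l)) * ennreal (\<bar>H v\<bar> * jb v powr l)) * ennreal (\<bar>f w\<bar> * jb w powr \<gamma>)"
      by (simp only: ennreal_leI abs_ge_zero powr_ge_zero mult_nonneg_nonneg)
  qed
  also have "\<dots> = (\<integral>\<^sup>+v. ennreal (\<bar>g v\<bar> * jb v powr (k + \<gamma> - l)) * ennreal (\<bar>H v\<bar> * jb v powr l) \<partial>lborel)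
     * (\<integral>\<^sup>+w. ennreal (\<bar>f w\<bar> * jb w powr \<gamma>) \<partial>lborel) * emeasure sphere_measure UNIV"
    by (simp add: nn_integral_cmult nn_integral_multc)
  also have "\<dots> \<le> ennreal (wnorm 2 (k + \<gamma> - l) g * wnorm 2 l H) * ennreal (wnorm 1 \<gamma> f) * ennreal 24"
    unfolding wint_1_wnorm[OF f] using emeasure_sphere_measure_UNIV by (intro mult_mono CS) auto
  also have "\<dots> = ennreal (wnorm 2 (k + \<gamma> - l) g * wnorm 2 l H * wnorm 1 \<gamma> f * 24)"
    using wnorm_nonneg by (simp add: ennreal_mult)
  finally show ?thesis
    by (simp only: mult_ac)
qed

section \<open>The collision operator\<close>

text \<open>Gain and loss are added in absolute value, so the integral always exists in
  \<open>ennreal\<close>. It dominates |\<open>Qcol\<close>| even where the integrand of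
  \<open>Qcol\<close> is not integrable, because the Bochner integral is then 0 by
  convention.\<close>

definition Qabs :: "real \<Rightarrow> (real^3 \<Rightarrow> real) \<Rightarrow> (real^3 \<Rightarrow> real) \<Rightarrow> real^3 \<Rightarrow> ennreal" where
  "Qabs \<gamma> f g v = (\<integral>\<^sup>+w. \<integral>\<^sup>+\<sigma>. ennreal (norm (v - w) powr \<gamma>
    * (\<bar>f (vsprime v w \<sigma>)\<bar> * \<bar>g (vprime v w \<sigma>)\<bar> + \<bar>f w\<bar> * \<bar>g v\<bar>)) \<partial>sphere_measure \<partial>lborel)"

lemma ennreal_abs_integral_le: "ennreal \<bar>\<integral>x. f x \<partial>M\<bar> \<le> (\<integral>\<^sup>+x. ennreal \<bar>f x\<bar> \<partial>M)"
proof (cases "integrable M f")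
  case True
  then show ?thesis
    using integral_norm_bound_ennreal[OF True] by simp
qed (simp add: not_integrable_integral_eq)

lemma ennreal_abs_Qcol_le:
  assumes [measurable]: "f \<in> borel_measurable borel" "g \<in> borel_measurable borel"
  shows "ennreal \<bar>Qcol \<gamma> f g v\<bar> \<le> Qabs \<gamma> f g v"
proof -
  have "ennreal \<bar>Qcol \<gamma> f g v\<bar> \<le> (\<integral>\<^sup>+x. ennreal \<bar>case x of (w, \<sigma>) \<Rightarrow> norm (v - w) powr \<gamma> *
       (f (vsprime v w \<sigma>) * g (vprime v w \<sigma>) - f w * g v)\<bar> \<partial>(lborel \<Otimes>\<^sub>M sphere_measure))"
    unfolding Qcol_def by (rule ennreal_abs_integral_le)
  also have "\<dots> \<le> (\<integral>\<^sup>+x. (case x of (w, \<sigma>) \<Rightarrow> ennreal (norm (v - w) powr \<gamma>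
    * (\<bar>f (vsprime v w \<sigma>)\<bar> * \<bar>g (vprime v w \<sigma>)\<bar> + \<bar>f w\<bar> * \<bar>g v\<bar>))) \<partial>(lborel \<Otimes>\<^sub>M sphere_measure))"
  proof (rule nn_integral_mono)
    fix x :: "(real^3) \<times> (real^3)"
    obtain w \<sigma> where x: "x = (w, \<sigma>)"
      by (cases x)
    have "\<bar>f (vsprime v w \<sigma>) * g (vprime v w \<sigma>) - f w * g v\<bar>
        \<le> \<bar>f (vsprime v w \<sigma>)\<bar> * \<bar>g (vprime v w \<sigma>)\<bar> + \<bar>f w\<bar> * \<bar>g v\<bar>"
      by (metis abs_mult abs_triangle_ineq4)
    then show "ennreal \<bar>case x of (w, \<sigma>) \<Rightarrow> norm (v - w) powr \<gamma> * (f (vsprime v w \<sigma>) * g (vprime v w \<sigma>) - f w * g v)\<bar>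
      \<le> (case x of (w, \<sigma>) \<Rightarrow> ennreal (norm (v - w) powr \<gamma>
    * (\<bar>f (vsprime v w \<sigma>)\<bar> * \<bar>g (vprime v w \<sigma>)\<bar> + \<bar>f w\<bar> * \<bar>g v\<bar>)))"
      unfolding x by (simp add: abs_mult ennreal_leI mult_left_mono)
  qed
  also have "\<dots> = Qabs \<gamma> f g v"
  proof -
    have "(\<integral>\<^sup>+x. (case x of (w, \<sigma>) \<Rightarrow> ennreal (norm (v - w) powr \<gamma>
        * (\<bar>f (vsprime v w \<sigma>)\<bar> * \<bar>g (vprime v w \<sigma>)\<bar> + \<bar>f w\<bar> * \<bar>g v\<bar>))) \<partial>(lborel \<Otimes>\<^sub>M sphere_measure))
      = (\<integral>\<^sup>+w. \<integral>\<^sup>+\<sigma>. (case (w, \<sigma>) of (w, \<sigma>) \<Rightarrow> ennreal (norm (v - w) powr \<gamma>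
        * (\<bar>f (vsprime v w \<sigma>)\<bar> * \<bar>g (vprime v w \<sigma>)\<bar> + \<bar>f w\<bar> * \<bar>g v\<bar>))) \<partial>sphere_measure \<partial>lborel)"
      by (rule sphere.nn_integral_fst[symmetric]) measurable
    then show ?thesis
      unfolding Qabs_def by simp
  qed
  finally show ?thesis .
qed

lemma borel_measurable_Qcol [measurable]:
  assumes [measurable]: "f \<in> borel_measurable borel" "g \<in> borel_measurable borel"
  shows "Qcol \<gamma> f g \<in> borel_measurable borel"
proof -
  interpret ls: pair_sigma_finite "lborel :: (real^3) measure" sphere_measure ..
  show ?thesis
    unfolding Qcol_def[abs_def]
    by (rule sigma_finite_measure.borel_measurable_lebesgue_integral[OF ls.P.sigma_finite_measure_axioms]) measurable
qed

lemma vprime_minus_vsprime: "vprime v w \<sigma> - vsprime v w \<sigma> = norm (v - w) *\<^sub>R \<sigma>"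
  by (simp add: vprime_def vsprime_def vec_eq_iff)

text \<open>The collisional change of variables is applied to the gain part only; it moves the test
  function to v' and leaves \<open>f\<close> and \<open>g\<close> at w and v.\<close>

lemma Qabs_dual_eq:
  assumes [measurable]: "f \<in> borel_measurable borel" "g \<in> borel_measurable borel" "H \<in> borel_measurable borel"
  shows "(\<integral>\<^sup>+v. ennreal (\<bar>H v\<bar> * jb v powr k) * Qabs \<gamma> f g v \<partial>lborel)
    = (\<integral>\<^sup>+v. \<integral>\<^sup>+w. \<integral>\<^sup>+\<sigma>. ennreal (norm (v - w) powr \<gamma> * \<bar>f w\<bar> * \<bar>g v\<bar>
        * (\<bar>H (vprime v w \<sigma>)\<bar> * jb (vprime v w \<sigma>) powr k)) \<partial>sphere_measure \<partial>lborel \<partial>lborel)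
    + (\<integral>\<^sup>+v. \<integral>\<^sup>+w. \<integral>\<^sup>+\<sigma>. ennreal (norm (v - w) powr \<gamma> * \<bar>f w\<bar> * \<bar>g v\<bar>
        * (\<bar>H v\<bar> * jb v powr k)) \<partial>sphere_measure \<partial>lborel \<partial>lborel)"
proof -
  \<comment> \<open>The kernel is written in the last two arguments: before the exchange these are v
    and w; afterwards they are the post-collisional velocities, whose distance is again |v - w| for
    unit \<sigma>.\<close>
  define \<Xi> where "\<Xi> a b c d = ennreal (norm (c - d) powr \<gamma> * \<bar>f b\<bar> * \<bar>g a\<bar> * (\<bar>H c\<bar> * jb c powr k))" for a b c d
  have "(\<integral>\<^sup>+v. ennreal (\<bar>H v\<bar> * jb v powr k) * Qabs \<gamma> f g v \<partial>lborel)
    = (\<integral>\<^sup>+v. \<integral>\<^sup>+w. \<integral>\<^sup>+\<sigma>. ennreal (\<bar>H v\<bar> * jb v powr k) * ennreal (norm (v - w) powr \<gamma>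
    * (\<bar>f (vsprime v w \<sigma>)\<bar> * \<bar>g (vprime v w \<sigma>)\<bar> + \<bar>f w\<bar> * \<bar>g v\<bar>)) \<partial>sphere_measure \<partial>lborel \<partial>lborel)"
    unfolding Qabs_def by (simp add: nn_integral_cmult)
  also have "\<dots> = (\<integral>\<^sup>+v. \<integral>\<^sup>+w. \<integral>\<^sup>+\<sigma>. (\<Xi> (vprime v w \<sigma>) (vsprime v w \<sigma>) v w
      + ennreal (norm (v - w) powr \<gamma> * \<bar>f w\<bar> * \<bar>g v\<bar> * (\<bar>H v\<bar> * jb v powr k))) \<partial>sphere_measure \<partial>lborel \<partial>lborel)"
  proof (intro nn_integral_cong)
    fix v w \<sigma> :: "real^3"
    show "ennreal (\<bar>H v\<bar> * jb v powr k) * ennreal (norm (v - w) powr \<gamma>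
        * (\<bar>f (vsprime v w \<sigma>)\<bar> * \<bar>g (vprime v w \<sigma>)\<bar> + \<bar>f w\<bar> * \<bar>g v\<bar>))
      = \<Xi> (vprime v w \<sigma>) (vsprime v w \<sigma>) v w
        + ennreal (norm (v - w) powr \<gamma> * \<bar>f w\<bar> * \<bar>g v\<bar> * (\<bar>H v\<bar> * jb v powr k))"
      unfolding \<Xi>_def
      by (subst ennreal_mult[symmetric], simp, simp, subst ennreal_plus[symmetric], simp, simp)
         (simp add: algebra_simps)
  qed
  also have "\<dots> = (\<integral>\<^sup>+v. \<integral>\<^sup>+w. \<integral>\<^sup>+\<sigma>. \<Xi> (vprime v w \<sigma>) (vsprime v w \<sigma>) v w \<partial>sphere_measure \<partial>lborel \<partial>lborel)
    + (\<integral>\<^sup>+v. \<integral>\<^sup>+w. \<integral>\<^sup>+\<sigma>. ennreal (norm (v - w) powr \<gamma> * \<bar>f w\<bar> * \<bar>g v\<bar>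
        * (\<bar>H v\<bar> * jb v powr k)) \<partial>sphere_measure \<partial>lborel \<partial>lborel)"
    unfolding \<Xi>_def by (simp add: nn_integral_add)
  also have "(\<integral>\<^sup>+v. \<integral>\<^sup>+w. \<integral>\<^sup>+\<sigma>. \<Xi> (vprime v w \<sigma>) (vsprime v w \<sigma>) v w \<partial>sphere_measure \<partial>lborel \<partial>lborel)
    = (\<integral>\<^sup>+v. \<integral>\<^sup>+w. \<integral>\<^sup>+\<sigma>. \<Xi> v w (vprime v w \<sigma>) (vsprime v w \<sigma>) \<partial>sphere_measure \<partial>lborel \<partial>lborel)"
  proof (rule nn_integral_pre_post_collision[symmetric])
    show "(\<lambda>(a, b, c, d). \<Xi> a b c d) \<in> borel_measurable (borel \<Otimes>\<^sub>M borel \<Otimes>\<^sub>M borel \<Otimes>\<^sub>M borel)"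
      unfolding \<Xi>_def by measurable
  qed
  also have "\<dots> = (\<integral>\<^sup>+v. \<integral>\<^sup>+w. \<integral>\<^sup>+\<sigma>. ennreal (norm (v - w) powr \<gamma> * \<bar>f w\<bar> * \<bar>g v\<bar>
        * (\<bar>H (vprime v w \<sigma>)\<bar> * jb (vprime v w \<sigma>) powr k)) \<partial>sphere_measure \<partial>lborel \<partial>lborel)"
  proof (rule nn_integral_cong, rule nn_integral_cong, rule nn_integral_cong_AE, use AE_norm_sphere_measure in eventually_elim)
    case (elim v w \<sigma>)
    then show ?case
      by (simp add: \<Xi>_def vprime_minus_vsprime)
  qed
  finally show ?thesis .
qed

lemma Qabs_dual_le:
  assumes k: "8 \<le> k" and l: "0 \<le> l" "l \<le> \<gamma>" "\<gamma> \<le> 1"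
    and f: "in_wL 1 \<gamma> f" "in_wL 2 (k + \<gamma> - l) f" and g: "in_wL 1 \<gamma> g" "in_wL 2 (k + \<gamma> - l) g" and H: "in_wL 2 l H"
  shows "(\<integral>\<^sup>+v. ennreal (\<bar>H v\<bar> * jb v powr k) * Qabs \<gamma> f g v \<partial>lborel)
    \<le> ennreal (2 * sqrt (768 * angular_const) / sqrt k * wnorm 1 \<gamma> g * wnorm 2 (k + \<gamma> - l) f * wnorm 2 l H
      + (2 * sqrt (768 * angular_const) + 24) * wnorm 1 \<gamma> f * wnorm 2 (k + \<gamma> - l) g * wnorm 2 l H
      + 2 * weight_const k * angular_const * sqrt (12 * pi) * wnorm 2 k f * wnorm 2 k g * wnorm 2 0 H)"
proof -
  define c where "c = 2 * sqrt (768 * angular_const)"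
  define W where "W = weight_const k * angular_const * sqrt (12 * pi)"
  have c: "0 \<le> c" "c / sqrt k \<le> c"
    using k angular_const_nonneg by (auto simp: c_def divide_le_eq mult_left_le mult_le_cancel_left1)
  have W: "0 \<le> W"
    using weight_const_nonneg angular_const_nonneg by (simp add: W_def)
  define x where "x = wnorm 1 \<gamma> g * wnorm 2 (k + \<gamma> - l) f * wnorm 2 l H"
  define y where "y = wnorm 1 \<gamma> f * wnorm 2 (k + \<gamma> - l) g * wnorm 2 l H"
  define z where "z = wnorm 2 k f * wnorm 2 k g * wnorm 2 0 H"
  have nn: "0 \<le> x" "0 \<le> y" "0 \<le> z"
    by (auto simp: x_def y_def z_def wnorm_nonneg)
  have "(\<integral>\<^sup>+v. ennreal (\<bar>H v\<bar> * jb v powr k) * Qabs \<gamma> f g v \<partial>lborel)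
    \<le> (ennreal (2 * sqrt (768 * angular_const) / sqrt k * wnorm 1 \<gamma> g * wnorm 2 (k + \<gamma> - l) f * wnorm 2 l H
        + weight_const k * angular_const * sqrt (12 * pi) * wnorm 2 k f * wnorm 2 k g * wnorm 2 0 H)
    + ennreal (2 * sqrt (768 * angular_const) / sqrt k * wnorm 1 \<gamma> f * wnorm 2 (k + \<gamma> - l) g * wnorm 2 l H
        + weight_const k * angular_const * sqrt (12 * pi) * wnorm 2 k g * wnorm 2 k f * wnorm 2 0 H))
    + ennreal (24 * wnorm 1 \<gamma> f * wnorm 2 (k + \<gamma> - l) g * wnorm 2 l H)"
    unfolding Qabs_dual_eq[OF in_wL_borel[OF f(1)] in_wL_borel[OF g(1)] in_wL_borel[OF H]]
    using l by (intro add_mono gain_le[OF k l f g H] loss_le f(1) g(2) H) auto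
  also have "\<dots> = (ennreal (c / sqrt k * x + W * z) + ennreal (c / sqrt k * y + W * z)) + ennreal (24 * y)"
    unfolding c_def W_def x_def y_def z_def by (simp only: mult_ac)
  also have "\<dots> = ennreal (c / sqrt k * x + W * z + (c / sqrt k * y + W * z) + 24 * y)"
    using c W nn k by (simp flip: ennreal_plus)
  also have "\<dots> \<le> ennreal (c / sqrt k * x + (c + 24) * y + 2 * W * z)"
  proof (rule ennreal_leI)
    \<comment> \<open>The 1/sqrt k of the mirrored gain region is given up, because the loss term
      has the same norms with the constant 24 and no decay.\<close>
    have "c / sqrt k * y \<le> c * y"
      by (rule mult_right_mono[OF c(2) nn(2)])
    then show "c / sqrt k * x + W * z + (c / sqrt k * y + W * z) + 24 * y \<le> c / sqrt k * x + (c + 24) * y + 2 * W * z"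
      by (simp add: algebra_simps)
  qed
  finally show ?thesis
    unfolding c_def W_def x_def y_def z_def by (simp only: mult.assoc)
qed

section \<open>Duality and the two inequalities\<close>

text \<open>\<open>X\<close> is not known to be square integrable, so it cannot be its own test
  function. Its truncations \<open>H n\<close>, in size and in support, are admissible: their
  squared norm is at most the pairing with |X|, hence at most B times their norm. Dividing gives the
  bound B for each n, and Fatou's lemma passes to the limit.\<close>

lemma nn_integral_square_le_dual:
  fixes X :: "real^3 \<Rightarrow> real"
  assumes [measurable]: "X \<in> borel_measurable borel" and B: "0 \<le> B"
    and dual: "\<And>H. in_wL 2 0 H \<Longrightarrow> (\<integral>\<^sup>+v. ennreal (\<bar>H v\<bar> * \<bar>X v\<bar>) \<partial>lborel) \<le> ennreal (B * wnorm 2 0 H)"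
  shows "(\<integral>\<^sup>+v. ennreal ((X v)\<^sup>2) \<partial>lborel) \<le> ennreal (B\<^sup>2)"
proof -
  define H where "H n v = indicator (cball 0 (real n)) v * min \<bar>X v\<bar> (real n)" for n :: nat and v :: "real^3"
  have [measurable]: "cball (0::real^3) (real n) \<in> sets borel" for n
    by simp
  have [measurable]: "H n \<in> borel_measurable borel" for n
    unfolding H_def by measurable
  have H0: "0 \<le> H n v" "H n v \<le> \<bar>X v\<bar>" for n v
    by (auto simp: H_def indicator_def)
  have wint_H: "wint 2 0 (H n) = (\<integral>\<^sup>+v. ennreal ((H n v)\<^sup>2) \<partial>lborel)" for n
    unfolding wint_2_eq using H0 by (intro nn_integral_cong) (simp add: less_imp_neq[OF jb_pos, symmetric])
  have fin: "in_wL 2 0 (H n)" for n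
  proof -
    have "wint 2 0 (H n) \<le> (\<integral>\<^sup>+v. ennreal ((real n)\<^sup>2) * indicator (cball (0::real^3) (real n)) v \<partial>lborel)"
      unfolding wint_H by (intro nn_integral_mono) (auto simp: H_def indicator_def intro!: ennreal_leI power_mono)
    also have "\<dots> = ennreal ((real n)\<^sup>2) * emeasure lborel (cball (0::real^3) (real n))"
      by (rule nn_integral_cmult_indicator) simp
    also have "\<dots> < \<infinity>"
      using emeasure_lborel_cball_finite[of "0::real^3" "real n"] by (simp add: ennreal_mult_less_top)
    finally show ?thesis
      by (simp add: in_wL_def)
  qed
  have bound: "(\<integral>\<^sup>+v. ennreal ((H n v)\<^sup>2) \<partial>lborel) \<le> ennreal (B\<^sup>2)" for n
  proof -
    let ?y = "wnorm 2 0 (H n)"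
    have e: "(\<integral>\<^sup>+v. ennreal ((H n v)\<^sup>2) \<partial>lborel) = ennreal (?y\<^sup>2)"
      unfolding wint_H[symmetric] by (rule wint_2_wnorm[OF fin])
    have "ennreal (?y\<^sup>2) \<le> (\<integral>\<^sup>+v. ennreal (\<bar>H n v\<bar> * \<bar>X v\<bar>) \<partial>lborel)"
      unfolding e[symmetric] using H0
      by (intro nn_integral_mono ennreal_leI) (auto simp: power2_eq_square intro!: mult_left_mono)
    also have "\<dots> \<le> ennreal (B * ?y)"
      by (rule dual[OF fin])
    finally have "?y\<^sup>2 \<le> B * ?y"
      using B wnorm_nonneg by simp
    then have "?y \<le> B"
      using wnorm_nonneg[of 2 0 "H n"] B by (cases "?y = 0") (auto simp: power2_eq_square)
    then show ?thesis
      unfolding e using wnorm_nonneg by (intro ennreal_leI power_mono) auto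
  qed
  have "(\<integral>\<^sup>+v. ennreal ((X v)\<^sup>2) \<partial>lborel) = (\<integral>\<^sup>+v. liminf (\<lambda>n. ennreal ((H n v)\<^sup>2)) \<partial>lborel)"
  proof (rule nn_integral_cong)
    fix v :: "real^3"
    have "\<forall>\<^sub>F n in sequentially. ennreal ((H n v)\<^sup>2) = ennreal ((X v)\<^sup>2)"
      using eventually_ge_at_top[of "nat \<lceil>max (norm v) \<bar>X v\<bar>\<rceil>"]
    proof eventually_elim
      case (elim n)
      then have "norm v \<le> real n" "\<bar>X v\<bar> \<le> real n"
        by linarith+
      then show ?case
        by (simp add: H_def)
    qed
    then have "(\<lambda>n. ennreal ((H n v)\<^sup>2)) \<longlonglongrightarrow> ennreal ((X v)\<^sup>2)"
      by (rule tendsto_eventually)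
    then show "ennreal ((X v)\<^sup>2) = liminf (\<lambda>n. ennreal ((H n v)\<^sup>2))"
      using lim_imp_Liminf[OF sequentially_bot] by metis
  qed
  also have "\<dots> \<le> liminf (\<lambda>n. \<integral>\<^sup>+v. ennreal ((H n v)\<^sup>2) \<partial>lborel)"
    by (rule nn_integral_liminf) measurable
  also have "\<dots> \<le> liminf (\<lambda>n::nat. ennreal (B\<^sup>2))"
    by (intro Liminf_mono always_eventually allI bound)
  also have "\<dots> = ennreal (B\<^sup>2)"
    by (simp add: Liminf_const)
  finally show ?thesis .
qed

text \<open>Half of the weight <v>^(2k) is absorbed into H = h <v>^k, whose norm in L^2_l is that of
  \<open>h\<close> in L^2_(k+l). The choice l = \<gamma>/2 then distributes the kernel weight
  evenly.\<close>

lemma Qcol_inner_le: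
  assumes k: "8 \<le> k" and \<gamma>: "0 \<le> \<gamma>" "\<gamma> \<le> 1"
    and f: "in_wL 1 \<gamma> f" "in_wL 2 (k + \<gamma>/2) f" and g: "in_wL 1 \<gamma> g" "in_wL 2 (k + \<gamma>/2) g" and h: "in_wL 2 (k + \<gamma>/2) h"
  shows "(\<integral> v. Qcol \<gamma> f g v * (h v * jb v powr (2 * k)) \<partial>lborel)
    \<le> 2 * sqrt (768 * angular_const) / sqrt k * wnorm 1 \<gamma> g * wnorm 2 (k + \<gamma>/2) f * wnorm 2 (k + \<gamma>/2) h
      + (2 * sqrt (768 * angular_const) + 24) * wnorm 1 \<gamma> f * wnorm 2 (k + \<gamma>/2) g * wnorm 2 (k + \<gamma>/2) h
      + 2 * weight_const k * angular_const * sqrt (12 * pi) * wnorm 2 k f * wnorm 2 k g * wnorm 2 k h" (is "_ \<le> ?R")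
proof -
  note [measurable] = in_wL_borel[OF f(1)] in_wL_borel[OF g(1)] in_wL_borel[OF h]
  define H where "H v = h v * jb v powr k" for v
  have wH: "wint 2 l H = wint 2 (k + l) h" for l
    unfolding wint_2_eq H_def by (intro nn_integral_cong) (simp add: abs_mult mult.assoc flip: powr_add)
  have nH: "wnorm 2 l H = wnorm 2 (k + l) h" for l
    unfolding wnorm_def wH ..
  have H: "in_wL 2 (\<gamma>/2) H"
    using h unfolding in_wL_def wH by (simp add: H_def[abs_def])
  have kg: "k + \<gamma> - \<gamma>/2 = k + \<gamma>/2"
    by simp
  have R: "0 \<le> ?R"
    using k angular_const_nonneg weight_const_nonneg wnorm_nonneg
    by (intro add_nonneg_nonneg mult_nonneg_nonneg divide_nonneg_nonneg) auto
  have "ennreal \<bar>\<integral> v. Qcol \<gamma> f g v * (h v * jb v powr (2 * k)) \<partial>lborel\<bar>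
      \<le> (\<integral>\<^sup>+v. ennreal \<bar>Qcol \<gamma> f g v * (h v * jb v powr (2 * k))\<bar> \<partial>lborel)"
    by (rule ennreal_abs_integral_le)
  also have "\<dots> \<le> (\<integral>\<^sup>+v. ennreal (\<bar>H v\<bar> * jb v powr k) * Qabs \<gamma> f g v \<partial>lborel)"
  proof (rule nn_integral_mono)
    fix v
    have "jb v powr (2 * k) = jb v powr k * jb v powr k"
      by (simp flip: powr_add)
    then have "\<bar>Qcol \<gamma> f g v * (h v * jb v powr (2 * k))\<bar> = (\<bar>H v\<bar> * jb v powr k) * \<bar>Qcol \<gamma> f g v\<bar>"
      by (simp add: H_def abs_mult)
    then show "ennreal \<bar>Qcol \<gamma> f g v * (h v * jb v powr (2 * k))\<bar> \<le> ennreal (\<bar>H v\<bar> * jb v powr k) * Qabs \<gamma> f g v"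
      by (simp add: ennreal_mult del: abs_mult) (intro mult_left_mono ennreal_abs_Qcol_le; simp)
  qed
  also have "\<dots> \<le> ennreal ?R"
    using Qabs_dual_le[OF k _ _ \<gamma>(2), of "\<gamma>/2" f g H] \<gamma> f g H
    unfolding nH kg by simp
  finally show ?thesis
    using R by (simp add: abs_le_iff)
qed

text \<open>The function |Q| <v>^k is tested against arbitrary \<open>H\<close> in unweighted L^2,
  so l = 0. Membership in the weighted space comes out of the duality bound and is not
  assumed.\<close>

lemma Qcol_weighted_L2_le:
  assumes k: "8 \<le> k" and \<gamma>: "0 \<le> \<gamma>" "\<gamma> \<le> 1"
    and f: "in_wL 1 \<gamma> f" "in_wL 2 (k + \<gamma>) f" and g: "in_wL 1 \<gamma> g" "in_wL 2 (k + \<gamma>) g"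
  shows "in_wL 2 k (Qcol \<gamma> f g)"
    and "wnorm 2 k (Qcol \<gamma> f g)
    \<le> 2 * sqrt (768 * angular_const) / sqrt k * wnorm 1 \<gamma> g * wnorm 2 (k + \<gamma>) f
      + (2 * sqrt (768 * angular_const) + 24) * wnorm 1 \<gamma> f * wnorm 2 (k + \<gamma>) g
      + 2 * weight_const k * angular_const * sqrt (12 * pi) * wnorm 2 k f * wnorm 2 k g" (is "_ \<le> ?B")
proof -
  note [measurable] = in_wL_borel[OF f(1)] in_wL_borel[OF g(1)]
  have B: "0 \<le> ?B"
    using k angular_const_nonneg weight_const_nonneg wnorm_nonneg
    by (intro add_nonneg_nonneg mult_nonneg_nonneg divide_nonneg_nonneg) auto
  define X where "X v = \<bar>Qcol \<gamma> f g v\<bar> * jb v powr k" for v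
  have [measurable]: "X \<in> borel_measurable borel"
    unfolding X_def by measurable
  have "(\<integral>\<^sup>+v. ennreal ((X v)\<^sup>2) \<partial>lborel) \<le> ennreal (?B\<^sup>2)"
  proof (rule nn_integral_square_le_dual[OF _ B])
    fix H assume H: "in_wL 2 0 H"
    have "(\<integral>\<^sup>+v. ennreal (\<bar>H v\<bar> * \<bar>X v\<bar>) \<partial>lborel) \<le> (\<integral>\<^sup>+v. ennreal (\<bar>H v\<bar> * jb v powr k) * Qabs \<gamma> f g v \<partial>lborel)"
    proof (rule nn_integral_mono)
      fix v
      have "\<bar>H v\<bar> * \<bar>X v\<bar> = (\<bar>H v\<bar> * jb v powr k) * \<bar>Qcol \<gamma> f g v\<bar>"
        by (simp add: X_def abs_mult)
      then have "ennreal (\<bar>H v\<bar> * \<bar>X v\<bar>) = ennreal (\<bar>H v\<bar> * jb v powr k) * ennreal \<bar>Qcol \<gamma> f g v\<bar>"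
        by (simp only: ennreal_mult[OF mult_nonneg_nonneg[OF abs_ge_zero powr_ge_zero] abs_ge_zero])
      then show "ennreal (\<bar>H v\<bar> * \<bar>X v\<bar>) \<le> ennreal (\<bar>H v\<bar> * jb v powr k) * Qabs \<gamma> f g v"
        by (simp only:) (intro mult_left_mono ennreal_abs_Qcol_le; simp)
    qed
    also have "\<dots> \<le> ennreal (?B * wnorm 2 0 H)"
      \<comment> \<open>Matching the hypothesis \<open>l \<le> \<gamma>\<close> with
        \<open>0 \<le> \<gamma>\<close> fixes l = 0.\<close>
      using Qabs_dual_le[OF k _ \<gamma>, of f g H] f g H by (simp add: distrib_right)
    finally show "(\<integral>\<^sup>+v. ennreal (\<bar>H v\<bar> * \<bar>X v\<bar>) \<partial>lborel) \<le> ennreal (?B * wnorm 2 0 H)" .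
  qed simp
  then have le: "wint 2 k (Qcol \<gamma> f g) \<le> ennreal (?B\<^sup>2)"
    unfolding wint_2_eq X_def .
  then show in_wL: "in_wL 2 k (Qcol \<gamma> f g)"
    unfolding in_wL_def by (auto intro: le_less_trans[OF _ ennreal_less_top])
  have "(wnorm 2 k (Qcol \<gamma> f g))\<^sup>2 \<le> ?B\<^sup>2"
    using le unfolding wint_2_wnorm[OF in_wL] by simp
  then show "wnorm 2 k (Qcol \<gamma> f g) \<le> ?B"
    using B by (rule power2_le_imp_le)
qed

theorem theorem2p1:
  "\<exists>C1 C2 :: real. \<forall>k :: real. k \<ge> 8 \<longrightarrow> (\<exists>Ck :: real. \<forall>\<gamma> :: real. 0 \<le> \<gamma> \<and> \<gamma> \<le> 1 \<longrightarrow>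
     (\<forall>f g h :: real^3 \<Rightarrow> real.
       ((in_wL 1 \<gamma> f \<and> in_wL 1 \<gamma> g \<and> in_wL 2 (k + \<gamma>/2) f \<and> in_wL 2 (k + \<gamma>/2) g
           \<and> in_wL 2 (k + \<gamma>/2) h) \<longrightarrow>
         (\<integral> v. Qcol \<gamma> f g v * (h v * jb v powr (2 * k)) \<partial>lborel)
           \<le> C1 / sqrt k * wnorm 1 \<gamma> g * wnorm 2 (k + \<gamma>/2) f * wnorm 2 (k + \<gamma>/2) h
            + C2 * wnorm 1 \<gamma> f * wnorm 2 (k + \<gamma>/2) g * wnorm 2 (k + \<gamma>/2) h
            + Ck * wnorm 2 k f * wnorm 2 k g * wnorm 2 k h)
     \<and> ((in_wL 1 \<gamma> f \<and> in_wL 1 \<gamma> g \<and> in_wL 2 (k + \<gamma>) f \<and> in_wL 2 (k + \<gamma>) g) \<longrightarrow>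
         in_wL 2 k (Qcol \<gamma> f g) \<and>
         wnorm 2 k (Qcol \<gamma> f g)
           \<le> C1 / sqrt k * wnorm 1 \<gamma> g * wnorm 2 (k + \<gamma>) f
            + C2 * wnorm 1 \<gamma> f * wnorm 2 (k + \<gamma>) g
            + Ck * wnorm 2 k f * wnorm 2 k g)))"
\<comment> \<open>In C_1 the 2 is the factor of \<open>powr_weight_split\<close>, 768 bounds the
  angular integral times k, and \<open>angular_const\<close> comes from the integral of H(v')^2. C_2
  is the gain bound of the mirrored region plus the area bound 24 of the loss term.\<close>
proof (rule exI[of _ "2 * sqrt (768 * angular_const)"], rule exI[of _ "2 * sqrt (768 * angular_const) + 24"], rule allI, rule impI)
  fix k :: real assume k: "8 \<le> k"
  show "\<exists>Ck :: real. \<forall>\<gamma> :: real. 0 \<le> \<gamma> \<and> \<gamma> \<le> 1 \<longrightarrow>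
     (\<forall>f g h :: real^3 \<Rightarrow> real.
       ((in_wL 1 \<gamma> f \<and> in_wL 1 \<gamma> g \<and> in_wL 2 (k + \<gamma>/2) f \<and> in_wL 2 (k + \<gamma>/2) g
           \<and> in_wL 2 (k + \<gamma>/2) h) \<longrightarrow>
         (\<integral> v. Qcol \<gamma> f g v * (h v * jb v powr (2 * k)) \<partial>lborel)
           \<le> 2 * sqrt (768 * angular_const) / sqrt k * wnorm 1 \<gamma> g * wnorm 2 (k + \<gamma>/2) f * wnorm 2 (k + \<gamma>/2) h
            + (2 * sqrt (768 * angular_const) + 24) * wnorm 1 \<gamma> f * wnorm 2 (k + \<gamma>/2) g * wnorm 2 (k + \<gamma>/2) h
            + Ck * wnorm 2 k f * wnorm 2 k g * wnorm 2 k h)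
     \<and> ((in_wL 1 \<gamma> f \<and> in_wL 1 \<gamma> g \<and> in_wL 2 (k + \<gamma>) f \<and> in_wL 2 (k + \<gamma>) g) \<longrightarrow>
         in_wL 2 k (Qcol \<gamma> f g) \<and>
         wnorm 2 k (Qcol \<gamma> f g)
           \<le> 2 * sqrt (768 * angular_const) / sqrt k * wnorm 1 \<gamma> g * wnorm 2 (k + \<gamma>) f
            + (2 * sqrt (768 * angular_const) + 24) * wnorm 1 \<gamma> f * wnorm 2 (k + \<gamma>) g
            + Ck * wnorm 2 k f * wnorm 2 k g))"
  \<comment> \<open>The factor 2 counts the regions <v> <= <w> and <w> <= <v>;
    \<open>sqrt (12 * pi)\<close> stems from \<open>nn_integral_jb_sq_le\<close>. The value does not
    involve \<gamma>, as the order of quantifiers demands.\<close>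
  proof (rule exI[of _ "2 * weight_const k * angular_const * sqrt (12 * pi)"], intro allI impI conjI; elim conjE)
  qed (rule Qcol_inner_le Qcol_weighted_L2_le; (rule k | assumption))+
qed

end
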